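(* Let $M=\{M_\gamma\}_{\gamma\in\Gamma}$ and $N=\{N_\omega\}_{\omega\in\Omega}$ be defining families of functions on $\mathbb R^{k_1}$ and $\mathbb R^{k_2}$ respectively, and let $\Phi\colon\mathcal K(M)\times\mathcal K(N)\to\mathcal K(M\otimes N)$ be the bilinear map $\Phi(f,g)(x,y)=f(x)g(y)$. Suppose $N$ satisfies: (I) for every $\omega\in\Omega$ there exist $\omega'\in\Omega$ and a bounded integrable nonnegative function $L$ on $\mathbb R^{k_2}$ with $N_\omega\le LN_{\omega'}$ and $L(y)\to0$ as $|y|\to\infty$; (II) for every $\omega\in\Omega$ there exist $\omega'\in\Omega$, a neighborhood $B$ of the origin in $\mathbb R^{k_2}$ and $C>0$ with $N_\omega(y)\le CN_{\omega'}(y+y')$ for all $y\in\mathbb R^{k_2}$, $y'\in B$. Then $\Phi$ induces a topological isomorphism $\mathcal K(M)\widehat{\otimes}_\pi\mathcal K(N)\simeq\mathcal K(M\otimes N)$.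
   Context: A defining family of functions on $\mathbb R^k$ is a family $M=\{M_\gamma\}_{\gamma\in\Gamma}$ of nonnegative measurable functions on $\mathbb R^k$, each bounded on bounded subsets of $\mathbb R^k$, such that: (a) for all $\gamma_1,\gamma_2\in\Gamma$ there are $\gamma\in\Gamma$ and $C>0$ with $M_\gamma\ge C(M_{\gamma_1}+M_{\gamma_2})$; (b) there is a countable $\Gamma'\subset\Gamma$ such that for every $\gamma\in\Gamma$ there are $\gamma'\in\Gamma'$ and $C>0$ with $CM_\gamma\le M_{\gamma'}$; (c) for every $x\in\mathbb R^k$ there are $\gamma\in\Gamma$, a neighborhood $O(x)$ of $x$ and $C>0$ with $M_\gamma(x')\ge C$ for all $x'\in O(x)$. $\mathcal K(M)$ is the space of smooth functions $f$ on $\mathbb R^k$ with finite seminorms $\|f\|_{\gamma,m}=\sup_{x\in\mathbb R^k,|\mu|\le m}M_\gamma(x)|\partial^\mu f(x)|$ for all $\gamma\in\Gamma$, $m\in\mathbb Z_+$, topologized by these seminorms. $M\otimes N$ is the defining family on $\mathbb R^{k_1+k_2}$ given by $(M\otimes N)_{\gamma\omega}(x,y)=M_\gamma(x)N_\omega(y)$, $(\gamma,\omega)\in\Gamma\times\Omega$. $\widehat{\otimes}_\pi$ denotes the completed projective tensor product. *)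

theory Defs
  imports "HOL-Analysis.Analysis"
begin

definition defining_family :: "('g \<Rightarrow> 'a::euclidean_space \<Rightarrow> real) \<Rightarrow> bool" where
  "defining_family M \<longleftrightarrow>
     (\<forall>\<gamma>. M \<gamma> \<in> borel_measurable lebesgue) \<and>
     (\<forall>\<gamma> x. 0 \<le> M \<gamma> x) \<and>
     (\<forall>\<gamma> S. bounded S \<longrightarrow> bdd_above (M \<gamma> ` S)) \<and>
     (\<forall>\<gamma>1 \<gamma>2. \<exists>\<gamma> C. C > 0 \<and> (\<forall>x. M \<gamma> x \<ge> C * (M \<gamma>1 x + M \<gamma>2 x))) \<and>
     (\<exists>\<Gamma>'. countable \<Gamma>' \<and> (\<forall>\<gamma>. \<exists>\<gamma>'\<in>\<Gamma>'. \<exists>C>0. \<forall>x. C * M \<gamma> x \<le> M \<gamma>' x)) \<and>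
     (\<forall>x. \<exists>\<gamma> U C. open U \<and> x \<in> U \<and> C > 0 \<and> (\<forall>x'\<in>U. M \<gamma> x' \<ge> C))"

definition tensor_family ::
  "('g \<Rightarrow> 'a \<Rightarrow> real) \<Rightarrow> ('w \<Rightarrow> 'b \<Rightarrow> real) \<Rightarrow> ('g \<times> 'w) \<Rightarrow> ('a \<times> 'b) \<Rightarrow> real" where
  "tensor_family M N = (\<lambda>(\<gamma>, \<omega>) (x, y). M \<gamma> x * N \<omega> y)"

primrec pdl :: "'a::euclidean_space list \<Rightarrow> ('a \<Rightarrow> complex) \<Rightarrow> 'a \<Rightarrow> complex" where
  "pdl [] f = f"
| "pdl (b # bs) f = (\<lambda>x. frechet_derivative (pdl bs f) (at x) b)"

definition smooth_fun :: "('a::euclidean_space \<Rightarrow> complex) \<Rightarrow> bool" where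
  "smooth_fun f \<longleftrightarrow> (\<forall>bs. set bs \<subseteq> Basis \<longrightarrow> (\<forall>x. pdl bs f differentiable (at x)))"

definition K_vals :: "('g \<Rightarrow> 'a::euclidean_space \<Rightarrow> real) \<Rightarrow> 'g \<Rightarrow> nat \<Rightarrow> ('a \<Rightarrow> complex) \<Rightarrow> real set" where
  "K_vals M \<gamma> m f = {M \<gamma> x * norm (pdl bs f x) | x bs. set bs \<subseteq> Basis \<and> length bs \<le> m}"

definition K_space :: "('g \<Rightarrow> 'a::euclidean_space \<Rightarrow> real) \<Rightarrow> ('a \<Rightarrow> complex) set" where
  "K_space M = {f. smooth_fun f \<and> (\<forall>\<gamma> m. bdd_above (K_vals M \<gamma> m f))}"

definition K_seminorm :: "('g \<Rightarrow> 'a::euclidean_space \<Rightarrow> real) \<Rightarrow> 'g \<times> nat \<Rightarrow> ('a \<Rightarrow> complex) \<Rightarrow> real" where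
  "K_seminorm M = (\<lambda>(\<gamma>, m) f. Sup (K_vals M \<gamma> m f))"

definition seminormed_space :: "('x \<Rightarrow> complex) set \<Rightarrow> ('i \<Rightarrow> ('x \<Rightarrow> complex) \<Rightarrow> real) \<Rightarrow> bool" where
  "seminormed_space V p \<longleftrightarrow>
     (\<lambda>x. 0) \<in> V \<and> (\<forall>f\<in>V. \<forall>g\<in>V. (\<lambda>x. f x + g x) \<in> V) \<and> (\<forall>c. \<forall>f\<in>V. (\<lambda>x. c * f x) \<in> V) \<and>
     (\<forall>i. \<forall>f\<in>V. 0 \<le> p i f) \<and>
     (\<forall>i c. \<forall>f\<in>V. p i (\<lambda>x. c * f x) = norm c * p i f) \<and>
     (\<forall>i. \<forall>f\<in>V. \<forall>g\<in>V. p i (\<lambda>x. f x + g x) \<le> p i f + p i g)"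

definition hausdorff_space_sn :: "('x \<Rightarrow> complex) set \<Rightarrow> ('i \<Rightarrow> ('x \<Rightarrow> complex) \<Rightarrow> real) \<Rightarrow> bool" where
  "hausdorff_space_sn V p \<longleftrightarrow> (\<forall>f\<in>V. (\<forall>i. p i f = 0) \<longrightarrow> f = (\<lambda>x. 0))"

definition complete_space_sn :: "('x \<Rightarrow> complex) set \<Rightarrow> ('i \<Rightarrow> ('x \<Rightarrow> complex) \<Rightarrow> real) \<Rightarrow> bool" where
  "complete_space_sn V p \<longleftrightarrow>
     (\<forall>F. F \<noteq> bot \<and> eventually (\<lambda>h. h \<in> V) F \<and>
          (\<forall>i \<epsilon>. \<epsilon> > 0 \<longrightarrow> (\<exists>A. eventually (\<lambda>h. h \<in> A) F \<and>
              (\<forall>h1\<in>A \<inter> V. \<forall>h2\<in>A \<inter> V. p i (\<lambda>x. h1 x - h2 x) < \<epsilon>)))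
        \<longrightarrow> (\<exists>h\<in>V. \<forall>i \<epsilon>. \<epsilon> > 0 \<longrightarrow> eventually (\<lambda>h'. p i (\<lambda>x. h' x - h x) < \<epsilon>) F))"

definition tensor_sums ::
  "('a \<Rightarrow> complex) set \<Rightarrow> ('b \<Rightarrow> complex) set \<Rightarrow> (('a \<Rightarrow> complex) \<Rightarrow> ('b \<Rightarrow> complex) \<Rightarrow> ('c \<Rightarrow> complex))
   \<Rightarrow> ('c \<Rightarrow> complex) set" where
  "tensor_sums VE VF \<Phi> = {h. \<exists>(n::nat) f g. (\<forall>i<n. f i \<in> VE \<and> g i \<in> VF) \<and> h = (\<lambda>z. \<Sum>i<n. \<Phi> (f i) (g i) z)}"

text \<open>Projective seminorm pi_{P,Q} on the algebraic tensor product, for the continuous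
  seminorms P = sum over I of pE, Q = sum over J of pF.\<close>
definition proj_seminorm ::
  "('a \<Rightarrow> complex) set \<Rightarrow> ('i \<Rightarrow> ('a \<Rightarrow> complex) \<Rightarrow> real) \<Rightarrow>
   ('b \<Rightarrow> complex) set \<Rightarrow> ('j \<Rightarrow> ('b \<Rightarrow> complex) \<Rightarrow> real) \<Rightarrow>
   (('a \<Rightarrow> complex) \<Rightarrow> ('b \<Rightarrow> complex) \<Rightarrow> ('c \<Rightarrow> complex)) \<Rightarrow> 'i set \<Rightarrow> 'j set \<Rightarrow> ('c \<Rightarrow> complex) \<Rightarrow> real" where
  "proj_seminorm VE pE VF pF \<Phi> I J h =
     Inf {\<Sum>i<n. (\<Sum>a\<in>I. pE a (f i)) * (\<Sum>b\<in>J. pF b (g i)) | (n::nat) f g.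
            (\<forall>i<n. f i \<in> VE \<and> g i \<in> VF) \<and> h = (\<lambda>z. \<Sum>i<n. \<Phi> (f i) (g i) z)}"

text \<open>(VG, pG) together with the bilinear map Phi is (a realisation of) the completed
  projective tensor product of (VE, pE) and (VF, pF), i.e. Phi induces a topological
  isomorphism of the completion of the projective tensor product onto (VG, pG).\<close>
definition completed_proj_tensor ::
  "('a \<Rightarrow> complex) set \<Rightarrow> ('i \<Rightarrow> ('a \<Rightarrow> complex) \<Rightarrow> real) \<Rightarrow>
   ('b \<Rightarrow> complex) set \<Rightarrow> ('j \<Rightarrow> ('b \<Rightarrow> complex) \<Rightarrow> real) \<Rightarrow>
   ('c \<Rightarrow> complex) set \<Rightarrow> ('k \<Rightarrow> ('c \<Rightarrow> complex) \<Rightarrow> real) \<Rightarrow>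
   (('a \<Rightarrow> complex) \<Rightarrow> ('b \<Rightarrow> complex) \<Rightarrow> ('c \<Rightarrow> complex)) \<Rightarrow> bool" where
  "completed_proj_tensor VE pE VF pF VG pG \<Phi> \<longleftrightarrow>
     seminormed_space VE pE \<and> seminormed_space VF pF \<and> seminormed_space VG pG \<and>
     hausdorff_space_sn VG pG \<and> complete_space_sn VG pG \<and>
     \<comment> \<open>Phi is a bilinear map VE x VF -> VG\<close>
     (\<forall>f\<in>VE. \<forall>g\<in>VF. \<Phi> f g \<in> VG) \<and>
     (\<forall>f1\<in>VE. \<forall>f2\<in>VE. \<forall>g\<in>VF. \<Phi> (\<lambda>x. f1 x + f2 x) g = (\<lambda>z. \<Phi> f1 g z + \<Phi> f2 g z)) \<and>
     (\<forall>f\<in>VE. \<forall>g1\<in>VF. \<forall>g2\<in>VF. \<Phi> f (\<lambda>y. g1 y + g2 y) = (\<lambda>z. \<Phi> f g1 z + \<Phi> f g2 z)) \<and>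
     (\<forall>c. \<forall>f\<in>VE. \<forall>g\<in>VF. \<Phi> (\<lambda>x. c * f x) g = (\<lambda>z. c * \<Phi> f g z) \<and> \<Phi> f (\<lambda>y. c * g y) = (\<lambda>z. c * \<Phi> f g z)) \<and>
     \<comment> \<open>the induced linear map from the algebraic tensor product is injective\<close>
     (\<forall>(n::nat) f g. (\<forall>i<n. f i \<in> VE \<and> g i \<in> VF) \<and>
        (\<forall>c. (\<lambda>x. \<Sum>i<n. c i * f i x) = (\<lambda>x. 0) \<longrightarrow> (\<forall>i<n. c i = 0)) \<and>
        (\<lambda>z. \<Sum>i<n. \<Phi> (f i) (g i) z) = (\<lambda>z. 0)
        \<longrightarrow> (\<forall>i<n. g i = (\<lambda>y. 0))) \<and>
     \<comment> \<open>the image of the algebraic tensor product is dense in VG\<close>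
     (\<forall>h\<in>VG. \<forall>K \<epsilon>. finite K \<and> \<epsilon> > 0 \<longrightarrow>
        (\<exists>t\<in>tensor_sums VE VF \<Phi>. (\<Sum>k\<in>K. pG k (\<lambda>z. h z - t z)) < \<epsilon>)) \<and>
     \<comment> \<open>on the algebraic tensor product the topology of VG is the projective topology\<close>
     (\<forall>k. \<exists>I J C. finite I \<and> finite J \<and>
        (\<forall>t\<in>tensor_sums VE VF \<Phi>. pG k t \<le> C * proj_seminorm VE pE VF pF \<Phi> I J t)) \<and>
     (\<forall>I J. finite I \<and> finite J \<longrightarrow> (\<exists>K C. finite K \<and>
        (\<forall>t\<in>tensor_sums VE VF \<Phi>. proj_seminorm VE pE VF pF \<Phi> I J t \<le> C * (\<Sum>k\<in>K. pG k t))))"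

end

theory Submission
  imports Defs
begin

text \<open>
The space \<open>K(N)\<close> is nuclear in a very concrete way: for every seminorm \<open>q\<close> there is a seminorm \<open>q'\<close>
such that the identity is approximated in the norm of operators from \<open>q'\<close> to \<open>q\<close> by finite-rank operators
\<open>T g = (\<Sum>i. l i g * e i)\<close> of uniformly bounded nuclear norm \<open>(\<Sum>i. \<parallel>l i\<parallel> * q (e i))\<close>,
where each \<open>l i\<close> is a linear combination of point evaluations and \<open>e i \<in> K(N)\<close>. Point evaluations in \<open>y\<close>
make sense for functions of \<open>(x, y)\<close>, so \<open>1 \<otimes> T\<close> acts on \<open>K(M \<otimes> N)\<close>: \<open>(1 \<otimes> T) h \<rightarrow> h\<close>
gives density, and splitting \<open>t = (1 \<otimes> T) t + (1 \<otimes> (1 - T)) t\<close> bounds the projective seminorm of a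
tensor \<open>t\<close> by a seminorm of \<open>K(M \<otimes> N)\<close>.

Spline quasi-interpolation at mesh \<open>h\<close> approximates the identity up to \<open>O(h)\<close> at the cost of one derivative,
with nuclear norm \<open>O(h powr - (m + dim))\<close>: condition (II) moves weights between nearby points and the integrable
\<open>L\<close> of condition (I) dominates the sum over the lattice. With \<open>\<eta> = h powr (m + dim)\<close> the error is
\<open>O(\<eta> powr t)\<close> and the nuclear norm \<open>O(1 / \<eta>)\<close>, where \<open>t = 1 / (m + dim)\<close>. Composing error operators
adds the exponents \<open>t\<close>, and as the harmonic series diverges they exceed 1; then a telescoping
sum over \<open>\<eta> = 1 / 2 ^ j\<close> has bounded nuclear norm.
\<close>

section \<open>Iterated partial derivatives\<close>

text \<open>The part \<open>(1 \<otimes> (1 - T)) t\<close> can be estimated only through a chosen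
  representation of \<open>t\<close>. So \<open>T\<close> is picked after \<open>t\<close> and its
  representation, and the nuclear norm must be bounded independently of that choice.

  A single mesh does not give this: \<open>m\<close> derivatives of an atom cost \<open>m\<close>
  powers of \<open>1 / h\<close>, the nodes have density \<open>h powr - dim\<close>, and plain
  sampling gains one power of \<open>h\<close>. Composing error operators raises the gain, but each
  factor asks for one more derivative of its input. The exponents are therefore
  \<open>1 / (m + dim)\<close>, \<open>1 / (m + 1 + dim)\<close> and so on, whence the harmonic
  series.

  Two error operators with exponent above 1 are multiplied because the difference of two such
  products consists of terms in which one factor has finite rank, at cost
  \<open>O(1 / \<eta>)\<close>, and the other is still an error operator of size
  \<open>O(\<eta> powr t)\<close>. With one error operator the difference would bring no gain.

  As \<open>pdl\<close> records the order of differentiation, comparing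
  \<open>(1 \<otimes> T) h\<close> with \<open>h\<close> requires symmetry of mixed partials. It
  follows from commuting finite differences, which are needed for the splines anyway.\<close>

lemma pdl_append: "pdl (as @ bs) f = pdl as (pdl bs f)"
  by (induction as) auto

lemma pdl_Cons_eq:
  assumes "pdl bs f = G" "\<And>x. (G has_derivative G' x) (at x)"
  shows "pdl (b # bs) f = (\<lambda>x. G' x b)"
  using frechet_derivative_at[OF assms(2)] assms(1) by simp

lemma smooth_funD:
  "smooth_fun f \<Longrightarrow> set bs \<subseteq> Basis \<Longrightarrow>
    (pdl bs f has_derivative frechet_derivative (pdl bs f) (at x)) (at x)"
  unfolding smooth_fun_def using frechet_derivative_works by blast

lemma smooth_fun_pdl:
  assumes "smooth_fun f" "set bs \<subseteq> Basis"
  shows "smooth_fun (pdl bs f)"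
  using assms unfolding smooth_fun_def by (metis pdl_append set_append Un_least)

text \<open>A coinduction principle: closure of \<open>\<F>\<close> under partial derivatives keeps
  every \<open>pdl bs f\<close> inside \<open>\<F>\<close>, so only first derivatives of members
  have to be computed. Products, flat functions and ridge functions are treated by exhibiting such a
  family instead of closed formulas for iterated derivatives.\<close>

lemma smooth_fun_family:
  assumes "f \<in> \<F>"
    and step: "\<And>f. f \<in> \<F> \<Longrightarrow> \<exists>f'. (\<forall>x. (f has_derivative f' x) (at x)) \<and> (\<forall>b\<in>Basis. (\<lambda>x. f' x b) \<in> \<F>)"
  shows "smooth_fun f"
proof -
  have *: "pdl bs f \<in> \<F>" if "set bs \<subseteq> Basis" for bs
    using that
  proof (induction bs)
    case (Cons b bs)
    then have "pdl bs f \<in> \<F>" by auto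
    from step[OF this] obtain f' where f': "\<forall>x. (pdl bs f has_derivative f' x) (at x)"
      "\<forall>b\<in>Basis. (\<lambda>x. f' x b) \<in> \<F>" by auto
    have "frechet_derivative (pdl bs f) (at x) = f' x" for x
      using f'(1) frechet_derivative_at by metis
    then show ?case using f'(2) Cons.prems by simp
  qed (use assms in auto)
  show ?thesis unfolding smooth_fun_def differentiable_def
    using step[OF *] by blast
qed

text \<open>The family is the set of smooth functions with \<open>f\<close> adjoined. The use is for
  antiderivatives: smoothness of the derivative passes to the function.\<close>

lemma smooth_fun_step:
  assumes "\<And>x. (f has_derivative f' x) (at x)" "\<And>b. b \<in> Basis \<Longrightarrow> smooth_fun (\<lambda>x. f' x b)"
  shows "smooth_fun f"
proof (rule smooth_fun_family[where \<F> = "insert f {g. smooth_fun g}"])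
  fix g assume "g \<in> insert f {g. smooth_fun g}"
  then consider "g = f" | "smooth_fun g" by auto
  then show "\<exists>f'. (\<forall>x. (g has_derivative f' x) (at x)) \<and> (\<forall>b\<in>Basis. (\<lambda>x. f' x b) \<in> insert f {g. smooth_fun g})"
  proof cases
    case 1 then show ?thesis using assms by (intro exI[of _ f']) auto
  next
    case 2
    then show ?thesis
      using smooth_funD[of g "[]"] smooth_fun_pdl[of g "[b]" for b]
      by (intro exI[of _ "\<lambda>x. frechet_derivative g (at x)"]) auto
  qed
qed simp

lemma pdl_const: "pdl bs (\<lambda>x. c) = (if bs = [] then (\<lambda>x. c) else (\<lambda>x. 0))"
  by (induction bs) auto

lemma smooth_fun_const [simp]: "smooth_fun (\<lambda>x. c)"
  unfolding smooth_fun_def by (auto simp: pdl_const)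

lemma pdl_add:
  assumes "smooth_fun f" "smooth_fun g" "set bs \<subseteq> Basis"
  shows "pdl bs (\<lambda>x. f x + g x) = (\<lambda>x. pdl bs f x + pdl bs g x)"
  using assms(3)
proof (induction bs)
  case (Cons b bs)
  have "frechet_derivative (\<lambda>x. pdl bs f x + pdl bs g x) (at x) b
      = frechet_derivative (pdl bs f) (at x) b + frechet_derivative (pdl bs g) (at x) b" for x
    using frechet_derivative_at[OF has_derivative_add[OF smooth_funD[OF assms(1), of bs x] smooth_funD[OF assms(2), of bs x]]]
      Cons.prems by (simp add: fun_eq_iff)
  then show ?case using Cons by simp
qed simp

lemma pdl_cmult:
  assumes "smooth_fun f" "set bs \<subseteq> Basis"
  shows "pdl bs (\<lambda>x. c * f x) = (\<lambda>x. c * pdl bs f x)"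
  using assms(2)
proof (induction bs)
  case (Cons b bs)
  have "frechet_derivative (\<lambda>x. c * pdl bs f x) (at x) b
      = c * frechet_derivative (pdl bs f) (at x) b" for x
    using frechet_derivative_at[OF has_derivative_mult_right[OF smooth_funD[OF assms(1), of bs x], of c]]
      Cons.prems by (simp add: fun_eq_iff)
  then show ?case using Cons by simp
qed simp

lemma smooth_fun_add:
  assumes "smooth_fun f" "smooth_fun g"
  shows "smooth_fun (\<lambda>x. f x + g x)"
  using assms unfolding smooth_fun_def by (auto simp: pdl_add[OF assms])

lemma smooth_fun_cmult:
  assumes "smooth_fun f"
  shows "smooth_fun (\<lambda>x. c * f x)"
  using assms unfolding smooth_fun_def by (auto simp: pdl_cmult[OF assms])

lemma pdl_diff:
  assumes "smooth_fun f" "smooth_fun g" "set bs \<subseteq> Basis"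
  shows "pdl bs (\<lambda>x. f x - g x) = (\<lambda>x. pdl bs f x - pdl bs g x)"
  using pdl_add[OF assms(1) smooth_fun_cmult[OF assms(2), of "-1"] assms(3)]
    pdl_cmult[OF assms(2,3), of "-1"] by simp

lemma smooth_fun_diff:
  assumes "smooth_fun f" "smooth_fun g"
  shows "smooth_fun (\<lambda>x. f x - g x)"
  using smooth_fun_add[OF assms(1) smooth_fun_cmult[OF assms(2), of "-1"]] by simp

lemma smooth_fun_sum:
  assumes "\<And>i. i \<in> A \<Longrightarrow> smooth_fun (f i)"
  shows "smooth_fun (\<lambda>x. \<Sum>i\<in>A. f i x)"
  using assms by (induction A rule: infinite_finite_induct) (auto intro: smooth_fun_add)

lemma pdl_sum:
  assumes "\<And>i. i \<in> A \<Longrightarrow> smooth_fun (f i)" "set bs \<subseteq> Basis"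
  shows "pdl bs (\<lambda>x. \<Sum>i\<in>A. f i x) = (\<lambda>x. \<Sum>i\<in>A. pdl bs (f i) x)"
  using assms
  by (induction A rule: infinite_finite_induct)
    (auto simp: pdl_add[OF _ smooth_fun_sum] pdl_const)

text \<open>Since \<open>J\<close> sends basis vectors to basis vectors, the chain rule produces one
  partial derivative of \<open>f\<close> and not a linear combination. The instances are scalings
  and translations, with \<open>J\<close> the identity, and the two coordinate embeddings into a
  product.\<close>

lemma
  fixes J :: "'a::euclidean_space \<Rightarrow> 'c::euclidean_space"
  assumes f: "smooth_fun f" and J: "bounded_linear J" and JB: "J ` Basis \<subseteq> Basis"
  shows smooth_fun_affine: "smooth_fun (\<lambda>x. f (c *\<^sub>R J x + d))"
    and pdl_affine: "set bs \<subseteq> Basis \<Longrightarrow> pdl bs (\<lambda>x. f (c *\<^sub>R J x + d))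
      = (\<lambda>x. complex_of_real c ^ length bs * pdl (map J bs) f (c *\<^sub>R J x + d))"
proof -
  have inner: "((\<lambda>x. c *\<^sub>R J x + d) has_derivative (\<lambda>v. c *\<^sub>R J v)) (at x)" for x
    by (auto intro!: derivative_eq_intros bounded_linear_imp_has_derivative J)
  have mapJ: "set (map J bs) \<subseteq> Basis" if "set bs \<subseteq> Basis" for bs
    using that JB by auto
  have D: "((\<lambda>x. a * pdl (map J bs) f (c *\<^sub>R J x + d)) has_derivative
      (\<lambda>v. a * (frechet_derivative (pdl (map J bs) f) (at (c *\<^sub>R J x + d)) (c *\<^sub>R J v)))) (at x)"
    if "set bs \<subseteq> Basis" for a bs x
    by (rule has_derivative_mult_right[OF has_derivative_compose[OF inner smooth_funD[OF f mapJ[OF that]]]])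
  have lin: "frechet_derivative (pdl (map J bs) f) (at y) (c *\<^sub>R v)
     = of_real c * frechet_derivative (pdl (map J bs) f) (at y) v" if "set bs \<subseteq> Basis" for bs v y
  proof -
    have "linear (frechet_derivative (pdl (map J bs) f) (at y))"
      using smooth_funD[OF f mapJ[OF that]] has_derivative_linear by blast
    then show ?thesis by (simp add: linear_scale scaleR_conv_of_real)
  qed
  show *: "set bs \<subseteq> Basis \<Longrightarrow> pdl bs (\<lambda>x. f (c *\<^sub>R J x + d))
      = (\<lambda>x. complex_of_real c ^ length bs * pdl (map J bs) f (c *\<^sub>R J x + d))" for bs
  proof (induction bs)
    case (Cons b bs)
    then have sub: "set bs \<subseteq> Basis" by simp
    show ?case
      using pdl_Cons_eq[OF Cons.IH[OF sub] D[OF sub], of b] by (simp add: lin[OF sub] mult_ac)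
  qed simp
  show "smooth_fun (\<lambda>x. f (c *\<^sub>R J x + d))"
    unfolding smooth_fun_def using * D differentiable_def by metis
qed

lemma smooth_fun_mult:
  assumes "smooth_fun f" "smooth_fun g"
  shows "smooth_fun (\<lambda>x. f x * g x)"
proof -
  define \<F> :: "('a \<Rightarrow> complex) set" where
    "\<F> = {\<lambda>x. \<Sum>i<(n::nat). F i x * G i x | n F G. \<forall>i<n. smooth_fun (F i) \<and> smooth_fun (G i)}"
  have "(\<lambda>x. f x * g x) \<in> \<F>"
    unfolding \<F>_def mem_Collect_eq
    by (rule exI[of _ 1], rule exI[of _ "\<lambda>_. f"], rule exI[of _ "\<lambda>_. g"]) (use assms in simp)
  then show ?thesis
  proof (rule smooth_fun_family)
    fix h assume "h \<in> \<F>"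
    then obtain n :: nat and F G where h: "h = (\<lambda>x. \<Sum>i<n. F i x * G i x)"
      and FG: "\<And>i. i < n \<Longrightarrow> smooth_fun (F i)" "\<And>i. i < n \<Longrightarrow> smooth_fun (G i)"
      unfolding \<F>_def by auto
    let ?D = "\<lambda>f x. frechet_derivative f (at x)"
    have D: "(h has_derivative (\<lambda>v. \<Sum>i<n. F i x * ?D (G i) x v + ?D (F i) x v * G i x)) (at x)" for x
      unfolding h
      using smooth_funD[OF FG(1), of _ "[]" x] smooth_funD[OF FG(2), of _ "[]" x]
      by (intro has_derivative_sum has_derivative_mult) auto
    have "(\<lambda>x. \<Sum>i<n. F i x * ?D (G i) x b + ?D (F i) x b * G i x) \<in> \<F>" if "b \<in> Basis" for b
    proof -
      \<comment> \<open>The \<open>2 n\<close> terms of the product rule are laid out in two blocks: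
        indices below \<open>n\<close> differentiate the second factor, the others the
        first.\<close>
      define F' where "F' i = (if i < n then F i else pdl [b] (F (i - n)))" for i
      define G' where "G' i = (if i < n then pdl [b] (G i) else G (i - n))" for i
      have "(\<Sum>i<n. F i x * ?D (G i) x b + ?D (F i) x b * G i x) = (\<Sum>i<n + n. F' i x * G' i x)" for x
        unfolding sum.nat_group[symmetric] lessThan_atLeast0 sum.atLeastLessThan_concat[of 0 n "n + n", symmetric, simplified]
          sum.shift_bounds_nat_ivl[of _ 0 n n, simplified]
        by (simp add: F'_def G'_def sum.distrib)
      moreover have "smooth_fun (F' i) \<and> smooth_fun (G' i)" if "i < n + n" for i
        using that FG smooth_fun_pdl[of _ "[b]"] \<open>b \<in> Basis\<close> unfolding F'_def G'_def by auto
      ultimately show ?thesis unfolding \<F>_def by blast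
    qed
    with D show "\<exists>f'. (\<forall>x. (h has_derivative f' x) (at x)) \<and> (\<forall>b\<in>Basis. (\<lambda>x. f' x b) \<in> \<F>)"
      by (intro exI[of _ "\<lambda>x v. \<Sum>i<n. F i x * ?D (G i) x v + ?D (F i) x v * G i x"]) auto
  qed
qed

lemma smooth_fun_prod:
  assumes "\<And>i. i \<in> A \<Longrightarrow> smooth_fun (f i)"
  shows "smooth_fun (\<lambda>x. \<Prod>i\<in>A. f i x)"
  using assms by (induction A rule: infinite_finite_induct) (auto intro: smooth_fun_mult)

section \<open>Partial derivatives of tensor products of functions\<close>

definition lefts :: "('a::euclidean_space \<times> 'b::euclidean_space) list \<Rightarrow> 'a list" where
  "lefts cs = map fst (filter (\<lambda>c. snd c = 0) cs)"

definition rights :: "('a::euclidean_space \<times> 'b::euclidean_space) list \<Rightarrow> 'b list" where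
  "rights cs = map snd (filter (\<lambda>c. snd c \<noteq> 0) cs)"

lemma lefts_rights_simps [simp]:
  "lefts [] = []" "rights [] = []"
  "lefts (c # cs) = (if snd c = 0 then fst c # lefts cs else lefts cs)"
  "rights (c # cs) = (if snd c = 0 then rights cs else snd c # rights cs)"
  by (auto simp: lefts_def rights_def)

lemma set_lefts: "set cs \<subseteq> Basis \<Longrightarrow> set (lefts cs) \<subseteq> Basis"
  and set_rights: "set cs \<subseteq> Basis \<Longrightarrow> set (rights cs) \<subseteq> Basis"
  by (induction cs) (auto simp: Basis_prod_def)

lemma length_lefts_rights: "length (lefts cs) + length (rights cs) = length cs"
  by (induction cs) auto

text \<open>Collecting derivatives by variable permutes the list \<open>cs\<close>; this is the form
  in which \<open>pdl_perm\<close> takes the permutation. A basis vector of the product has exactly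
  one nonzero component, so the test \<open>snd c = 0\<close> separates the two kinds.\<close>

lemma mset_lefts_rights:
  assumes "set cs \<subseteq> Basis"
  shows "mset cs = mset (map (Pair 0) (rights cs) @ map (\<lambda>a. (a, 0)) (lefts cs))"
  using assms by (induction cs) (auto simp: Basis_prod_def)

text \<open>Each basis direction meets only one factor: in the product rule the other term contains
  a derivative in direction 0 and vanishes. Hence nothing is reordered here, although
  \<open>cs\<close> may mix the two variables.\<close>

lemma
  assumes f: "smooth_fun f" and g: "smooth_fun g"
  shows smooth_fun_tensor: "smooth_fun (\<lambda>(x, y). f x * g y)"
    and pdl_tensor: "set cs \<subseteq> Basis \<Longrightarrow>
      pdl cs (\<lambda>(x, y). f x * g y) = (\<lambda>(x, y). pdl (lefts cs) f x * pdl (rights cs) g y)"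
proof -
  let ?D = "\<lambda>f x. frechet_derivative f (at x)"
  have D: "((\<lambda>z. pdl as f (fst z) * pdl bs g (snd z)) has_derivative
     (\<lambda>v. pdl as f (fst z) * ?D (pdl bs g) (snd z) (snd v) + ?D (pdl as f) (fst z) (fst v) * pdl bs g (snd z))) (at z)"
    if "set as \<subseteq> Basis" "set bs \<subseteq> Basis" for as bs z
    by (intro has_derivative_mult has_derivative_compose[OF _ smooth_funD[OF f that(1)]]
       has_derivative_compose[OF _ smooth_funD[OF g that(2)]] derivative_intros)
  have zf: "?D (pdl as f) x 0 = 0" if "set as \<subseteq> Basis" for as x
    using smooth_funD[OF f that] has_derivative_linear linear_0 by blast
  have zg: "?D (pdl as g) x 0 = 0" if "set as \<subseteq> Basis" for as x
    using smooth_funD[OF g that] has_derivative_linear linear_0 by blast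
  show *: "set cs \<subseteq> Basis \<Longrightarrow>
      pdl cs (\<lambda>(x, y). f x * g y) = (\<lambda>(x, y). pdl (lefts cs) f x * pdl (rights cs) g y)" for cs
  proof (induction cs)
    case (Cons c cs)
    then have cs: "set cs \<subseteq> Basis" by simp
    from Cons(2) have "c \<in> Basis" by simp
    note L = set_lefts[OF cs] set_rights[OF cs]
    have IH: "pdl cs (\<lambda>(x, y). f x * g y) = (\<lambda>z. pdl (lefts cs) f (fst z) * pdl (rights cs) g (snd z))"
      using Cons.IH[OF cs] by auto
    from \<open>c \<in> Basis\<close> have "fst c = 0 \<and> snd c \<noteq> 0 \<or> snd c = 0" by (auto simp: Basis_prod_def)
    then show ?case
      unfolding pdl_Cons_eq[OF IH D[OF L]] by (auto simp: fun_eq_iff zf[OF L(1)] zg[OF L(2)])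
  qed auto
  show "smooth_fun (\<lambda>(x, y). f x * g y)"
    unfolding smooth_fun_def
  proof (intro allI impI)
    fix cs :: "('a \<times> 'b) list" and z assume cs: "set cs \<subseteq> Basis"
    show "pdl cs (\<lambda>(x, y). f x * g y) differentiable at z"
      using D[OF set_lefts[OF cs] set_rights[OF cs], of z] *[OF cs]
      unfolding differentiable_def by (auto simp: case_prod_unfold)
  qed
qed

section \<open>Finite differences and symmetry of mixed partials\<close>

lemma norm_frechet_derivative_le:
  assumes f: "smooth_fun f" and S: "\<And>b. b \<in> Basis \<Longrightarrow> norm (pdl [b] f x) \<le> S"
  shows "norm (frechet_derivative f (at x) v) \<le> real DIM('a::euclidean_space) * S * norm (v::'a)"
proof -
  let ?D = "frechet_derivative f (at x)"
  have lin: "linear ?D" using smooth_funD[OF f, of "[]" x] has_derivative_linear by fastforce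
  have "?D v = ?D (\<Sum>b\<in>Basis. (v \<bullet> b) *\<^sub>R b)" by (simp add: euclidean_representation)
  also have "\<dots> = (\<Sum>b\<in>Basis. (v \<bullet> b) *\<^sub>R ?D b)" using lin by (simp add: linear_sum linear_scale)
  finally have "norm (?D v) \<le> (\<Sum>b\<in>Basis. norm ((v \<bullet> b) *\<^sub>R ?D b))" by (simp add: sum_norm_le)
  also have "\<dots> \<le> (\<Sum>b\<in>(Basis::'a set). norm v * S)"
    using S by (intro sum_mono) (auto intro!: mult_mono simp: Basis_le_norm)
  finally show ?thesis by (simp add: mult_ac)
qed

lemma smooth_fun_lipschitz:
  fixes f :: "'a::euclidean_space \<Rightarrow> complex"
  assumes f: "smooth_fun f" and "convex X" "x \<in> X" "y \<in> X"
    and S: "\<And>b v. b \<in> Basis \<Longrightarrow> v \<in> X \<Longrightarrow> norm (pdl [b] f v) \<le> S"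
  shows "norm (f x - f y) \<le> real DIM('a) * S * norm (x - y)"
proof (rule differentiable_bound[OF \<open>convex X\<close> _ _ \<open>x \<in> X\<close> \<open>y \<in> X\<close>])
  show "(f has_derivative frechet_derivative f (at v)) (at v within X)" for v
    using smooth_funD[OF f, of "[]" v] by (auto intro: has_derivative_at_withinI)
  have "0 \<le> S" using S[OF SOME_Basis \<open>x \<in> X\<close>] norm_ge_zero order_trans by blast
  then show "onorm (frechet_derivative f (at v)) \<le> real DIM('a) * S" if "v \<in> X" for v
    using norm_frechet_derivative_le[OF f S[OF _ that]] by (intro onorm_bound) auto
qed

text \<open>Backward differences are chosen because the derivative of a spline is the backward
  difference of the spline of lower order, see \<open>DERIV_spline\<close>.\<close>

primrec fdiff :: "'a::real_vector list \<Rightarrow> ('a \<Rightarrow> 'c::ab_group_add) \<Rightarrow> 'a \<Rightarrow> 'c" where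
  "fdiff [] f = f"
| "fdiff (b # bs) f = (\<lambda>x. fdiff bs f x - fdiff bs f (x - b))"

lemma fdiff_append: "fdiff (as @ bs) f = fdiff as (fdiff bs f)"
  by (induction as) auto

lemma fdiff_diff: "fdiff bs (\<lambda>x. f x - g (x - c)) x = fdiff bs f x - fdiff bs g (x - c)"
proof (induction bs arbitrary: x)
  case (Cons b bs)
  show ?case by (simp only: fdiff.simps Cons.IH) (simp add: algebra_simps)
qed simp

lemma fdiff_snoc: "fdiff (bs @ [b]) f = fdiff (b # bs) f"
  by (simp add: fun_eq_iff fdiff_append fdiff_diff)

lemma fdiff_perm:
  assumes "mset as = mset bs"
  shows "fdiff as f = fdiff bs f"
  using assms
proof (induction as arbitrary: bs)
  case (Cons a as)
  then obtain us vs where bs: "bs = us @ a # vs" by (metis list.set_intros(1) mset_eq_setD split_list)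
  then have "mset as = mset (us @ vs)" using Cons.prems by simp
  from Cons.IH[OF this] have "fdiff (a # as) f = fdiff (a # us @ vs) f" by simp
  also have "\<dots> = fdiff (a # us) (fdiff vs f)" by (simp only: fdiff_append flip: append_Cons)
  also have "\<dots> = fdiff (us @ [a]) (fdiff vs f)" by (simp only: fdiff_snoc)
  also have "\<dots> = fdiff bs f" by (simp add: bs fdiff_append)
  finally show ?case .
qed auto

lemma
  assumes "smooth_fun f"
  shows smooth_fun_fdiff: "smooth_fun (fdiff bs f)"
    and pdl_fdiff: "set as \<subseteq> Basis \<Longrightarrow> pdl as (fdiff bs f) = fdiff bs (pdl as f)"
proof -
  have sh: "smooth_fun (\<lambda>x. g (x - b))" if "smooth_fun g" for g :: "'a \<Rightarrow> complex" and b
    using smooth_fun_affine[OF that bounded_linear_ident, of 1 "- b"] by simp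
  have ps: "pdl as (\<lambda>x. g (x - b)) = (\<lambda>x. pdl as g (x - b))" if "smooth_fun g" "set as \<subseteq> Basis"
    for g :: "'a \<Rightarrow> complex" and b as
    using pdl_affine[OF that(1) bounded_linear_ident _ that(2), of 1 "- b"] by simp
  have *: "smooth_fun (fdiff bs f) \<and> (set as \<subseteq> Basis \<longrightarrow> pdl as (fdiff bs f) = fdiff bs (pdl as f))"
    by (induction bs) (auto simp: assms sh smooth_fun_diff pdl_diff ps)
  show "smooth_fun (fdiff bs f)" using * by blast
  show "set as \<subseteq> Basis \<Longrightarrow> pdl as (fdiff bs f) = fdiff bs (pdl as f)" using * by blast
qed

text \<open>The induction peels off the innermost derivative \<open>b\<close>: the difference in
  direction \<open>b\<close> is governed by \<open>fdiff bs (pdl [b] f)\<close> on the segment from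
  \<open>z - b\<close> to \<open>z\<close>, where the induction hypothesis applies. Points of the
  segment are up to 1 further from \<open>y\<close>, so \<open>\<rho>\<close> grows by 1 while
  \<open>length bs\<close> drops by 1, and the ball of radius \<open>\<rho> + length bs\<close>
  stays the same.\<close>

lemma fdiff_pdl_bound:
  fixes f :: "'a::euclidean_space \<Rightarrow> complex"
  assumes "smooth_fun f" "set bs \<subseteq> Basis" "norm (z - y) \<le> \<rho>"
    and "\<And>cs v. set cs \<subseteq> Basis \<Longrightarrow> length cs = Suc (length bs) \<Longrightarrow>
      v \<in> cball y (\<rho> + length bs) \<Longrightarrow> norm (pdl cs f v) \<le> S"
  shows "norm (fdiff bs f z - pdl bs f y) \<le> real DIM('a) * (\<rho> + length bs) * S"
  using assms
proof (induction bs arbitrary: f z \<rho> rule: rev_induct)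
  case Nil
  then have "0 \<le> \<rho>" using norm_ge_zero order_trans by blast
  have S: "norm (pdl [b] f v) \<le> S" if "b \<in> Basis" "v \<in> cball y \<rho>" for b v
    using Nil(4)[of "[b]" v] that by simp
  have "norm (f z - f y) \<le> real DIM('a) * S * norm (z - y)"
    using Nil \<open>0 \<le> \<rho>\<close> by (intro smooth_fun_lipschitz[OF _ convex_cball[of y \<rho>]])
      (auto simp: dist_norm norm_minus_commute simp del: pdl.simps intro!: S)
  also have "\<dots> \<le> real DIM('a) * S * \<rho>"
  proof -
    have "0 \<le> S" using S[OF SOME_Basis, of y] \<open>0 \<le> \<rho>\<close> norm_ge_zero order_trans
      by (metis centre_in_cball)
    then show ?thesis using Nil(3) by (intro mult_left_mono) auto
  qed
  finally show ?case by (simp add: mult_ac)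
next
  case (snoc b bs)
  let ?F = "fdiff bs f" and ?c = "pdl (bs @ [b]) f y"
  have b: "b \<in> Basis" and bs: "set bs \<subseteq> Basis" using snoc.prems by auto
  have sm: "smooth_fun (pdl [b] f)" using snoc.prems b by (intro smooth_fun_pdl) auto
  have fd: "frechet_derivative ?F (at v) b = fdiff bs (pdl [b] f) v" for v
    using pdl_fdiff[OF snoc.prems(1), of "[b]" bs] b by (simp add: fun_eq_iff)
  have near: "norm (fdiff bs (pdl [b] f) (z - b + t *\<^sub>R b) - ?c)
      \<le> real DIM('a) * (\<rho> + length (bs @ [b])) * S" if "t \<in> {0..1}" for t
  proof -
    have "norm (z - b + t *\<^sub>R b - y) = norm ((z - y) - (1 - t) *\<^sub>R b)"
      by (simp add: algebra_simps)
    also have "\<dots> \<le> norm (z - y) + norm ((1 - t) *\<^sub>R b)" by (rule norm_triangle_ineq4)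
    also have "\<dots> \<le> \<rho> + 1" using snoc.prems(3) b that by auto
    finally have "norm (z - b + t *\<^sub>R b - y) \<le> \<rho> + 1" .
    from snoc.IH[OF sm bs this] show ?thesis
    proof -
      have "norm (pdl cs (pdl [b] f) v) \<le> S" if "set cs \<subseteq> Basis" "length cs = Suc (length bs)"
        "v \<in> cball y (\<rho> + 1 + length bs)" for cs v
        using snoc.prems(4)[of "cs @ [b]" v] that b by (simp add: pdl_append algebra_simps)
      from snoc.IH[OF sm bs \<open>norm (z - b + t *\<^sub>R b - y) \<le> \<rho> + 1\<close> this] show ?thesis
        by (simp add: pdl_append algebra_simps)
    qed
  qed
  \<comment> \<open>Subtracting the linear function with slope \<open>?c\<close> makes
    \<open>\<phi> 1 - \<phi> 0\<close> the quantity to estimate and its derivative the quantity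
    bounded in \<open>near\<close>.\<close>
  define \<phi> where "\<phi> t = ?F (z - b + t *\<^sub>R b) - t *\<^sub>R ?c" for t :: real
  have lin: "linear (frechet_derivative ?F (at v))" for v
    using smooth_funD[OF smooth_fun_fdiff[OF snoc.prems(1)], of "[]"] has_derivative_linear by fastforce
  have "((\<lambda>t. ?F (z - b + t *\<^sub>R b)) has_derivative
      (\<lambda>s. frechet_derivative ?F (at (z - b + t *\<^sub>R b)) (s *\<^sub>R b))) (at t)" for t :: real
    by (rule has_derivative_compose[OF _ smooth_funD[OF smooth_fun_fdiff[OF snoc.prems(1)], of "[]", simplified]])
      (auto intro!: derivative_eq_intros)
  then have "((\<lambda>t. ?F (z - b + t *\<^sub>R b)) has_derivative
      (\<lambda>s. s *\<^sub>R fdiff bs (pdl [b] f) (z - b + t *\<^sub>R b))) (at t)" for t :: real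
    by (simp only: linear_scale[OF lin] fd)
  then have D: "(\<phi> has_derivative (\<lambda>s. s *\<^sub>R (fdiff bs (pdl [b] f) (z - b + t *\<^sub>R b) - ?c))) (at t within {0..1})" for t
    unfolding \<phi>_def scaleR_diff_right
    by (rule has_derivative_at_withinI[OF has_derivative_diff[OF _ has_derivative_scaleR_left[OF has_derivative_ident]]])
  have "onorm (\<lambda>s. s *\<^sub>R (fdiff bs (pdl [b] f) (z - b + t *\<^sub>R b) - ?c))
      \<le> real DIM('a) * (\<rho> + length (bs @ [b])) * S" if "t \<in> {0..1}" for t
    by (rule onorm_bound[OF order_trans[OF norm_ge_zero near[OF that]]])
      (subst norm_scaleR, subst mult.commute, unfold real_norm_def,
        rule mult_right_mono[OF near[OF that] abs_ge_zero])
  then have "norm (\<phi> 1 - \<phi> 0) \<le> (real DIM('a) * (\<rho> + length (bs @ [b])) * S) * norm (1 - 0 :: real)"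
    by (intro differentiable_bound[OF _ D]) auto
  then show ?case unfolding \<phi>_def fdiff_snoc by (simp add: algebra_simps)
qed

text \<open>The finite differences commute, and after rescaling by \<open>h\<close> they approximate the iterated partial derivatives up to \<open>O(h)\<close>.\<close>

lemma pdl_perm:
  fixes f :: "'a::euclidean_space \<Rightarrow> complex"
  assumes f: "smooth_fun f" and as: "set as \<subseteq> Basis" and mset: "mset as = mset bs"
  shows "pdl as f = pdl bs f"
proof
  fix y
  define n where "n = length as"
  have bs: "set bs \<subseteq> Basis" and n: "length bs = n"
    using as mset n_def by (metis mset_eq_setD, metis mset_eq_length)
  let ?L = "{cs. set cs \<subseteq> (Basis :: 'a set) \<and> length cs = Suc n}"
  have fin: "finite ?L" by (intro finite_lists_length_eq) simp
  have "\<exists>B. \<forall>v\<in>cball y n. norm (pdl cs f v) \<le> B" if "cs \<in> ?L" for cs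
  proof -
    have "isCont (pdl cs f) v" for v
      using that smooth_funD[OF f, of cs v] has_derivative_continuous by auto
    then have "compact (pdl cs f ` cball y n)"
      by (intro compact_continuous_image continuous_at_imp_continuous_on) auto
    from compact_imp_bounded[OF this] show ?thesis unfolding bounded_iff by auto
  qed
  then have "\<forall>cs\<in>?L. \<exists>B. \<forall>v\<in>cball y n. norm (pdl cs f v) \<le> B" by blast
  from bchoice[OF this] obtain B where
    "\<forall>cs\<in>?L. \<forall>v\<in>cball y n. norm (pdl cs f v) \<le> B cs" by blast
  then have B: "\<And>cs v. cs \<in> ?L \<Longrightarrow> v \<in> cball y n \<Longrightarrow> norm (pdl cs f v) \<le> B cs"
    by blast
  define S where "S = (\<Sum>cs\<in>?L. \<bar>B cs\<bar>)"
  have S: "norm (pdl cs f v) \<le> S" if "cs \<in> ?L" "v \<in> cball y n" for cs v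
    using B[OF that] member_le_sum[OF that(1), of "\<lambda>cs. \<bar>B cs\<bar>"] fin unfolding S_def by force
  define C where "C = real DIM('a) * n * S"
  have key: "norm (fdiff cs (\<lambda>x. f (h *\<^sub>R x + y)) 0 - of_real h ^ n * pdl cs f y) \<le> h ^ n * (h * C)"
    if "0 < h" "h \<le> 1" "set cs \<subseteq> Basis" "length cs = n" for h cs
  proof -
    have "smooth_fun (\<lambda>x. f (h *\<^sub>R x + y))"
      using smooth_fun_affine[OF f bounded_linear_ident] by simp
    moreover note pd = pdl_affine[OF f bounded_linear_ident, of _ h y, simplified]
    have "norm (pdl ds (\<lambda>x. f (h *\<^sub>R x + y)) v) \<le> h ^ Suc n * S"
      if ds: "set ds \<subseteq> Basis" "length ds = Suc n" and v: "norm v \<le> n" for ds v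
    proof -
      have "norm (h *\<^sub>R v) \<le> 1 * real n"
        unfolding norm_scaleR using v \<open>0 < h\<close> \<open>h \<le> 1\<close> by (intro mult_mono) auto
      then have "norm (pdl ds f (h *\<^sub>R v + y)) \<le> S" using ds by (intro S) (auto simp: dist_norm)
      then show ?thesis
        using \<open>0 < h\<close> ds unfolding pd[OF ds(1)] by (auto simp: norm_mult norm_power intro!: mult_left_mono)
    qed
    ultimately have "norm (fdiff cs (\<lambda>x. f (h *\<^sub>R x + y)) 0 - pdl cs (\<lambda>x. f (h *\<^sub>R x + y)) 0)
       \<le> real DIM('a) * (0 + real (length cs)) * (h ^ Suc n * S)"
      using that by (intro fdiff_pdl_bound) auto
    then show ?thesis unfolding pd[OF that(3)] C_def using that by (simp add: mult_ac)
  qed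
  \<comment> \<open>One finite difference is compared with both derivatives, since by
    \<open>fdiff_perm\<close> it does not see the order of the directions. The errors carry one
    power of \<open>h\<close> more than the factor \<open>h ^ n\<close> of the derivatives, so
    division leaves a bound that tends to 0.\<close>
  have bound: "norm (pdl as f y - pdl bs f y) \<le> 2 * C * h" if "0 < h" "h \<le> 1" for h
  proof -
    let ?F = "fdiff as (\<lambda>x. f (h *\<^sub>R x + y)) 0"
    have "h ^ n * norm (pdl as f y - pdl bs f y) = norm ((?F - of_real h ^ n * pdl bs f y) - (?F - of_real h ^ n * pdl as f y))"
    proof -
      have "(?F - of_real h ^ n * pdl bs f y) - (?F - of_real h ^ n * pdl as f y)
        = of_real h ^ n * (pdl as f y - pdl bs f y)" by (simp add: algebra_simps)
      then show ?thesis using that by (simp only: norm_mult norm_power norm_of_real)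
    qed
    also have "\<dots> \<le> h ^ n * (h * C) + h ^ n * (h * C)"
      using key[OF that as n_def[symmetric]] key[OF that bs n]
      by (intro order_trans[OF norm_triangle_ineq4 add_mono]) (simp_all add: fdiff_perm[OF mset])
    finally have "h ^ n * norm (pdl as f y - pdl bs f y) \<le> h ^ n * (2 * C * h)" by (simp add: algebra_simps)
    then show ?thesis using that by simp
  qed
  have "((\<lambda>h. 2 * C * h) \<longlongrightarrow> 2 * C * 0) (at_right 0)" by (intro tendsto_intros)
  moreover have "eventually (\<lambda>h. norm (pdl as f y - pdl bs f y) \<le> 2 * C * h) (at_right 0)"
    using eventually_at_right_real[of 0 1] by (auto elim!: eventually_mono intro!: bound)
  ultimately have "norm (pdl as f y - pdl bs f y) \<le> 2 * C * 0"
    by (intro tendsto_lowerbound) auto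
  then show "pdl as f y = pdl bs f y" by simp
qed

section \<open>Smooth splines on the line\<close>

text \<open>The polynomial factor makes the class closed under differentiation: in the variable
  \<open>s = 1 / t\<close> the derivative corresponds to replacing \<open>p\<close> by
  \<open>s^2 (p - p')\<close>. All members are flat at 0.\<close>

definition exp_step :: "real poly \<Rightarrow> real \<Rightarrow> real" where
  "exp_step p t = (if t > 0 then poly p (1 / t) * exp (- (1 / t)) else 0)"

lemma tendsto_poly_exp_at_top: "((\<lambda>x. poly p x * exp (- x)) \<longlongrightarrow> 0) (at_top :: real filter)"
proof -
  have "((\<lambda>x. \<Sum>i\<le>degree p. coeff p i * (x ^ i / exp x)) \<longlongrightarrow> (\<Sum>i\<le>degree p. coeff p i * 0)) (at_top :: real filter)"
    by (intro tendsto_intros tendsto_power_div_exp_0)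
  moreover have "poly p x * exp (- x) = (\<Sum>i\<le>degree p. coeff p i * (x ^ i / exp x))" for x
    by (simp add: poly_altdef exp_minus sum_distrib_left divide_inverse mult_ac)
  ultimately show ?thesis by simp
qed

lemma DERIV_exp_step: "(exp_step p has_real_derivative exp_step ([:0, 0, 1:] * (p - pderiv p)) t) (at t)"
proof -
  let ?q = "[:0, 0, 1:] * (p - pderiv p)"
  consider "t > 0" | "t < 0" | "t = 0" by linarith
  then show ?thesis
  proof cases
    case 1
    have "((\<lambda>t. poly p (1 / t) * exp (- (1 / t))) has_real_derivative exp_step ?q t) (at t)"
      using 1 unfolding exp_step_def
      by (auto intro!: derivative_eq_intros DERIV_chain2[OF poly_DERIV] simp: field_simps power2_eq_square)
    moreover have "eventually (\<lambda>s. poly p (1 / s) * exp (- (1 / s)) = exp_step p s) (nhds t)"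
      using eventually_nhds_in_open[of "{0<..}" t] 1 by (auto elim!: eventually_mono simp: exp_step_def)
    ultimately show ?thesis by (subst (asm) DERIV_cong_ev[OF refl _ refl])
  next
    case 2
    have "eventually (\<lambda>s. 0 = exp_step p s) (nhds t)"
      using eventually_nhds_in_open[of "{..<0}" t] 2 by (auto elim!: eventually_mono simp: exp_step_def)
    moreover have "((\<lambda>_. 0 :: real) has_real_derivative exp_step ?q t) (at t)" using 2 by (simp add: exp_step_def)
    ultimately show ?thesis by (subst (asm) DERIV_cong_ev[OF refl _ refl])
  next
    case 3
    \<comment> \<open>The difference quotient at 0 is of the same type: dividing by \<open>h\<close>
      multiplies the polynomial by its variable, whence \<open>[:0, 1:]\<close>.\<close>
    have "((\<lambda>h. poly ([:0, 1:] * p) (inverse h) * exp (- inverse h)) \<longlongrightarrow> 0) (at_right 0)"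
      by (rule filterlim_compose[OF tendsto_poly_exp_at_top filterlim_inverse_at_top_right])
    then have "((\<lambda>h. exp_step p h / h) \<longlongrightarrow> 0) (at_right 0)"
      by (rule Lim_transform_eventually)
        (auto simp: eventually_at_filter exp_step_def field_simps intro!: always_eventually)
    moreover have "((\<lambda>h. exp_step p h / h) \<longlongrightarrow> 0) (at_left 0)"
      by (rule Lim_transform_eventually[OF tendsto_const])
        (auto simp: eventually_at_filter exp_step_def intro!: always_eventually)
    ultimately have "((\<lambda>h. exp_step p h / h) \<longlongrightarrow> 0) (at 0)" by (rule filterlim_split_at[rotated])
    then show ?thesis using 3 by (simp add: DERIV_def exp_step_def)
  qed
qed

lemma has_derivative_of_real_fun:
  "(f has_real_derivative d) (at t) \<Longrightarrow>
    ((\<lambda>t. complex_of_real (f t)) has_derivative (\<lambda>v. of_real (d * v))) (at t)"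
  unfolding has_field_derivative_def by (rule has_derivative_of_real)

lemma smooth_fun_real_step:
  assumes "\<And>t. (f has_real_derivative f' t) (at t)" "smooth_fun (\<lambda>t. complex_of_real (f' t))"
  shows "smooth_fun (\<lambda>t. complex_of_real (f t))"
  by (rule smooth_fun_step[OF has_derivative_of_real_fun[OF assms(1)]]) (use assms(2) in simp)

lemma smooth_fun_exp_step: "smooth_fun (\<lambda>t. complex_of_real (exp_step p t))"
proof (rule smooth_fun_family[where \<F> = "range (\<lambda>p t. complex_of_real (exp_step p t))"])
  fix f assume "f \<in> range (\<lambda>p t. complex_of_real (exp_step p t))"
  then obtain p where f: "f = (\<lambda>t. complex_of_real (exp_step p t))" by auto
  let ?q = "[:0, 0, 1:] * (p - pderiv p)"
  have "(f has_derivative (\<lambda>v. of_real (exp_step ?q t * v))) (at t)" for t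
    unfolding f by (rule has_derivative_of_real_fun[OF DERIV_exp_step])
  moreover have "(\<lambda>t. complex_of_real (exp_step ?q t * b)) \<in> range (\<lambda>p t. complex_of_real (exp_step p t))"
    if "b \<in> Basis" for b
    using that by (simp del: mult_pCons_left)
  ultimately show "\<exists>f'. (\<forall>t. (f has_derivative f' t) (at t)) \<and>
      (\<forall>b\<in>Basis. (\<lambda>t. f' t b) \<in> range (\<lambda>p t. complex_of_real (exp_step p t)))"
    by (intro exI[of _ "\<lambda>t v. of_real (exp_step ?q t * v)"]) blast
qed simp

lemma smooth_fun_continuous: "smooth_fun f \<Longrightarrow> continuous_on X f"
  using has_derivative_continuous_on[OF has_derivative_at_withinI[OF smooth_funD[of f "[]"]]] by simp

lemma antiderivative_vanishing_left:
  fixes f :: "real \<Rightarrow> real"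
  assumes "continuous_on UNIV f" and 0: "\<And>t. t \<le> 0 \<Longrightarrow> f t = 0"
  obtains F where "\<And>t. (F has_real_derivative f t) (at t)" "\<And>t. t \<le> 0 \<Longrightarrow> F t = 0"
proof
  define F where "F t = integral {0..t} f" for t
  show "F t = 0" if "t \<le> 0" for t
    using that unfolding F_def by (cases "t = 0") auto
  show "(F has_real_derivative f t) (at t)" for t
  proof -
    \<comment> \<open>The base point of the integral is moved to the left of both 0 and
      \<open>t\<close>, which changes nothing because \<open>f\<close> vanishes there. Now
      \<open>t\<close> is interior to \<open>{a..b}\<close> and the two-sided derivative
      follows.\<close>
    define a b where "a = min (- 1) (t - 1)" and "b = t + 1"
    have cont: "continuous_on {a..b} f" using assms(1) continuous_on_subset by blast
    have eq: "F u = integral {a..u} f" if "u \<in> {a..b}" for u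
    proof (cases "u \<le> 0")
      case True
      then have "integral {a..u} f = integral {a..u} (\<lambda>_. 0)" by (intro integral_cong) (auto intro: 0)
      then show ?thesis using True unfolding F_def by (cases "u = 0") auto
    next
      case False
      have "integral {a..0} f = integral {a..0} (\<lambda>_. 0)" by (intro integral_cong) (auto intro: 0)
      moreover have "integral {a..0} f + integral {0..u} f = integral {a..u} f"
        using False that by (intro Henstock_Kurzweil_Integration.integral_combine
            integrable_continuous_real continuous_on_subset[OF assms(1)]) (auto simp: a_def)
      ultimately show ?thesis unfolding F_def by simp
    qed
    have t: "t \<in> {a<..<b}" by (auto simp: a_def b_def)
    have "((\<lambda>u. integral {a..u} f) has_real_derivative f t) (at t within {a..b})"
      using t by (intro integral_has_real_derivative cont) auto
    then have "(F has_real_derivative f t) (at t within {a..b})"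
      using t by (subst has_field_derivative_cong_eventually[where g = "\<lambda>u. integral {a..u} f"])
        (auto simp: eventually_at_filter eq intro!: always_eventually)
    then show ?thesis using t by (subst (asm) at_within_interior) auto
  qed
qed

definition smooth_step :: "real \<Rightarrow> (real \<Rightarrow> real) \<Rightarrow> bool" where
  "smooth_step a S \<longleftrightarrow> smooth_fun (\<lambda>t. complex_of_real (S t)) \<and> mono S \<and>
     (\<forall>t\<le>0. S t = 0) \<and> (\<forall>t\<ge>a. S t = 1)"

text \<open>The normalised primitive of the bump \<open>\<beta>\<close>, which is positive exactly
  between 0 and 1.\<close>

lemma ex_smooth_step: "\<exists>S. smooth_step 1 S"
proof -
  define \<beta> where "\<beta> t = exp_step 1 t * exp_step 1 (1 - t)" for t
  have "smooth_fun (\<lambda>t. complex_of_real (exp_step 1 ((- 1) *\<^sub>R t + 1)))"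
    by (rule smooth_fun_affine[OF smooth_fun_exp_step bounded_linear_ident]) auto
  then have \<beta>: "smooth_fun (\<lambda>t. complex_of_real (\<beta> t))"
    using smooth_fun_mult[OF smooth_fun_exp_step[of 1]] by (simp add: \<beta>_def)
  have \<beta>0: "\<beta> t = 0" if "t \<le> 0 \<or> t \<ge> 1" for t using that by (auto simp: \<beta>_def exp_step_def)
  have \<beta>pos: "\<beta> t > 0" if "0 < t" "t < 1" for t using that by (auto simp: \<beta>_def exp_step_def)
  then have \<beta>nn: "\<beta> t \<ge> 0" for t using \<beta>0[of t] by (cases "0 < t \<and> t < 1") (auto simp: less_imp_le not_less)
  have "continuous_on UNIV (\<lambda>t. Re (complex_of_real (\<beta> t)))"
    by (intro continuous_intros smooth_fun_continuous[OF \<beta>])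
  then have "continuous_on UNIV \<beta>" by simp
  from antiderivative_vanishing_left[OF this] obtain F
    where F: "\<And>t. (F has_real_derivative \<beta> t) (at t)" and F0: "\<And>t. t \<le> 0 \<Longrightarrow> F t = 0"
    using \<beta>0 by auto
  have "mono F" by (rule monoI, rule DERIV_nonneg_imp_nondecreasing) (use F \<beta>nn in auto)
  have F1: "F t = F 1" if "t \<ge> 1" for t
  proof (cases "t = 1")
    case False
    then have "\<exists>z. 1 < z \<and> z < t \<and> F t - F 1 = (t - 1) * \<beta> z"
      using that F by (intro MVT2) auto
    then show ?thesis using \<beta>0 by auto
  qed simp
  have "F 0 < F 1" by (rule DERIV_pos_imp_increasing_open)
     (use F \<beta>pos in \<open>auto intro!: continuous_at_imp_continuous_on DERIV_isCont\<close>)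
  then have "0 < F 1" using F0 by simp
  have "smooth_fun (\<lambda>t. complex_of_real (F t))" by (rule smooth_fun_real_step[OF F \<beta>])
  then have "smooth_step 1 (\<lambda>t. F t / F 1)"
    unfolding smooth_step_def
  proof (intro conjI allI impI)
    show "mono (\<lambda>t. F t / F 1)" using \<open>0 < F 1\<close> \<open>mono F\<close> by (simp add: mono_def divide_right_mono)
    show "smooth_fun (\<lambda>t. complex_of_real (F t / F 1))"
      using smooth_fun_cmult[OF \<open>smooth_fun (\<lambda>t. complex_of_real (F t))\<close>, of "1 / F 1"] by simp
  qed (simp add: F0, metis F1 \<open>0 < F 1\<close> divide_self less_irrefl)
  then show ?thesis by blast
qed

text \<open>\<open>S'\<close> is the mean of \<open>S\<close> over \<open>[t - 1, t]\<close>, that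
  is, the convolution of \<open>S\<close> with the indicator of a unit interval. This preserves
  monotonicity, lengthens the transition interval by 1 and has a backward difference as
  derivative.\<close>

lemma smooth_step_next:
  assumes S: "smooth_step a S"
  shows "\<exists>S'. smooth_step (a + 1) S' \<and> (\<forall>t. (S' has_real_derivative S t - S (t - 1)) (at t))"
proof -
  note S = S[unfolded smooth_step_def]
  have "continuous_on UNIV (\<lambda>t. Re (complex_of_real (S t)))"
    by (intro continuous_intros smooth_fun_continuous) (use S in auto)
  then have "continuous_on UNIV S" by simp
  from antiderivative_vanishing_left[OF this] obtain F
    where F: "\<And>t. (F has_real_derivative S t) (at t)" and F0: "\<And>t. t \<le> 0 \<Longrightarrow> F t = 0"
    using S by auto
  define S' where "S' t = F t - F (t - 1)" for t
  have D: "(S' has_real_derivative S t - S (t - 1)) (at t)" for t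
    unfolding S'_def by (auto intro!: derivative_eq_intros F DERIV_chain2[OF F])
  have "smooth_fun (\<lambda>t. complex_of_real (S (1 *\<^sub>R t + - 1)))"
    by (rule smooth_fun_affine[OF _ bounded_linear_ident]) (use S in auto)
  then have "smooth_fun (\<lambda>t. complex_of_real (S t - S (t - 1)))"
    using S smooth_fun_diff by fastforce
  then have "smooth_fun (\<lambda>t. complex_of_real (S' t))" by (rule smooth_fun_real_step[OF D])
  moreover have "mono S'"
  proof (rule monoI)
    fix x y :: real assume "x \<le> y"
    moreover have "S (t - 1) \<le> S t" for t using S by (auto simp: mono_def)
    ultimately show "S' x \<le> S' y"
      by (intro DERIV_nonneg_imp_nondecreasing[of x y S']) (auto intro!: exI[of _ "S t - S (t - 1)" for t] D)
  qed
  moreover have "S' t = 1" if "t \<ge> a + 1" for t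
  proof -
    have "\<exists>z. t - 1 < z \<and> z < t \<and> F t - F (t - 1) = (t - (t - 1)) * S z"
      using F by (intro MVT2) auto
    then show ?thesis using that S by (auto simp: S'_def)
  qed
  ultimately have "smooth_step (a + 1) S'" unfolding smooth_step_def using F0 by (auto simp: S'_def)
  then show ?thesis using D by blast
qed

lemma ex_spline_steps:
  "\<exists>S. \<forall>n. smooth_step (real n + 1) (S n) \<and> (\<forall>t. (S (Suc n) has_real_derivative S n t - S n (t - 1)) (at t))"
proof (rule dependent_nat_choice)
  show "\<exists>S. smooth_step (real 0 + 1) S" using ex_smooth_step by simp
  show "\<exists>S'. smooth_step (real (Suc n) + 1) S' \<and> (\<forall>t. (S' has_real_derivative S t - S (t - 1)) (at t))"
    if "smooth_step (real n + 1) S" for S n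
    using smooth_step_next[OF that] by (simp add: add_ac)
qed

text \<open>Choice fixes one coherent tower of steps. Coherence relates consecutive levels, so the
  levels cannot be chosen independently of each other.\<close>

definition spline_step :: "nat \<Rightarrow> real \<Rightarrow> real" where
  "spline_step = (SOME S. \<forall>n. smooth_step (real n + 1) (S n) \<and>
     (\<forall>t. (S (Suc n) has_real_derivative S n t - S n (t - 1)) (at t)))"

text \<open>A smooth counterpart of the cardinal B-spline, vanishing outside
  \<open>[0, n + 2]\<close>. It keeps two features of B-splines, integer translates that sum to 1
  and derivatives that are backward differences, and it is infinitely differentiable, so that
  functions built from it can lie in \<open>K_space N\<close>.\<close>

definition spline :: "nat \<Rightarrow> real \<Rightarrow> real" where
  "spline n t = spline_step n t - spline_step n (t - 1)"

lemma spline_step: "smooth_step (real n + 1) (spline_step n)"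
  and DERIV_spline_step: "(spline_step (Suc n) has_real_derivative spline n t) (at t)"
  using someI_ex[OF ex_spline_steps] unfolding spline_def spline_step_def by blast+

lemma smooth_fun_spline: "smooth_fun (\<lambda>t. complex_of_real (spline n t))"
proof -
  have "smooth_fun (\<lambda>t. complex_of_real (spline_step n (1 *\<^sub>R t + - 1)))"
    by (rule smooth_fun_affine[OF _ bounded_linear_ident]) (use spline_step[of n] in \<open>auto simp: smooth_step_def\<close>)
  then show ?thesis
    using spline_step[of n] smooth_fun_diff unfolding spline_def smooth_step_def by fastforce
qed

lemma DERIV_spline: "(spline (Suc n) has_real_derivative spline n t - spline n (t - 1)) (at t)"
  unfolding spline_def[of "Suc n", abs_def]
  by (auto intro!: derivative_eq_intros DERIV_spline_step DERIV_chain2[OF DERIV_spline_step])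

lemma spline_nonneg: "0 \<le> spline n t"
  using spline_step[of n] unfolding spline_def smooth_step_def mono_def by simp

lemma spline_eq_0: "(t::real) \<le> 0 \<or> t \<ge> real n + 2 \<Longrightarrow> spline n t = 0"
  using spline_step[of n] unfolding spline_def smooth_step_def by auto

text \<open>The sum telescopes; the condition on \<open>K\<close> places the two remaining arguments
  where the step is constantly 1 and constantly 0.\<close>

lemma sum_spline:
  assumes "\<bar>t\<bar> + n + 2 \<le> real K"
  shows "(\<Sum>j\<in>{- int K..int K}. spline n (t - of_int j)) = 1"
proof -
  have "(\<Sum>j\<in>{- int K..int K}. spline n (t - of_int j)) = spline_step n (t + K) - spline_step n (t - K - 1)"
  proof (induction K)
    case (Suc K)
    have "{- int (Suc K)..int (Suc K)} = insert (- int (Suc K)) (insert (int (Suc K)) {- int K..int K})"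
      by auto
    then show ?case using Suc by (simp add: spline_def algebra_simps)
  qed (simp add: spline_def)
  also have "\<dots> = 1 - 0"
    using spline_step[of n] assms unfolding smooth_step_def by (intro arg_cong2[of _ _ _ _ "(-)"]) auto
  finally show ?thesis by simp
qed

section \<open>Quasi-interpolation on the integer lattice\<close>

lemma spline_le_1: "spline n t \<le> 1"
proof -
  note S = spline_step[of n, unfolded smooth_step_def]
  have "spline_step n t \<le> spline_step n (max t (real n + 1))" "spline_step n (min (t - 1) 0) \<le> spline_step n (t - 1)"
    using S by (intro monoD[of "spline_step n"]; simp)+
  moreover have "spline_step n (max t (real n + 1)) = 1" "spline_step n (min (t - 1) 0) = 0" using S by auto
  ultimately show ?thesis unfolding spline_def by linarith
qed

text \<open>The order may differ between coordinates because a derivative in direction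
  \<open>c\<close> lowers only \<open>\<nu> c\<close>.\<close>

definition bspline :: "('a::euclidean_space \<Rightarrow> nat) \<Rightarrow> 'a \<Rightarrow> complex" where
  "bspline \<nu> u = of_real (\<Prod>b\<in>Basis. spline (\<nu> b) (u \<bullet> b))"

text \<open>The family contains scalar multiples because a derivative in direction \<open>b\<close>
  brings out the factor \<open>b \<bullet> a\<close>.\<close>

lemma smooth_fun_inner:
  assumes "smooth_fun f"
  shows "smooth_fun (\<lambda>u. f (u \<bullet> a))"
proof (rule smooth_fun_family[where \<F> = "{\<lambda>u. c * f (u \<bullet> a) | c f. smooth_fun f}"])
  show "(\<lambda>u. f (u \<bullet> a)) \<in> {\<lambda>u. c * f (u \<bullet> a) | c f. smooth_fun f}"
    using assms by (auto intro!: exI[of _ 1] exI[of _ f])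
next
  fix g assume "g \<in> {\<lambda>u. c * f (u \<bullet> a) | c f. smooth_fun f}"
  then obtain c f where g: "g = (\<lambda>u. c * f (u \<bullet> a))" and f: "smooth_fun f" by auto
  let ?D = "\<lambda>u. frechet_derivative f (at (u \<bullet> a))"
  have "(g has_derivative (\<lambda>v. c * ?D u (v \<bullet> a))) (at u)" for u
    unfolding g
    by (intro has_derivative_mult_right has_derivative_compose[OF _ smooth_funD[OF f, of "[]", simplified]])
      (auto intro!: derivative_eq_intros)
  moreover have "?D u (v \<bullet> a) = of_real (v \<bullet> a) * pdl [1] f (u \<bullet> a)" for u v
  proof -
    have "linear (?D u)" using smooth_funD[OF f, of "[]"] has_derivative_linear by fastforce
    from linear_scale[OF this, of "v \<bullet> a" 1] show ?thesis by (simp add: scaleR_conv_of_real)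
  qed
  ultimately have "(g has_derivative (\<lambda>v. (c * of_real (v \<bullet> a)) * pdl [1] f (u \<bullet> a))) (at u)" for u
    by (simp only: mult.assoc)
  moreover have "smooth_fun (pdl [1] f)" using f by (intro smooth_fun_pdl) auto
  ultimately show "\<exists>f'. (\<forall>x. (g has_derivative f' x) (at x)) \<and>
      (\<forall>b\<in>Basis. (\<lambda>x. f' x b) \<in> {\<lambda>u. c * f (u \<bullet> a) | c f. smooth_fun f})"
    by (intro exI[of _ "\<lambda>u v. (c * of_real (v \<bullet> a)) * pdl [1] f (u \<bullet> a)"]) blast
qed

lemma smooth_fun_bspline: "smooth_fun (bspline \<nu>)"
proof -
  have "smooth_fun (\<lambda>u. \<Prod>b\<in>Basis. complex_of_real (spline (\<nu> b) (u \<bullet> b)))"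
    by (intro smooth_fun_prod smooth_fun_inner[OF smooth_fun_spline])
  then show ?thesis by (simp add: bspline_def[abs_def])
qed

lemma pdl_eq_vector_derivative:
  assumes f: "smooth_fun f" and d: "((\<lambda>t. f (u + t *\<^sub>R c)) has_vector_derivative d) (at 0)"
  shows "pdl [c] f u = d"
proof -
  have "((\<lambda>t. f (u + t *\<^sub>R c)) has_derivative (\<lambda>s. frechet_derivative f (at (u + 0 *\<^sub>R c)) (s *\<^sub>R c))) (at 0)"
    by (rule has_derivative_compose[OF _ smooth_funD[OF f, of "[]", simplified]])
      (auto intro!: derivative_eq_intros)
  from has_derivative_unique[OF this d[unfolded has_vector_derivative_def]]
  have "frechet_derivative f (at (u + 0 *\<^sub>R c)) (1 *\<^sub>R c) = 1 *\<^sub>R d" by metis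
  then show ?thesis by simp
qed

lemma bspline_split:
  "c \<in> Basis \<Longrightarrow> bspline \<nu> u = of_real (spline (\<nu> c) (u \<bullet> c)) * (\<Prod>b\<in>Basis - {c}. of_real (spline (\<nu> b) (u \<bullet> b)))"
  by (simp add: bspline_def prod.remove[of Basis c])

lemma pdl_bspline1:
  assumes c: "c \<in> Basis" and \<nu>: "\<nu> c = Suc k"
  shows "pdl [c] (bspline \<nu>) = fdiff [c] (bspline (\<nu>(c := k)))"
proof
  fix u
  let ?P = "\<lambda>u. \<Prod>b\<in>Basis - {c}. complex_of_real (spline (\<nu> b) (u \<bullet> b))"
  have P: "?P (u + t *\<^sub>R c) = ?P u" for t
    using c by (intro prod.cong) (auto simp: inner_add_left inner_Basis)
  have P2: "(\<Prod>b\<in>Basis - {c}. complex_of_real (spline ((\<nu>(c := k)) b) (v \<bullet> b))) = ?P v" for v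
    by (intro prod.cong) auto
  have "((\<lambda>t. spline (Suc k) (u \<bullet> c + t)) has_real_derivative
      (spline k (u \<bullet> c + 0) - spline k (u \<bullet> c + 0 - 1)) * 1) (at 0)"
    by (rule DERIV_chain2[OF DERIV_spline]) (auto intro!: derivative_eq_intros)
  then have "((\<lambda>t. spline (Suc k) (u \<bullet> c + t)) has_real_derivative
      (spline k (u \<bullet> c) - spline k (u \<bullet> c - 1))) (at 0)" by simp
  from has_vector_derivative_mult_left[OF has_vector_derivative_of_real[OF this], of "?P u"]
  have "((\<lambda>t. of_real (spline (Suc k) (u \<bullet> c + t)) * ?P u) has_vector_derivative
      of_real (spline k (u \<bullet> c) - spline k (u \<bullet> c - 1)) * ?P u) (at 0)" .
  moreover have "bspline \<nu> (u + t *\<^sub>R c) = of_real (spline (Suc k) (u \<bullet> c + t)) * ?P u" for t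
    unfolding bspline_split[OF c] P using c \<nu> by (simp add: inner_add_left)
  ultimately have "((\<lambda>t. bspline \<nu> (u + t *\<^sub>R c)) has_vector_derivative
      of_real (spline k (u \<bullet> c) - spline k (u \<bullet> c - 1)) * ?P u) (at 0)" by simp
  from pdl_eq_vector_derivative[OF smooth_fun_bspline this]
  have "pdl [c] (bspline \<nu>) u = of_real (spline k (u \<bullet> c) - spline k (u \<bullet> c - 1)) * ?P u" .
  also have "\<dots> = fdiff [c] (bspline (\<nu>(c := k))) u"
    using P[of "-1"] c unfolding fdiff.simps bspline_split[OF c] P2
    by (simp add: inner_diff_left algebra_simps)
  finally show "pdl [c] (bspline \<nu>) u = fdiff [c] (bspline (\<nu>(c := k))) u" .
qed

text \<open>Every derivative is traded for a backward difference and one order in its own direction;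
  the bound on \<open>count_list\<close> keeps the subtraction of natural numbers exact.\<close>

lemma pdl_bspline:
  assumes "set bs \<subseteq> Basis" "\<And>b. count_list bs b \<le> \<nu> b"
  shows "pdl bs (bspline \<nu>) = fdiff bs (bspline (\<lambda>b. \<nu> b - count_list bs b))"
  using assms
proof (induction bs)
  case (Cons c bs)
  let ?\<nu> = "\<lambda>b. \<nu> b - count_list bs b"
  have bs: "set bs \<subseteq> Basis" and c: "c \<in> Basis" using Cons.prems by auto
  have "count_list bs b \<le> \<nu> b" for b using Cons.prems(2)[of b] by (auto split: if_splits)
  from Cons.IH[OF bs this] have IH: "pdl bs (bspline \<nu>) = fdiff bs (bspline ?\<nu>)" .
  have "?\<nu> c = Suc (\<nu> c - count_list (c # bs) c)" using Cons.prems(2)[of c] by simp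
  from pdl_bspline1[OF c, of ?\<nu>, OF this] have eq: "pdl [c] (bspline ?\<nu>) = fdiff [c] (bspline (?\<nu>(c := \<nu> c - count_list (c # bs) c)))" .
  have "?\<nu>(c := \<nu> c - count_list (c # bs) c) = (\<lambda>b. \<nu> b - count_list (c # bs) b)" by auto
  note eq = eq[unfolded this]
  have "pdl (c # bs) (bspline \<nu>) = pdl [c] (fdiff bs (bspline ?\<nu>))" by (simp add: IH)
  also have "\<dots> = fdiff bs (pdl [c] (bspline ?\<nu>))" using c by (intro pdl_fdiff smooth_fun_bspline) auto
  also have "\<dots> = fdiff (bs @ [c]) (bspline (\<lambda>b. \<nu> b - count_list (c # bs) b))"
    unfolding eq by (simp only: fdiff_append)
  finally show ?case by (simp only: fdiff_snoc)
qed simp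

lemma norm_bspline_le: "norm (bspline \<nu> u) \<le> 1"
  unfolding bspline_def norm_of_real
  by (simp add: abs_prod spline_nonneg) (intro prod_le_1, auto simp: spline_nonneg spline_le_1)

lemma bspline_support:
  assumes "bspline \<nu> u \<noteq> 0" "\<And>b. \<nu> b \<le> r"
  shows "norm (u::'a::euclidean_space) \<le> real DIM('a) * (real r + 2)"
proof -
  have "norm u \<le> (\<Sum>b\<in>Basis. \<bar>u \<bullet> b\<bar>)" by (rule norm_le_l1)
  also have "\<dots> \<le> (\<Sum>b\<in>(Basis::'a set). real r + 2)"
  proof (rule sum_mono)
    fix b :: 'a assume "b \<in> Basis"
    then have "spline (\<nu> b) (u \<bullet> b) \<noteq> 0" using assms(1) by (auto simp: bspline_def)
    then show "\<bar>u \<bullet> b\<bar> \<le> real r + 2"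
      using spline_eq_0[where t = "u \<bullet> b" and n = "\<nu> b"] assms(2)[of b] by linarith
  qed
  finally show ?thesis by simp
qed

lemma fdiff_norm_le:
  fixes f :: "'a::real_vector \<Rightarrow> 'c::real_normed_vector"
  assumes "\<And>u. norm (f u) \<le> B"
  shows "norm (fdiff bs f u) \<le> 2 ^ length bs * B"
proof (induction bs arbitrary: u)
  case (Cons b bs)
  show ?case using norm_triangle_ineq4[of "fdiff bs f u" "fdiff bs f (u - b)"] Cons[of u] Cons[of "u - b"] by simp
qed (use assms in simp)

lemma fdiff_support:
  fixes f :: "'a::euclidean_space \<Rightarrow> 'c::ab_group_add"
  assumes "fdiff bs f u \<noteq> 0" "set bs \<subseteq> Basis" "\<And>u. f u \<noteq> 0 \<Longrightarrow> norm u \<le> \<rho>"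
  shows "norm u \<le> \<rho> + length bs"
  using assms(1,2)
proof (induction bs arbitrary: u)
  case (Cons b bs)
  then consider "fdiff bs f u \<noteq> 0" | "fdiff bs f (u - b) \<noteq> 0" by force
  then show ?case
  proof cases
    case 1 then show ?thesis using Cons by force
  next
    case 2
    then have "norm (u - b) \<le> \<rho> + length bs" using Cons by force
    moreover have "norm u \<le> norm (u - b) + norm b" using norm_triangle_ineq[of "u - b" b] by simp
    ultimately show ?thesis using Cons.prems by simp
  qed
qed (use assms in simp)

section \<open>The integer lattice and finite sums over it\<close>

definition int_lattice :: "'a::euclidean_space set" where
  "int_lattice = {z. \<forall>b\<in>Basis. z \<bullet> b \<in> \<int>}"

definition lattice_box :: "nat \<Rightarrow> 'a::euclidean_space set" where
  "lattice_box K = {z \<in> int_lattice. \<forall>b\<in>Basis. \<bar>z \<bullet> b\<bar> \<le> real K}"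

text \<open>Integer coordinates turn a sum over the box into a sum over \<open>PiE\<close>, which
  \<open>prod_sum_PiE\<close> factors over the coordinates.\<close>

lemma
  shows finite_lattice_box: "finite (lattice_box K :: 'a::euclidean_space set)"
    and sum_lattice_box: "sum F (lattice_box K :: 'a set) =
      (\<Sum>n\<in>PiE Basis (\<lambda>_. {- int K..int K}). F (\<Sum>b\<in>Basis. of_int (n b) *\<^sub>R b))"
proof -
  let ?P = "PiE (Basis :: 'a set) (\<lambda>_. {- int K..int K})"
  let ?j = "\<lambda>n :: 'a \<Rightarrow> int. (\<Sum>b\<in>Basis. of_int (n b) *\<^sub>R b) :: 'a"
  let ?i = "\<lambda>z :: 'a. restrict (\<lambda>b. \<lfloor>z \<bullet> b\<rfloor>) Basis"
  have in_P: "?i z \<in> ?P" if "z \<in> lattice_box K" for z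
  proof (rule PiE_I)
    fix b :: 'a assume b: "b \<in> Basis"
    then have "z \<bullet> b \<in> \<int>" "\<bar>z \<bullet> b\<bar> \<le> real K"
      using that unfolding lattice_box_def int_lattice_def by auto
    then obtain m where "z \<bullet> b = of_int m" "\<bar>z \<bullet> b\<bar> \<le> real K" by (metis Ints_cases)
    then show "?i z b \<in> {- int K..int K}" using b by (auto simp: abs_le_iff)
  qed auto
  have ji: "?j (?i z) = z" if "z \<in> lattice_box K" for z
  proof -
    have "?j (?i z) = (\<Sum>b\<in>Basis. (z \<bullet> b) *\<^sub>R b)"
      using that by (intro sum.cong) (auto simp: lattice_box_def int_lattice_def elim!: Ints_cases dest!: bspec)
    then show ?thesis by (simp add: euclidean_representation)
  qed
  have j: "?j n \<in> lattice_box K" if "n \<in> ?P" for n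
    using that by (auto simp: lattice_box_def int_lattice_def PiE_iff)
  have ij: "?i (?j n) = n" if "n \<in> ?P" for n
    using that by (auto simp: fun_eq_iff PiE_def extensional_def restrict_def)
  have "finite ?P" by (intro finite_PiE) auto
  then show "finite (lattice_box K :: 'a set)"
  proof (rule finite_surj[of _ _ ?j], intro subsetI)
    fix z :: 'a assume z: "z \<in> lattice_box K"
    show "z \<in> ?j ` ?P" by (rule image_eqI[where x = "?i z"], rule ji[OF z, symmetric], rule in_P[OF z])
  qed
  show "sum F (lattice_box K :: 'a set) = (\<Sum>n\<in>?P. F (?j n))"
    by (rule sum.reindex_bij_witness[where i = ?j and j = ?i]) (use in_P j ij ji in auto)
qed

lemma bspline_partition:
  assumes "\<And>b. b \<in> Basis \<Longrightarrow> \<bar>u \<bullet> b\<bar> + \<nu> b + 2 \<le> real K"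
  shows "(\<Sum>z\<in>lattice_box K. bspline \<nu> (u - z)) = 1"
proof -
  have "(\<Sum>z\<in>lattice_box K. bspline \<nu> (u - z)) =
    (\<Sum>n\<in>PiE Basis (\<lambda>_. {- int K..int K}). \<Prod>b\<in>Basis. complex_of_real (spline (\<nu> b) (u \<bullet> b - of_int (n b))))"
    unfolding sum_lattice_box bspline_def by (simp add: inner_diff_left)
  also have "\<dots> = (\<Prod>b\<in>Basis. \<Sum>j\<in>{- int K..int K}. complex_of_real (spline (\<nu> b) (u \<bullet> b - of_int j)))"
    by (rule prod_sum_PiE[symmetric]) auto
  also have "\<dots> = (\<Prod>b\<in>(Basis::'a set). 1)"
    by (intro prod.cong refl) (simp add: sum_spline[OF assms] flip: of_real_sum)
  finally show ?thesis by simp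
qed

text \<open>The shift loses or gains only points in the boundary layer of the box, where
  \<open>H\<close> vanishes because of the slack 1 in \<open>supp\<close>.\<close>

lemma sum_lattice_box_shift:
  assumes b: "b \<in> Basis" and supp: "\<And>z. H z \<noteq> 0 \<Longrightarrow> norm z + 1 \<le> real K"
  shows "(\<Sum>z\<in>lattice_box K. H (z + b)) = sum H (lattice_box K)"
proof -
  have in_box: "z \<in> lattice_box K \<and> z - b \<in> lattice_box K" if "H z \<noteq> 0" "z \<in> int_lattice" for z
  proof -
    have "\<bar>z \<bullet> c\<bar> + 1 \<le> K" if "c \<in> Basis" for c
      using Basis_le_norm[OF that, of z] supp[OF \<open>H z \<noteq> 0\<close>] by linarith
    moreover have "b \<bullet> c \<in> {0, 1}" if "c \<in> Basis" for c using b that by (auto simp: inner_Basis)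
    ultimately show ?thesis using that(2)
      by (fastforce simp: lattice_box_def int_lattice_def inner_diff_left)
  qed
  have lat: "z \<in> int_lattice" if "z \<in> lattice_box K" for z using that by (auto simp: lattice_box_def)
  have lat': "z + b \<in> int_lattice" if "z \<in> lattice_box K" for z
    using that b by (auto simp: lattice_box_def int_lattice_def inner_add_left inner_Basis)
  have "(\<Sum>z\<in>lattice_box K. H (z + b)) = sum H ((\<lambda>z. z + b) ` lattice_box K)"
    by (subst sum.reindex) (auto simp: inj_on_def)
  also have "\<dots> = sum H (lattice_box K)"
  proof (rule sum.mono_neutral_cong)
    show "H z = 0" if "z \<in> lattice_box K - (\<lambda>z. z + b) ` lattice_box K" for z
      using in_box[of z] lat that by (metis DiffE diff_add_cancel image_eqI)
    show "H z = 0" if "z \<in> (\<lambda>z. z + b) ` lattice_box K - lattice_box K" for z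
      using in_box[of z] lat' that by auto
  qed (auto simp: finite_lattice_box)
  finally show ?thesis .
qed

text \<open>Reindexing \<open>z\<close> by \<open>b\<close> moves a difference from the spline to
  the samples. As the spline is evaluated at \<open>u - z\<close>, the differences of
  \<open>G\<close> are again backward and no sign appears. The bound on \<open>K\<close> covers the
  support of \<open>V\<close> enlarged by \<open>length bs\<close>, plus 1 for the shift.\<close>

lemma fdiff_summation_by_parts:
  fixes V G :: "'a::euclidean_space \<Rightarrow> complex"
  assumes "set bs \<subseteq> Basis" and supp: "\<And>u. V u \<noteq> 0 \<Longrightarrow> norm u \<le> \<rho>"
    and K: "norm u + \<rho> + length bs + 1 \<le> real K"
  shows "(\<Sum>z\<in>lattice_box K. fdiff bs V (u - z) * G z) = (\<Sum>z\<in>lattice_box K. V (u - z) * fdiff bs G z)"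
  using assms(1) K
proof (induction bs arbitrary: G)
  case (Cons b bs)
  let ?V = "fdiff bs V"
  have "(\<Sum>z\<in>lattice_box K. ?V (u - z - b) * G z) = (\<Sum>z\<in>lattice_box K. (\<lambda>z. ?V (u - z) * G (z - b)) (z + b))"
    by (simp add: diff_diff_eq)
  also have "\<dots> = (\<Sum>z\<in>lattice_box K. ?V (u - z) * G (z - b))"
  proof (rule sum_lattice_box_shift)
    fix z assume "?V (u - z) * G (z - b) \<noteq> 0"
    then have "norm (u - z) \<le> \<rho> + length bs"
      using Cons.prems(1) supp by (intro fdiff_support[of bs V]) auto
    moreover have "norm z \<le> norm u + norm (u - z)" using norm_triangle_ineq4[of u "u - z"] by simp
    ultimately show "norm z + 1 \<le> real K" using Cons.prems(2) by simp
  qed (use Cons.prems in auto)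
  finally have "(\<Sum>z\<in>lattice_box K. fdiff (b # bs) V (u - z) * G z) = (\<Sum>z\<in>lattice_box K. ?V (u - z) * fdiff [b] G z)"
    by (simp add: left_diff_distrib right_diff_distrib sum_subtractf)
  also have "\<dots> = (\<Sum>z\<in>lattice_box K. V (u - z) * fdiff bs (fdiff [b] G) z)"
    using Cons.prems by (intro Cons.IH) auto
  also have "fdiff bs (fdiff [b] G) = fdiff (b # bs) G" by (rule trans[OF fdiff_append[symmetric] fdiff_snoc])
  finally show ?case .
qed simp


text \<open>A radius that contains the support of the spline of order \<open>r\<close> and of its
  derivatives up to order \<open>r\<close>: the first summand is the \<open>l1\<close> bound for the
  cube of side \<open>r + 2\<close>, the second pays for up to \<open>r\<close> unit
  differences.\<close>

definition spline_radius :: "'a::euclidean_space itself \<Rightarrow> nat \<Rightarrow> real" where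
  "spline_radius _ r = real DIM('a) * (real r + 2) + real r"

abbreviation cardinal_spline :: "nat \<Rightarrow> 'a::euclidean_space \<Rightarrow> complex" where
  "cardinal_spline r \<equiv> bspline (\<lambda>_. r)"

lemma pdl_cardinal_spline:
  assumes "set bs \<subseteq> Basis" "length bs \<le> r"
  shows "pdl bs (cardinal_spline r) = fdiff bs (bspline (\<lambda>b. r - count_list bs b))"
  using order_trans[OF count_le_length assms(2)] by (intro pdl_bspline assms(1))

lemma norm_pdl_cardinal_spline_le:
  assumes "set bs \<subseteq> Basis" "length bs \<le> r"
  shows "norm (pdl bs (cardinal_spline r) u) \<le> 2 ^ r"
proof -
  have "norm (pdl bs (cardinal_spline r) u) \<le> 2 ^ length bs * 1"
    unfolding pdl_cardinal_spline[OF assms] by (intro fdiff_norm_le norm_bspline_le)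
  also have "\<dots> \<le> 2 ^ r" using assms by (simp add: power_increasing)
  finally show ?thesis .
qed

lemma pdl_cardinal_spline_support:
  fixes u :: "'a::euclidean_space"
  assumes "set bs \<subseteq> Basis" "length bs \<le> r" "pdl bs (cardinal_spline r) u \<noteq> 0"
  shows "norm u \<le> spline_radius TYPE('a) r"
proof -
  have "norm u \<le> real DIM('a) * (real r + 2) + length bs"
    by (rule fdiff_support[OF assms(3)[unfolded pdl_cardinal_spline[OF assms(1,2)]] assms(1)])
      (rule bspline_support[where \<nu> = "\<lambda>b. r - count_list bs b"], assumption, simp)
  then show ?thesis using assms by (simp add: spline_radius_def)
qed

text \<open>Differentiating the splines and summing by parts turns the derivative of the
  quasi-interpolant into an average of the differences \<open>fdiff bs G z\<close>, with nonnegative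
  weights \<open>V (u - z)\<close> of sum 1. Each difference with nonzero weight is close to
  \<open>pdl bs G u\<close> by \<open>fdiff_pdl_bound\<close>, hence so is the average. The set
  \<open>A\<close> is left free because later only some of the nodes are sampled.\<close>

lemma cardinal_spline_approx:
  fixes G :: "'a::euclidean_space \<Rightarrow> complex"
  assumes G: "smooth_fun G" and bs: "set bs \<subseteq> Basis" "length bs \<le> r"
    and A: "finite A" "A \<subseteq> int_lattice" "\<And>z. z \<in> int_lattice \<Longrightarrow> norm (u - z) \<le> spline_radius TYPE('a) r \<Longrightarrow> z \<in> A"
    and S: "\<And>cs v. set cs \<subseteq> Basis \<Longrightarrow> length cs = Suc (length bs) \<Longrightarrow>
      v \<in> cball u (spline_radius TYPE('a) r + r) \<Longrightarrow> norm (pdl cs G v) \<le> S"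
  shows "norm (pdl bs G u - (\<Sum>z\<in>A. pdl bs (cardinal_spline r) (u - z) * G z))
     \<le> real DIM('a) * (spline_radius TYPE('a) r + r) * S"
proof -
  let ?\<rho> = "spline_radius TYPE('a) r" and ?W = "pdl bs (cardinal_spline r)"
  let ?\<nu> = "\<lambda>b. r - count_list bs b"
  define V :: "'a \<Rightarrow> real" where "V u = (\<Prod>b\<in>Basis. spline (?\<nu> b) (u \<bullet> b))" for u
  have VW: "bspline ?\<nu> = (\<lambda>u. complex_of_real (V u))" by (simp add: bspline_def[abs_def] V_def)
  have V0: "0 \<le> V v" for v by (auto simp: V_def intro!: prod_nonneg spline_nonneg)
  \<comment> \<open>Large enough for both the partition of unity and the summation by parts; the box
    is auxiliary, since outside the support of the spline it makes no difference to the sum over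
    \<open>A\<close>.\<close>
  define K where "K = nat \<lceil>norm u + ?\<rho> + r + 2\<rceil>"
  have K: "norm u + ?\<rho> + r + 2 \<le> real K" unfolding K_def by linarith
  have S0: "0 \<le> S"
    by (rule order_trans[OF norm_ge_zero S[of "replicate (Suc (length bs)) (SOME b. b \<in> Basis)" u]])
      (auto simp: spline_radius_def SOME_Basis)
  have lat: "z \<in> int_lattice" if "z \<in> lattice_box K" for z :: 'a using that by (simp add: lattice_box_def)
  have boxI: "z \<in> lattice_box K" if "z \<in> int_lattice" "norm (u - z) \<le> ?\<rho>" for z
  proof -
    have "norm z \<le> norm u + norm (u - z)" using norm_triangle_ineq4[of u "u - z"] by simp
    then have "norm z \<le> K" using that K by linarith
    then show ?thesis using that Basis_le_norm order_trans by (fastforce simp: lattice_box_def)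
  qed
  have supp: "norm v \<le> ?\<rho>" if "?W v \<noteq> 0" for v by (rule pdl_cardinal_spline_support[OF bs that])
  have suppV: "norm v \<le> real DIM('a) * (real r + 2)" if "bspline ?\<nu> v \<noteq> 0" for v
    using bspline_support[OF that, of r] by simp
  have "(\<Sum>z\<in>A. ?W (u - z) * G z) = (\<Sum>z\<in>lattice_box K. ?W (u - z) * G z)"
  proof (rule sum.mono_neutral_cong[OF finite_lattice_box A(1) _ _ refl])
    show "?W (u - z) * G z = 0" if "z \<in> lattice_box K - A" for z
      using that A(3)[OF lat supp, of z] by auto
    show "?W (u - z) * G z = 0" if "z \<in> A - lattice_box K" for z
      using that A(2) boxI[OF _ supp, of z] by auto
  qed
  also have "\<dots> = (\<Sum>z\<in>lattice_box K. bspline ?\<nu> (u - z) * fdiff bs G z)"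
    unfolding pdl_cardinal_spline[OF bs]
    using bs K by (intro fdiff_summation_by_parts[OF _ suppV]) (auto simp: spline_radius_def)
  finally have 1: "(\<Sum>z\<in>A. ?W (u - z) * G z) = (\<Sum>z\<in>lattice_box K. bspline ?\<nu> (u - z) * fdiff bs G z)" .
  have part: "(\<Sum>z\<in>lattice_box K. bspline ?\<nu> (u - z)) = 1"
  proof (rule bspline_partition)
    fix b :: 'a assume "b \<in> Basis"
    then have "\<bar>u \<bullet> b\<bar> \<le> norm u" by (rule Basis_le_norm)
    moreover have "0 \<le> ?\<rho>" by (simp add: spline_radius_def)
    ultimately show "\<bar>u \<bullet> b\<bar> + real (?\<nu> b) + 2 \<le> real K" using K by linarith
  qed
  have partV: "(\<Sum>z\<in>lattice_box K. V (u - z)) = 1"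
  proof -
    have "complex_of_real (\<Sum>z\<in>lattice_box K. V (u - z)) = of_real 1"
      using part unfolding VW by (simp only: of_real_sum of_real_1)
    then show ?thesis by (simp only: of_real_eq_iff)
  qed
  have "pdl bs G u = (\<Sum>z\<in>lattice_box K. bspline ?\<nu> (u - z)) * pdl bs G u" by (simp only: part mult_1)
  with 1 have "pdl bs G u - (\<Sum>z\<in>A. ?W (u - z) * G z)
     = (\<Sum>z\<in>lattice_box K. bspline ?\<nu> (u - z) * (pdl bs G u - fdiff bs G z))"
    by (simp only: sum_distrib_right right_diff_distrib sum_subtractf)
  also have "norm \<dots> \<le> (\<Sum>z\<in>lattice_box K. V (u - z) * (real DIM('a) * (?\<rho> + r) * S))"
  proof (rule sum_norm_le)
    fix z :: 'a
    show "norm (bspline ?\<nu> (u - z) * (pdl bs G u - fdiff bs G z)) \<le> V (u - z) * (real DIM('a) * (?\<rho> + r) * S)"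
    proof (cases "V (u - z) = 0")
      case False
      then have "norm (u - z) \<le> real DIM('a) * (real r + 2)" by (intro suppV) (simp add: VW)
      then have "norm (z - u) \<le> ?\<rho>" by (simp add: spline_radius_def norm_minus_commute)
      then have "norm (fdiff bs G z - pdl bs G u) \<le> real DIM('a) * (?\<rho> + length bs) * S"
        using bs by (intro fdiff_pdl_bound[OF G] S) auto
      also have "\<dots> \<le> real DIM('a) * (?\<rho> + r) * S"
        using bs S0 by (intro mult_right_mono mult_left_mono) auto
      finally show ?thesis
        using V0 by (simp add: VW norm_mult norm_minus_commute mult_left_mono)
    qed (simp add: VW)
  qed
  also have "\<dots> = real DIM('a) * (?\<rho> + r) * S" by (simp only: flip: sum_distrib_right) (simp add: partV)
  finally show ?thesis .
qed

text \<open>Translating by the coordinatewise integer part of \<open>u\<close> puts these points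
  into one box that does not depend on \<open>u\<close>, which makes the count uniform.\<close>

lemma card_lattice_ball:
  "\<exists>c. \<forall>u::'a::euclidean_space. finite {z \<in> int_lattice. norm (u - z) \<le> \<rho>} \<and> card {z \<in> int_lattice. norm (u - z) \<le> \<rho>} \<le> c"
proof -
  define K where "K = nat \<lceil>\<rho> + 1\<rceil>"
  have K: "\<rho> + 1 \<le> real K" unfolding K_def by linarith
  have "{z \<in> int_lattice. norm (u - z) \<le> \<rho>} \<subseteq> (+) (\<Sum>b\<in>Basis. of_int \<lfloor>u \<bullet> b\<rfloor> *\<^sub>R b) ` lattice_box K" for u :: 'a
  proof
    fix z assume z: "z \<in> {z \<in> int_lattice. norm (u - z) \<le> \<rho>}"
    define w :: 'a where "w = (\<Sum>b\<in>Basis. of_int \<lfloor>u \<bullet> b\<rfloor> *\<^sub>R b)"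
    have "\<bar>(z - w) \<bullet> b\<bar> \<le> real K \<and> (z - w) \<bullet> b \<in> \<int>" if b: "b \<in> Basis" for b
    proof -
      have "\<bar>u \<bullet> b - z \<bullet> b\<bar> \<le> \<rho>" using Basis_le_norm[OF b, of "u - z"] z by (simp add: inner_diff_left)
      moreover have "w \<bullet> b = of_int \<lfloor>u \<bullet> b\<rfloor>" using b by (simp add: w_def)
      moreover have "\<bar>u \<bullet> b - of_int \<lfloor>u \<bullet> b\<rfloor>\<bar> \<le> 1" by linarith
      ultimately have "\<bar>(z - w) \<bullet> b\<bar> \<le> real K" using K by (simp add: inner_diff_left) linarith
      moreover have "z \<bullet> b \<in> \<int>" using z b by (simp add: int_lattice_def)
      ultimately show ?thesis using b by (simp add: inner_diff_left w_def)
    qed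
    then have "z - w \<in> lattice_box K" by (auto simp: lattice_box_def int_lattice_def)
    then show "z \<in> (+) (\<Sum>b\<in>Basis. of_int \<lfloor>u \<bullet> b\<rfloor> *\<^sub>R b) ` lattice_box K"
      unfolding w_def[symmetric] by (intro image_eqI[of _ _ "z - w"]) auto
  qed
  note sub = this
  have "card {z \<in> int_lattice. norm (u - z) \<le> \<rho>} \<le> card (lattice_box K :: 'a set)" for u :: 'a
    by (rule order_trans[OF card_mono[OF _ sub] card_image_le]) (auto simp: finite_lattice_box)
  moreover have "finite {z \<in> int_lattice. norm (u - z) \<le> \<rho>}" for u :: 'a
    by (rule finite_subset[OF sub]) (auto simp: finite_lattice_box)
  ultimately show ?thesis by blast
qed

text \<open>After rescaling, the derivative and the sum carry \<open>h ^ length bs\<close>, while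
  the error carries one power more because it involves derivatives of one order higher. The surplus
  power is the gain \<open>h\<close>.\<close>

lemma scaled_cardinal_spline_approx:
  fixes g :: "'a::euclidean_space \<Rightarrow> complex"
  assumes g: "smooth_fun g" and h: "0 < h" and bs: "set bs \<subseteq> Basis" "length bs \<le> r"
    and A: "finite A" "A \<subseteq> int_lattice"
      "\<And>z. z \<in> int_lattice \<Longrightarrow> norm (y - h *\<^sub>R z) \<le> h * spline_radius TYPE('a) r \<Longrightarrow> z \<in> A"
    and S: "\<And>cs v. set cs \<subseteq> Basis \<Longrightarrow> length cs = Suc (length bs) \<Longrightarrow>
      norm (v - y) \<le> h * (spline_radius TYPE('a) r + r) \<Longrightarrow> norm (pdl cs g v) \<le> S"
  shows "norm (pdl bs g y - (\<Sum>z\<in>A. of_real (1 / h) ^ length bs * pdl bs (cardinal_spline r) ((1 / h) *\<^sub>R y - z) * g (h *\<^sub>R z)))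
     \<le> h * (real DIM('a) * (spline_radius TYPE('a) r + r) * S)"
proof -
  let ?\<rho> = "spline_radius TYPE('a) r"
  define G where "G = (\<lambda>u. g (h *\<^sub>R u))"
  define u where "u = (1 / h) *\<^sub>R y"
  define n where "n = length bs"
  have G: "smooth_fun G"
    using smooth_fun_affine[OF g bounded_linear_ident, of h 0] by (simp add: G_def)
  have pG: "pdl cs G = (\<lambda>x. of_real h ^ length cs * pdl cs g (h *\<^sub>R x))" if "set cs \<subseteq> Basis" for cs
    using pdl_affine[OF g bounded_linear_ident _ that, of h 0] by (simp add: G_def)
  have hu: "h *\<^sub>R u = y" using h by (simp add: u_def)
  have sc: "norm (y - h *\<^sub>R v) = h * norm (u - v)" for v
  proof -
    have "y - h *\<^sub>R v = h *\<^sub>R (u - v)" by (simp add: scaleR_diff_right hu)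
    then show ?thesis using h by simp
  qed
  have "norm (pdl bs G u - (\<Sum>z\<in>A. pdl bs (cardinal_spline r) (u - z) * G z))
     \<le> real DIM('a) * (?\<rho> + r) * (h ^ Suc n * S)"
  proof (rule cardinal_spline_approx[OF G bs A(1,2)])
    fix z :: 'a assume "z \<in> int_lattice" "norm (u - z) \<le> ?\<rho>"
    then show "z \<in> A" using h by (intro A(3)) (simp_all add: sc)
  next
    fix cs :: "'a list" and v assume cs: "set cs \<subseteq> Basis" "length cs = Suc (length bs)" and v: "v \<in> cball u (?\<rho> + r)"
    have "norm (h *\<^sub>R v - y) \<le> h * (?\<rho> + r)"
      using v h by (simp add: norm_minus_commute[of "h *\<^sub>R v"] sc dist_norm)
    from S[OF cs this] show "norm (pdl cs G v) \<le> h ^ Suc n * S"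
      unfolding pG[OF cs(1)] using h cs by (simp add: norm_mult norm_power n_def mult_left_mono)
  qed
  also have "pdl bs G u - (\<Sum>z\<in>A. pdl bs (cardinal_spline r) (u - z) * G z)
     = of_real h ^ n * (pdl bs g y - (\<Sum>z\<in>A. of_real (1 / h) ^ length bs * pdl bs (cardinal_spline r) (u - z) * g (h *\<^sub>R z)))"
    unfolding pG[OF bs(1)] hu using h
    by (simp add: right_diff_distrib sum_distrib_left n_def G_def power_divide)
  finally have "h ^ n * norm (pdl bs g y - (\<Sum>z\<in>A. of_real (1 / h) ^ length bs * pdl bs (cardinal_spline r) (u - z) * g (h *\<^sub>R z)))
     \<le> h ^ n * (h * (real DIM('a) * (?\<rho> + r) * S))"
    using h by (simp add: norm_mult norm_power mult_ac)
  then show ?thesis using h by (simp add: u_def)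
qed

section \<open>The spaces of smooth functions with weighted seminorms\<close>

text \<open>Nonnegativity, directedness and local positivity in one predicate:
  \<open>weight_family_tensor\<close> carries them over to \<open>tensor_family M N\<close>, so the
  same lemmas serve all three spaces.\<close>

definition weight_family :: "('g \<Rightarrow> 'a::euclidean_space \<Rightarrow> real) \<Rightarrow> bool" where
  "weight_family M \<longleftrightarrow> (\<forall>\<gamma> x. 0 \<le> M \<gamma> x) \<and>
     (\<forall>\<gamma>1 \<gamma>2. \<exists>\<gamma> C. C > 0 \<and> (\<forall>x. M \<gamma> x \<ge> C * (M \<gamma>1 x + M \<gamma>2 x))) \<and>
     (\<forall>x. \<exists>\<gamma> U C. open U \<and> x \<in> U \<and> C > 0 \<and> (\<forall>x'\<in>U. M \<gamma> x' \<ge> C))"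

lemma weight_family_nonneg: "weight_family M \<Longrightarrow> 0 \<le> M \<gamma> x"
  unfolding weight_family_def by blast

lemma weight_family_locally_pos:
  assumes "weight_family M"
  shows "\<exists>\<gamma> r C. r > 0 \<and> C > 0 \<and> (\<forall>v\<in>ball x r. C \<le> M \<gamma> v)"
proof -
  obtain \<gamma> U C where U: "open U" "x \<in> U" "C > 0" "\<forall>x'\<in>U. M \<gamma> x' \<ge> C"
    using assms unfolding weight_family_def by meson
  then obtain r where "r > 0" "ball x r \<subseteq> U" using openE by blast
  then show ?thesis using U by blast
qed

lemma K_seminorm_upper:
  assumes "f \<in> K_space M" "set bs \<subseteq> Basis" "length bs \<le> m"
  shows "M \<gamma> x * norm (pdl bs f x) \<le> K_seminorm M (\<gamma>, m) f"
  using assms unfolding K_seminorm_def K_space_def K_vals_def by (auto intro!: cSup_upper)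

lemma K_seminorm_least:
  assumes "\<And>x bs. set bs \<subseteq> Basis \<Longrightarrow> length bs \<le> m \<Longrightarrow> M \<gamma> x * norm (pdl bs f x) \<le> c"
  shows "K_seminorm M (\<gamma>, m) f \<le> c"
proof -
  \<comment> \<open>\<open>cSup_least\<close> asks for a nonempty set; the empty list of derivatives
    provides a member.\<close>
  have "M \<gamma> undefined * norm (pdl [] f undefined) \<in> K_vals M \<gamma> m f"
    unfolding K_vals_def by (rule CollectI, rule exI, rule exI[of _ "[]"]) simp
  then show ?thesis unfolding K_seminorm_def using assms
    by (auto simp: K_vals_def intro!: cSup_least)
qed

lemma K_spaceI:
  assumes "smooth_fun f"
    and "\<And>\<gamma> m. \<exists>c. \<forall>x bs. set bs \<subseteq> Basis \<longrightarrow> length bs \<le> m \<longrightarrow> M \<gamma> x * norm (pdl bs f x) \<le> c"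
  shows "f \<in> K_space M"
proof -
  have "bdd_above (K_vals M \<gamma> m f)" for \<gamma> m
    using assms(2)[of m \<gamma>] unfolding K_vals_def bdd_above_def by auto
  then show ?thesis using assms(1) by (simp add: K_space_def)
qed

lemma K_space_smooth: "f \<in> K_space M \<Longrightarrow> smooth_fun f"
  unfolding K_space_def by blast

lemma K_seminorm_nonneg:
  assumes "weight_family M" "f \<in> K_space M"
  shows "0 \<le> K_seminorm M k f"
proof (cases k)
  case (Pair \<gamma> m)
  have "0 \<le> M \<gamma> undefined * norm (pdl [] f undefined)" using weight_family_nonneg[OF assms(1)] by simp
  also have "\<dots> \<le> K_seminorm M k f" unfolding Pair by (rule K_seminorm_upper[OF assms(2)]) auto
  finally show ?thesis .
qed

lemma
  assumes M: "weight_family M" and f: "f \<in> K_space M" and g: "g \<in> K_space M"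
  shows K_space_add: "(\<lambda>x. f x + g x) \<in> K_space M"
    and K_seminorm_add: "K_seminorm M k (\<lambda>x. f x + g x) \<le> K_seminorm M k f + K_seminorm M k g"
proof -
  note sm = K_space_smooth[OF f] K_space_smooth[OF g]
  have *: "M \<gamma> x * norm (pdl bs (\<lambda>x. f x + g x) x) \<le> K_seminorm M (\<gamma>, m) f + K_seminorm M (\<gamma>, m) g"
    if "set bs \<subseteq> Basis" "length bs \<le> m" for \<gamma> x bs m
  proof -
    have "M \<gamma> x * norm (pdl bs f x + pdl bs g x) \<le> M \<gamma> x * norm (pdl bs f x) + M \<gamma> x * norm (pdl bs g x)"
      unfolding distrib_left[symmetric]
      by (rule mult_left_mono[OF norm_triangle_ineq weight_family_nonneg[OF M]])
    also have "\<dots> \<le> K_seminorm M (\<gamma>, m) f + K_seminorm M (\<gamma>, m) g"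
      using that by (intro add_mono K_seminorm_upper f g)
    finally show ?thesis by (simp add: pdl_add[OF sm that(1)])
  qed
  then show "(\<lambda>x. f x + g x) \<in> K_space M" by (intro K_spaceI smooth_fun_add sm) blast
  show "K_seminorm M k (\<lambda>x. f x + g x) \<le> K_seminorm M k f + K_seminorm M k g"
    by (cases k) (auto intro!: K_seminorm_least *)
qed

lemma
  assumes M: "weight_family M" and f: "f \<in> K_space M"
  shows K_space_cmult: "(\<lambda>x. c * f x) \<in> K_space M"
    and K_seminorm_cmult: "K_seminorm M k (\<lambda>x. c * f x) = norm c * K_seminorm M k f"
proof -
  note sm = K_space_smooth[OF f]
  have *: "M \<gamma> x * norm (pdl bs (\<lambda>x. c * f x) x) \<le> norm c * K_seminorm M (\<gamma>, m) f"
    if f: "f \<in> K_space M" "set bs \<subseteq> Basis" "length bs \<le> m" for \<gamma> x bs m f c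
    using mult_left_mono[OF K_seminorm_upper[OF that, of \<gamma> x] norm_ge_zero[of c]]
    by (simp add: pdl_cmult[OF K_space_smooth[OF f(1)] that(2)] norm_mult mult_ac)
  have mem: "(\<lambda>x. c * f x) \<in> K_space M" if "f \<in> K_space M" for f c
    by (rule K_spaceI[OF smooth_fun_cmult[OF K_space_smooth[OF that]]]) (use *[OF that] in blast)
  have le: "K_seminorm M k (\<lambda>x. c * f x) \<le> norm c * K_seminorm M k f" if "f \<in> K_space M" for f c
    by (cases k) (use that in \<open>auto intro!: K_seminorm_least *\<close>)
  show "(\<lambda>x. c * f x) \<in> K_space M" using f by (rule mem)
  show "K_seminorm M k (\<lambda>x. c * f x) = norm c * K_seminorm M k f"
  proof (cases "c = 0")
    case True
    then show ?thesis using le[OF f, of c] K_seminorm_nonneg[OF M mem[OF f, of c], of k] by simp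
  next
    case False
    \<comment> \<open>The reverse inequality is \<open>le\<close> for the function
      \<open>c * f\<close> and the scalar \<open>1 / c\<close>.\<close>
    have "norm c * K_seminorm M k f \<le> norm c * (norm (1 / c) * K_seminorm M k (\<lambda>x. c * f x))"
      using le[OF mem[OF f, of c], of "1 / c"] False by (intro mult_left_mono) auto
    then show ?thesis using le[OF f, of c] False by (simp add: norm_divide)
  qed
qed

lemma K_space_zero [simp]: "(\<lambda>x. 0) \<in> K_space M"
  by (intro K_spaceI) (auto simp: pdl_const intro!: exI[of _ 0])

lemma K_seminorm_zero: "weight_family M \<Longrightarrow> K_seminorm M k (\<lambda>x. 0) = 0"
  using K_seminorm_cmult[of M "\<lambda>x. 0" k 0] by simp

lemma K_space_diff:
  "weight_family M \<Longrightarrow> f \<in> K_space M \<Longrightarrow> g \<in> K_space M \<Longrightarrow> (\<lambda>x. f x - g x) \<in> K_space M"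
  using K_space_add[of M f "\<lambda>x. - 1 * g x"] K_space_cmult[of M g "- 1"] by simp

lemma K_space_sum:
  assumes "weight_family M" "\<And>i. i \<in> A \<Longrightarrow> f i \<in> K_space M"
  shows "(\<lambda>x. \<Sum>i\<in>A. f i x) \<in> K_space M"
  using assms by (induction A rule: infinite_finite_induct) (auto intro: K_space_add)

lemma seminormed_K_space:
  assumes "weight_family M"
  shows "seminormed_space (K_space M) (K_seminorm M)"
  unfolding seminormed_space_def
  using K_space_add[OF assms] K_space_cmult[OF assms] K_seminorm_nonneg[OF assms]
    K_seminorm_cmult[OF assms] K_seminorm_add[OF assms] by auto

lemma hausdorff_K_space:
  assumes "weight_family M"
  shows "hausdorff_space_sn (K_space M) (K_seminorm M)"
  unfolding hausdorff_space_sn_def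
proof (intro ballI impI ext)
  fix f x assume f: "f \<in> K_space M" and 0: "\<forall>i. K_seminorm M i f = 0"
  obtain \<gamma> r C where "r > 0" "C > 0" "\<And>v. v \<in> ball x r \<Longrightarrow> C \<le> M \<gamma> v"
    using weight_family_locally_pos[OF assms, of x] by blast
  then have "C \<le> M \<gamma> x" by simp
  with \<open>C > 0\<close> have "0 < M \<gamma> x" by simp
  moreover have "M \<gamma> x * norm (f x) \<le> 0" using K_seminorm_upper[OF f, of "[]" 0 \<gamma> x] 0 by simp
  ultimately show "f x = 0" by (simp add: mult_le_0_iff)
qed

lemma K_seminorm_mono:
  fixes M :: "'g \<Rightarrow> 'a::euclidean_space \<Rightarrow> real"
  assumes "f \<in> K_space M" "weight_family M" "\<And>x. M \<gamma> x \<le> c * M \<gamma>' x" "m \<le> m'" "0 \<le> c"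
  shows "K_seminorm M (\<gamma>, m) f \<le> c * K_seminorm M (\<gamma>', m') f"
proof (rule K_seminorm_least)
  fix x and bs :: "'a list" assume bs: "set bs \<subseteq> Basis" "length bs \<le> m"
  have "M \<gamma> x * norm (pdl bs f x) \<le> c * M \<gamma>' x * norm (pdl bs f x)"
    using assms(3) by (intro mult_right_mono) auto
  also have "\<dots> \<le> c * K_seminorm M (\<gamma>', m') f"
    unfolding mult.assoc using bs assms by (intro mult_left_mono K_seminorm_upper) auto
  finally show "M \<gamma> x * norm (pdl bs f x) \<le> c * K_seminorm M (\<gamma>', m') f" .
qed

text \<open>Directedness merges finitely many weights into one, and the orders of differentiation
  are replaced by their maximum.\<close>

lemma sum_K_seminorm_le:
  assumes "finite K" "weight_family M"
  shows "\<exists>\<gamma> m C. 0 \<le> C \<and> (\<forall>f\<in>K_space M. (\<Sum>k\<in>K. K_seminorm M k f) \<le> C * K_seminorm M (\<gamma>, m) f)"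
  using assms(1)
proof induction
  case empty
  show ?case by (intro exI[of _ undefined] exI[of _ 0]) auto
next
  case (insert k K)
  then obtain \<gamma> m C where C: "0 \<le> C" "\<And>f. f \<in> K_space M \<Longrightarrow> (\<Sum>k\<in>K. K_seminorm M k f) \<le> C * K_seminorm M (\<gamma>, m) f"
    by blast
  obtain \<gamma>1 m1 where k: "k = (\<gamma>1, m1)" by fastforce
  obtain \<gamma>2 c where c: "c > 0" "\<And>x. M \<gamma>2 x \<ge> c * (M \<gamma> x + M \<gamma>1 x)"
    using assms(2) unfolding weight_family_def by meson
  have le: "M \<gamma> x \<le> 1 / c * M \<gamma>2 x" "M \<gamma>1 x \<le> 1 / c * M \<gamma>2 x" for x
  proof -
    have "0 \<le> c * M \<gamma> x" "0 \<le> c * M \<gamma>1 x" using weight_family_nonneg[OF assms(2)] c(1) by auto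
    then show "M \<gamma> x \<le> 1 / c * M \<gamma>2 x" "M \<gamma>1 x \<le> 1 / c * M \<gamma>2 x"
      using c(1) c(2)[of x] by (auto simp: field_simps)
  qed
  have "(\<Sum>k\<in>insert k K. K_seminorm M k f) \<le> (1 / c + C * (1 / c)) * K_seminorm M (\<gamma>2, max m m1) f"
    if f: "f \<in> K_space M" for f
  proof -
    have "K_seminorm M k f \<le> 1 / c * K_seminorm M (\<gamma>2, max m m1) f"
      unfolding k using c by (intro K_seminorm_mono f assms le) auto
    moreover have "C * K_seminorm M (\<gamma>, m) f \<le> C * (1 / c * K_seminorm M (\<gamma>2, max m m1) f)"
      using c C by (intro mult_left_mono K_seminorm_mono f assms le) auto
    ultimately show ?thesis using C(2)[OF f] insert.hyps by (simp add: distrib_right mult.assoc)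
  qed
  then show ?case using c C by (intro exI[of _ \<gamma>2] exI[of _ "max m m1"] exI[of _ "1 / c + C * (1 / c)"]) auto
qed

text \<open>Local positivity of the weights makes the values \<open>pdl bs h x\<close> Cauchy along
  the filter, which gives candidates \<open>H bs\<close> for the derivatives of the limit.
  Completeness speaks of filters, so differentiation of the limit is proved directly: on a ball
  where a weight is bounded below, the members of a small set \<open>A\<close> have uniformly close
  derivatives.\<close>

lemma complete_K_space:
  fixes M :: "'g \<Rightarrow> 'a::euclidean_space \<Rightarrow> real"
  assumes M: "weight_family M"
  shows "complete_space_sn (K_space M) (K_seminorm M)"
  unfolding complete_space_sn_def
proof (intro allI impI, elim conjE)
  let ?V = "K_space M" and ?p = "K_seminorm M"
  fix F assume F: "F \<noteq> bot" "eventually (\<lambda>h. h \<in> ?V) F"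
    and cauchy: "\<forall>i \<epsilon>. \<epsilon> > 0 \<longrightarrow> (\<exists>A. eventually (\<lambda>h. h \<in> A) F \<and>
       (\<forall>h1\<in>A \<inter> ?V. \<forall>h2\<in>A \<inter> ?V. ?p i (\<lambda>x. h1 x - h2 x) < \<epsilon>))"
  have small: "\<exists>A. eventually (\<lambda>h. h \<in> A) F \<and> A \<subseteq> ?V \<and>
      (\<forall>h1\<in>A. \<forall>h2\<in>A. \<forall>bs x. set bs \<subseteq> Basis \<longrightarrow> length bs \<le> m \<longrightarrow>
        M \<gamma> x * norm (pdl bs h1 x - pdl bs h2 x) \<le> \<epsilon>)" if "\<epsilon> > 0" for \<gamma> m \<epsilon>
  proof -
    obtain A where A: "eventually (\<lambda>h. h \<in> A) F" and
      d: "\<And>h1 h2. h1 \<in> A \<inter> ?V \<Longrightarrow> h2 \<in> A \<inter> ?V \<Longrightarrow> ?p (\<gamma>, m) (\<lambda>x. h1 x - h2 x) < \<epsilon>"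
      using cauchy[rule_format, OF \<open>\<epsilon> > 0\<close>, of "(\<gamma>, m)"] by blast
    have "M \<gamma> x * norm (pdl bs h1 x - pdl bs h2 x) \<le> \<epsilon>"
      if "h1 \<in> A \<inter> ?V" "h2 \<in> A \<inter> ?V" "set bs \<subseteq> Basis" "length bs \<le> m" for h1 h2 bs x
    proof -
      have "M \<gamma> x * norm (pdl bs (\<lambda>x. h1 x - h2 x) x) \<le> ?p (\<gamma>, m) (\<lambda>x. h1 x - h2 x)"
        using that by (intro K_seminorm_upper K_space_diff M) auto
      moreover have "pdl bs (\<lambda>x. h1 x - h2 x) = (\<lambda>x. pdl bs h1 x - pdl bs h2 x)"
        using that by (intro pdl_diff K_space_smooth[of _ M]) auto
      ultimately show ?thesis using d[OF that(1,2)] by simp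
    qed
    moreover have "eventually (\<lambda>h. h \<in> A \<inter> ?V) F" using A F(2) by eventually_elim auto
    ultimately show ?thesis by (intro exI[of _ "A \<inter> ?V"]) blast
  qed
  have nonempty: "A \<noteq> {}" if "eventually (\<lambda>h. h \<in> A) F" for A
    using that F(1) by auto
  have "\<exists>l. ((\<lambda>h. pdl bs h x) \<longlongrightarrow> l) F" if bs: "set bs \<subseteq> Basis" for bs x
  proof -
    obtain \<gamma> r C where r: "r > 0" "C > 0" "\<And>v. v \<in> ball x r \<Longrightarrow> C \<le> M \<gamma> v"
      using weight_family_locally_pos[OF M, of x] by blast
    have "cauchy_filter (filtermap (\<lambda>h. pdl bs h x) F)"
      unfolding cauchy_filter_metric_filtermap
    proof (intro allI impI)
      fix e :: real assume "e > 0"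
      then obtain A where A: "eventually (\<lambda>h. h \<in> A) F"
        "\<And>h1 h2. h1 \<in> A \<Longrightarrow> h2 \<in> A \<Longrightarrow> M \<gamma> x * norm (pdl bs h1 x - pdl bs h2 x) \<le> C * e / 2"
        using small[of "C * e / 2" "length bs" \<gamma>] bs r(2) by auto
      have "norm (pdl bs h1 x - pdl bs h2 x) < e" if "h1 \<in> A" "h2 \<in> A" for h1 h2
      proof -
        have "C * norm (pdl bs h1 x - pdl bs h2 x) \<le> M \<gamma> x * norm (pdl bs h1 x - pdl bs h2 x)"
          using r by (intro mult_right_mono) auto
        also have "\<dots> \<le> C * (e / 2)" using A(2)[OF that] by simp
        finally show ?thesis using r(2) \<open>e > 0\<close> by simp
      qed
      then show "\<exists>P. eventually P F \<and> (\<forall>h1 h2. P h1 \<and> P h2 \<longrightarrow> dist (pdl bs h1 x) (pdl bs h2 x) < e)"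
        using A(1) by (intro exI[of _ "\<lambda>h. h \<in> A"]) (auto simp: dist_norm)
    qed
    moreover have "filtermap (\<lambda>h. pdl bs h x) F \<noteq> bot" using F(1) by (simp add: filtermap_bot_iff)
    ultimately show ?thesis
      using complete_UNIV unfolding complete_uniform filterlim_def by (metis UNIV_I principal_UNIV top_greatest)
  qed
  then obtain H where H: "\<And>bs x. set bs \<subseteq> Basis \<Longrightarrow> ((\<lambda>h. pdl bs h x) \<longlongrightarrow> H bs x) F" by metis
  have conv: "M \<gamma> x * norm (pdl bs h x - H bs x) \<le> \<epsilon>"
    if A: "eventually (\<lambda>h. h \<in> A) F" "\<And>h1 h2. h1 \<in> A \<Longrightarrow> h2 \<in> A \<Longrightarrow> M \<gamma> x * norm (pdl bs h1 x - pdl bs h2 x) \<le> \<epsilon>"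
      and "h \<in> A" "set bs \<subseteq> Basis" for A \<gamma> x bs h \<epsilon>
  proof (rule tendsto_upperbound[OF _ _ F(1)])
    show "((\<lambda>h2. M \<gamma> x * norm (pdl bs h x - pdl bs h2 x)) \<longlongrightarrow> M \<gamma> x * norm (pdl bs h x - H bs x)) F"
      using H[OF that(4)] by (intro tendsto_intros)
    show "eventually (\<lambda>h2. M \<gamma> x * norm (pdl bs h x - pdl bs h2 x) \<le> \<epsilon>) F"
      using A(1) by (rule eventually_mono) (rule A(2)[OF \<open>h \<in> A\<close>])
  qed
  have deriv: "(H bs has_derivative (\<lambda>v. \<Sum>b\<in>Basis. (v \<bullet> b) *\<^sub>R H (b # bs) x)) (at x)"
    if bs: "set bs \<subseteq> Basis" for bs x
    unfolding has_derivative_at_alt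
  proof (intro conjI allI impI)
    show "bounded_linear (\<lambda>v. \<Sum>b\<in>Basis. (v \<bullet> b) *\<^sub>R H (b # bs) x)"
      by (intro bounded_linear_intros)
    fix e :: real assume "e > 0"
    obtain \<gamma> r C where r: "r > 0" "C > 0" "\<And>v. v \<in> ball x r \<Longrightarrow> C \<le> M \<gamma> v"
      using weight_family_locally_pos[OF M, of x] by blast
    \<comment> \<open>Chosen so that errors \<open>\<epsilon> / C\<close> summed over the basis give
      \<open>e / 3\<close>. The three thirds come from the differentiability of one fixed
      \<open>h\<close>, from the distance of its derivative to the candidate, and from a Lipschitz
      bound for \<open>h\<close> minus the limit.\<close>
    define \<epsilon> where "\<epsilon> = e * C / (3 * real DIM('a))"
    have \<epsilon>: "\<epsilon> > 0" "real DIM('a) * (\<epsilon> / C) = e / 3" using r(2) \<open>e > 0\<close> by (auto simp: \<epsilon>_def)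
    obtain A where A: "eventually (\<lambda>h. h \<in> A) F" "A \<subseteq> ?V" and
      small: "\<And>h1 h2 cs v. h1 \<in> A \<Longrightarrow> h2 \<in> A \<Longrightarrow> set cs \<subseteq> Basis \<Longrightarrow> length cs \<le> Suc (length bs) \<Longrightarrow>
        M \<gamma> v * norm (pdl cs h1 v - pdl cs h2 v) \<le> \<epsilon>"
      using small[OF \<epsilon>(1), of "Suc (length bs)" \<gamma>] by auto
    obtain h where h: "h \<in> A" using nonempty[OF A(1)] by auto
    then have smh: "smooth_fun h" using A(2) K_space_smooth by auto
    have div: "a \<le> \<epsilon> / C" if "v \<in> ball x r" "M \<gamma> v * a \<le> \<epsilon>" "0 \<le> a" for v a
    proof -
      have "C * a \<le> M \<gamma> v * a" using r(3)[OF that(1)] that(3) by (rule mult_right_mono)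
      then show ?thesis using that(2) r(2) by (simp add: field_simps)
    qed
    \<comment> \<open>By the mean value inequality the Lipschitz bound holds for
      \<open>h - h2\<close> with every \<open>h2\<close> in \<open>A\<close>; it survives the limit
      in \<open>h2\<close>, so the limit itself need not be known to be differentiable.\<close>
    have lip: "norm ((pdl bs h v - H bs v) - (pdl bs h x - H bs x)) \<le> e / 3 * norm (v - x)" if v: "v \<in> ball x r" for v
    proof (rule tendsto_upperbound[OF _ _ F(1)])
      show "((\<lambda>h2. norm ((pdl bs h v - pdl bs h2 v) - (pdl bs h x - pdl bs h2 x))) \<longlongrightarrow>
          norm ((pdl bs h v - H bs v) - (pdl bs h x - H bs x))) F"
        using H[OF bs] by (intro tendsto_intros)
      show "eventually (\<lambda>h2. norm ((pdl bs h v - pdl bs h2 v) - (pdl bs h x - pdl bs h2 x)) \<le> e / 3 * norm (v - x)) F"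
        using A(1)
      proof (rule eventually_mono)
        fix h2 assume h2: "h2 \<in> A"
        then have smh2: "smooth_fun h2" using A(2) K_space_smooth by auto
        have "norm (pdl [b] (\<lambda>x. pdl bs h x - pdl bs h2 x) w) \<le> \<epsilon> / C" if "b \<in> Basis" "w \<in> ball x r" for b w
        proof -
          have "pdl [b] (\<lambda>x. pdl bs h x - pdl bs h2 x) w = pdl (b # bs) h w - pdl (b # bs) h2 w"
            using pdl_diff[OF smooth_fun_pdl[OF smh bs] smooth_fun_pdl[OF smh2 bs], of "[b]"] that(1) by simp
          moreover have "M \<gamma> w * norm (pdl (b # bs) h w - pdl (b # bs) h2 w) \<le> \<epsilon>"
            using that bs by (intro small h h2) auto
          ultimately show ?thesis using div[OF that(2), of "norm (pdl (b # bs) h w - pdl (b # bs) h2 w)"] by simp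
        qed
        then have "norm ((pdl bs h v - pdl bs h2 v) - (pdl bs h x - pdl bs h2 x)) \<le> real DIM('a) * (\<epsilon> / C) * norm (v - x)"
          using v r(1) by (intro smooth_fun_lipschitz[of "\<lambda>x. pdl bs h x - pdl bs h2 x" "ball x r"]
              smooth_fun_diff smooth_fun_pdl smh smh2 bs) auto
        then show "norm ((pdl bs h v - pdl bs h2 v) - (pdl bs h x - pdl bs h2 x)) \<le> e / 3 * norm (v - x)"
          unfolding \<epsilon>(2) .
      qed
    qed
    let ?D = "frechet_derivative (pdl bs h) (at x)"
    obtain d where d: "d > 0" "\<And>v. norm (v - x) < d \<Longrightarrow> norm (pdl bs h v - pdl bs h x - ?D (v - x)) \<le> e / 3 * norm (v - x)"
      using smooth_funD[OF smh bs, of x] \<open>e > 0\<close> unfolding has_derivative_at_alt by (meson divide_pos_pos zero_less_numeral)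
    have lin: "linear ?D" using smooth_funD[OF smh bs, of x] has_derivative_linear by blast
    have der: "norm (?D v - (\<Sum>b\<in>Basis. (v \<bullet> b) *\<^sub>R H (b # bs) x)) \<le> e / 3 * norm v" for v
    proof -
      have "?D v = ?D (\<Sum>b\<in>Basis. (v \<bullet> b) *\<^sub>R b)" by (simp add: euclidean_representation)
      also have "\<dots> = (\<Sum>b\<in>Basis. (v \<bullet> b) *\<^sub>R pdl (b # bs) h x)" using lin by (simp add: linear_sum linear_scale)
      finally have "?D v - (\<Sum>b\<in>Basis. (v \<bullet> b) *\<^sub>R H (b # bs) x) =
          (\<Sum>b\<in>Basis. (v \<bullet> b) *\<^sub>R (pdl (b # bs) h x - H (b # bs) x))"
        by (simp only: scaleR_diff_right sum_subtractf)
      also have "norm \<dots> \<le> (\<Sum>b\<in>(Basis::'a set). norm v * (\<epsilon> / C))"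
      proof (intro sum_norm_le)
        fix b :: 'a assume b: "b \<in> Basis"
        have "norm (pdl (b # bs) h x - H (b # bs) x) \<le> \<epsilon> / C"
          using b bs r(1) by (intro div[of x] conv[OF A(1) _ h] small) auto
        then show "norm ((v \<bullet> b) *\<^sub>R (pdl (b # bs) h x - H (b # bs) x)) \<le> norm v * (\<epsilon> / C)"
          unfolding norm_scaleR real_norm_def using Basis_le_norm[OF b, of v] by (intro mult_mono) auto
      qed
      also have "\<dots> = (real DIM('a) * (\<epsilon> / C)) * norm v" by simp
      finally show ?thesis unfolding \<epsilon>(2) .
    qed
    show "\<exists>d>0. \<forall>y. norm (y - x) < d \<longrightarrow>
        norm (H bs y - H bs x - (\<Sum>b\<in>Basis. ((y - x) \<bullet> b) *\<^sub>R H (b # bs) x)) \<le> e * norm (y - x)"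
    proof (intro exI[of _ "min d r"] conjI allI impI)
      fix y assume y: "norm (y - x) < min d r"
      let ?L = "\<Sum>b\<in>Basis. ((y - x) \<bullet> b) *\<^sub>R H (b # bs) x"
      have eq: "H bs y - H bs x - ?L = (pdl bs h y - pdl bs h x - ?D (y - x)) + (?D (y - x) - ?L)
          - ((pdl bs h y - H bs y) - (pdl bs h x - H bs x))"
        by simp
      have "norm (H bs y - H bs x - ?L) \<le> norm (pdl bs h y - pdl bs h x - ?D (y - x)) + norm (?D (y - x) - ?L)
          + norm ((pdl bs h y - H bs y) - (pdl bs h x - H bs x))"
        unfolding eq by (rule order_trans[OF norm_triangle_ineq4 add_right_mono[OF norm_triangle_ineq]])
      also have "\<dots> \<le> e / 3 * norm (y - x) + e / 3 * norm (y - x) + e / 3 * norm (y - x)"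
      proof -
        have "norm (y - x) < d" "y \<in> ball x r" using y by (simp_all add: dist_norm norm_minus_commute[of x])
        then show ?thesis by (intro add_mono[OF add_mono[OF d(2) der] lip])
      qed
      finally show "norm (H bs y - H bs x - ?L) \<le> e * norm (y - x)" by (simp add: field_simps)
    qed (use d r in auto)
  qed
  have pH: "pdl bs (H []) = H bs" if "set bs \<subseteq> Basis" for bs
    using that
  proof (induction bs)
    case (Cons b bs)
    then have "pdl (b # bs) (H []) = (\<lambda>x. \<Sum>c\<in>Basis. (b \<bullet> c) *\<^sub>R H (c # bs) x)"
      by (intro pdl_Cons_eq[OF _ deriv]) auto
    also have "\<dots> = H (b # bs)"
    proof
      fix x
      have "(\<Sum>c\<in>Basis. (b \<bullet> c) *\<^sub>R H (c # bs) x) = (\<Sum>c\<in>Basis. if c = b then H (b # bs) x else 0)"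
        using Cons.prems by (intro sum.cong) (auto simp: inner_Basis)
      then show "(\<Sum>c\<in>Basis. (b \<bullet> c) *\<^sub>R H (c # bs) x) = H (b # bs) x" using Cons.prems by simp
    qed
    finally show ?case .
  qed simp
  have smH: "smooth_fun (H [])"
    unfolding smooth_fun_def
  proof (intro allI impI)
    fix bs :: "'a list" and x assume bs: "set bs \<subseteq> Basis"
    show "pdl bs (H []) differentiable at x" unfolding pH[OF bs] by (rule differentiableI[OF deriv[OF bs]])
  qed
  have HV: "H [] \<in> ?V"
  proof (rule K_spaceI[OF smH])
    fix \<gamma> and m :: nat
    obtain A where A: "eventually (\<lambda>h. h \<in> A) F" "A \<subseteq> ?V" and
      small: "\<And>h1 h2 cs v. h1 \<in> A \<Longrightarrow> h2 \<in> A \<Longrightarrow> set cs \<subseteq> Basis \<Longrightarrow> length cs \<le> m \<Longrightarrow>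
        M \<gamma> v * norm (pdl cs h1 v - pdl cs h2 v) \<le> 1"
      using small[of 1 m \<gamma>] by auto
    obtain h where h: "h \<in> A" using nonempty[OF A(1)] by auto
    have "M \<gamma> x * norm (H bs x) \<le> 1 + ?p (\<gamma>, m) h" if bs: "set bs \<subseteq> Basis" "length bs \<le> m" for x bs
    proof -
      have "norm (H bs x) \<le> norm (pdl bs h x - H bs x) + norm (pdl bs h x)"
        using norm_triangle_ineq4[of "pdl bs h x" "pdl bs h x - H bs x"] by simp
      then have "M \<gamma> x * norm (H bs x) \<le> M \<gamma> x * norm (pdl bs h x - H bs x) + M \<gamma> x * norm (pdl bs h x)"
        unfolding distrib_left[symmetric] by (rule mult_left_mono[OF _ weight_family_nonneg[OF M]])
      also have "\<dots> \<le> 1 + ?p (\<gamma>, m) h"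
        using bs h A by (intro add_mono conv[OF A(1) _ h] small K_seminorm_upper) auto
      finally show ?thesis .
    qed
    then show "\<exists>c. \<forall>x bs. set bs \<subseteq> Basis \<longrightarrow> length bs \<le> m \<longrightarrow> M \<gamma> x * norm (pdl bs (H []) x) \<le> c"
      using pH by auto
  qed
  show "\<exists>h\<in>?V. \<forall>i \<epsilon>. \<epsilon> > 0 \<longrightarrow> eventually (\<lambda>h'. ?p i (\<lambda>x. h' x - h x) < \<epsilon>) F"
  proof (intro bexI[of _ "H []"] allI impI HV)
    fix i :: "'g \<times> nat" and \<epsilon> :: real assume "\<epsilon> > 0"
    obtain \<gamma> m where i: "i = (\<gamma>, m)" by fastforce
    obtain A where A: "eventually (\<lambda>h. h \<in> A) F" "A \<subseteq> ?V" and
      small: "\<And>h1 h2 cs v. h1 \<in> A \<Longrightarrow> h2 \<in> A \<Longrightarrow> set cs \<subseteq> Basis \<Longrightarrow> length cs \<le> m \<Longrightarrow>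
        M \<gamma> v * norm (pdl cs h1 v - pdl cs h2 v) \<le> \<epsilon> / 2"
      using small[of "\<epsilon> / 2" m \<gamma>] \<open>\<epsilon> > 0\<close> by auto
    show "eventually (\<lambda>h'. ?p i (\<lambda>x. h' x - H [] x) < \<epsilon>) F"
      using A(1)
    proof (rule eventually_mono)
      fix h assume h: "h \<in> A"
      then have smh: "smooth_fun h" using A(2) K_space_smooth by auto
      have "?p (\<gamma>, m) (\<lambda>x. h x - H [] x) \<le> \<epsilon> / 2"
      proof (rule K_seminorm_least)
        fix x and bs :: "'a list" assume bs: "set bs \<subseteq> Basis" "length bs \<le> m"
        have "M \<gamma> x * norm (pdl bs h x - H bs x) \<le> \<epsilon> / 2"
          by (rule conv[OF A(1) small h bs(1)]) (use bs in auto)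
        then show "M \<gamma> x * norm (pdl bs (\<lambda>x. h x - H [] x) x) \<le> \<epsilon> / 2"
          by (simp add: pdl_diff[OF smh smH bs(1)] pH[OF bs(1)])
      qed
      then show "?p i (\<lambda>x. h x - H [] x) < \<epsilon>" using \<open>\<epsilon> > 0\<close> by (simp add: i)
    qed
  qed
qed

section \<open>Finite-rank operators and the base estimate\<close>

text \<open>Linear combinations of point evaluations are defined on all functions, so they are
  linear without side conditions and apply to \<open>\<lambda>y. h (x, y)\<close> for every fixed
  \<open>x\<close>. They also commute with differentiation in \<open>x\<close>, see
  \<open>pdl_partial\<close>.\<close>

inductive point_functional :: "(('b \<Rightarrow> complex) \<Rightarrow> complex) \<Rightarrow> bool" where
  zero: "point_functional (\<lambda>g. 0)"
| add: "point_functional l \<Longrightarrow> point_functional (\<lambda>g. l g + c * g z)"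

text \<open>\<open>nuclear_op V P Q T B\<close>: \<open>T\<close> has finite rank, and its nuclear norm from \<open>(V, P)\<close> to \<open>(V, Q)\<close> is at most \<open>B\<close>.\<close>

inductive nuclear_op :: "('b \<Rightarrow> complex) set \<Rightarrow> (('b \<Rightarrow> complex) \<Rightarrow> real) \<Rightarrow> (('b \<Rightarrow> complex) \<Rightarrow> real) \<Rightarrow>
    (('b \<Rightarrow> complex) \<Rightarrow> 'b \<Rightarrow> complex) \<Rightarrow> real \<Rightarrow> bool" for V P Q where
  zero: "nuclear_op V P Q (\<lambda>g y. 0) 0"
| add: "nuclear_op V P Q T B \<Longrightarrow> point_functional l \<Longrightarrow> e \<in> V \<Longrightarrow> 0 \<le> c \<Longrightarrow>
    (\<And>g. g \<in> V \<Longrightarrow> norm (l g) \<le> c * P g) \<Longrightarrow>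
    nuclear_op V P Q (\<lambda>g y. T g y + l g * e y) (B + c * Q e)"
| weaken: "nuclear_op V P Q T B \<Longrightarrow> B \<le> B' \<Longrightarrow> nuclear_op V P Q T B'"

lemma point_functional_eval: "point_functional (\<lambda>g. c * g z)"
  using point_functional.add[OF point_functional.zero, of c z] by simp

lemma nuclear_op_sum:
  assumes "finite A" "\<And>z. z \<in> A \<Longrightarrow> point_functional (l z) \<and> e z \<in> V \<and> 0 \<le> c z \<and> (\<forall>g\<in>V. norm (l z g) \<le> c z * P g)"
  shows "nuclear_op V P Q (\<lambda>g y. \<Sum>z\<in>A. l z g * e z y) (\<Sum>z\<in>A. c z * Q (e z))"
  using assms
proof (induction A rule: finite_induct)
  case empty
  show ?case using nuclear_op.zero by simp
next
  case (insert z A)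
  then have "nuclear_op V P Q (\<lambda>g y. (\<Sum>z\<in>A. l z g * e z y) + l z g * e z y) ((\<Sum>z\<in>A. c z * Q (e z)) + c z * Q (e z))"
    by (intro nuclear_op.add) auto
  then show ?case using insert.hyps by (simp add: add.commute)
qed

lemma pdl_support:
  assumes f: "smooth_fun f" and "open U" "\<And>x. x \<in> U \<Longrightarrow> f x = 0" "set bs \<subseteq> Basis" "x \<in> U"
  shows "pdl bs f x = 0"
  using assms(4,5)
proof (induction bs arbitrary: x)
  case (Cons b bs)
  have "frechet_derivative (pdl bs f) (at x) = frechet_derivative (\<lambda>_. 0) (at x)"
    using Cons smooth_funD[OF f] \<open>open U\<close>
    by (intro frechet_derivative_transform_within_open[of _ _ U]) (auto simp: differentiable_def)
  then show ?case by simp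
qed (use assms in auto)

lemma pdl_bounded_on_compact:
  fixes f :: "'a::euclidean_space \<Rightarrow> complex"
  assumes f: "smooth_fun f" and "compact X"
  obtains B where "0 \<le> B" "\<And>bs x. set bs \<subseteq> Basis \<Longrightarrow> length bs \<le> m \<Longrightarrow> x \<in> X \<Longrightarrow> norm (pdl bs f x) \<le> B"
proof -
  let ?L = "{bs. set bs \<subseteq> (Basis :: 'a set) \<and> length bs \<le> m}"
  have fin: "finite ?L" by (intro finite_lists_length_le) simp
  have "\<forall>bs\<in>?L. \<exists>B. \<forall>x\<in>X. norm (pdl bs f x) \<le> B"
  proof
    fix bs assume "bs \<in> ?L"
    then have "compact (pdl bs f ` X)"
      by (intro compact_continuous_image smooth_fun_continuous smooth_fun_pdl f \<open>compact X\<close>) auto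
    from compact_imp_bounded[OF this] show "\<exists>B. \<forall>x\<in>X. norm (pdl bs f x) \<le> B"
      unfolding bounded_iff by auto
  qed
  from bchoice[OF this] obtain B where B: "\<forall>bs\<in>?L. \<forall>x\<in>X. norm (pdl bs f x) \<le> B bs" by blast
  have "norm (pdl bs f x) \<le> (\<Sum>bs\<in>?L. \<bar>B bs\<bar>)" if "bs \<in> ?L" "x \<in> X" for bs x
  proof -
    have "norm (pdl bs f x) \<le> \<bar>B bs\<bar>" using B that by fastforce
    also have "\<dots> \<le> (\<Sum>bs\<in>?L. \<bar>B bs\<bar>)" using fin that by (intro member_le_sum) auto
    finally show ?thesis .
  qed
  then show thesis by (intro that[of "\<Sum>bs\<in>?L. \<bar>B bs\<bar>"]) (auto intro!: sum_nonneg)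
qed

lemma compact_support_K_space:
  fixes f :: "'a::euclidean_space \<Rightarrow> complex"
  assumes f: "smooth_fun f" and supp: "\<And>x. f x \<noteq> 0 \<Longrightarrow> x \<in> cball a R"
    and M: "weight_family M" "\<And>\<gamma> S. bounded S \<Longrightarrow> bdd_above (M \<gamma> ` S)"
  shows "f \<in> K_space M"
proof (rule K_spaceI[OF f])
  fix \<gamma> and m :: nat
  obtain B where B: "0 \<le> B" "\<And>bs x. set bs \<subseteq> Basis \<Longrightarrow> length bs \<le> m \<Longrightarrow> x \<in> cball a R \<Longrightarrow> norm (pdl bs f x) \<le> B"
    using pdl_bounded_on_compact[OF f compact_cball, of m a R] by blast
  obtain b where b: "\<And>x. x \<in> cball a R \<Longrightarrow> M \<gamma> x \<le> b"
    using M(2)[OF bounded_cball[of a R], of \<gamma>] unfolding bdd_above_def by blast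
  have "M \<gamma> x * norm (pdl bs f x) \<le> \<bar>b\<bar> * B" if bs: "set bs \<subseteq> Basis" "length bs \<le> m" for x bs
  proof (cases "x \<in> cball a R")
    case True
    then have "M \<gamma> x \<le> \<bar>b\<bar>" using b by fastforce
    then show ?thesis using B bs True by (intro mult_mono) auto
  next
    case False
    then have "pdl bs f x = 0"
      using supp by (intro pdl_support[OF f _ _ bs(1), of "- cball a R"]) auto
    then show ?thesis using B(1) by simp
  qed
  then show "\<exists>c. \<forall>x bs. set bs \<subseteq> Basis \<longrightarrow> length bs \<le> m \<longrightarrow> M \<gamma> x * norm (pdl bs f x) \<le> c"
    by blast
qed

text \<open>Condition (II), then (I), then (II) again. In the application \<open>y\<close> is a
  point in the support of an atom, \<open>z\<close> its node and \<open>u\<close> any point of the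
  lattice cell at the node: having \<open>L\<close> at the free point \<open>u\<close> allows the
  sum over nodes to be compared with the integral of \<open>L\<close>. The choice
  \<open>u = y\<close> gives decay in \<open>y\<close>.\<close>

lemma weight_transfer:
  fixes N :: "'w \<Rightarrow> 'b::euclidean_space \<Rightarrow> real"
  assumes N: "weight_family N"
    and condI: "\<forall>\<omega>. \<exists>\<omega>' L. bounded (range L) \<and> integrable lebesgue L \<and> (\<forall>y. 0 \<le> L y) \<and>
                 (\<forall>y. N \<omega> y \<le> L y * N \<omega>' y) \<and> (L \<longlongrightarrow> 0) at_infinity"
    and condII: "\<forall>\<omega>. \<exists>\<omega>' B C. open B \<and> 0 \<in> B \<and> C > 0 \<and>
                 (\<forall>y y'. y' \<in> B \<longrightarrow> N \<omega> y \<le> C * N \<omega>' (y + y'))"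
  shows "\<exists>\<omega>' L r. bounded (range L) \<and> integrable lebesgue L \<and> (\<forall>y. 0 \<le> L y) \<and> (L \<longlongrightarrow> 0) at_infinity \<and> 0 < r \<and>
           (\<forall>y u z. norm (y - u) < r \<longrightarrow> norm (u - z) < r \<longrightarrow> N \<omega> y \<le> L u * N \<omega>' z)"
proof -
  have shift: "\<exists>\<omega>' r C. 0 < r \<and> 0 < C \<and> (\<forall>y u. norm (y - u) < r \<longrightarrow> N \<omega> y \<le> C * N \<omega>' u)" for \<omega>
  proof -
    obtain \<omega>' B C where B: "open B" "0 \<in> B" "C > 0" "\<And>y y'. y' \<in> B \<Longrightarrow> N \<omega> y \<le> C * N \<omega>' (y + y')"
      using condII by meson
    then obtain r where r: "r > 0" "ball 0 r \<subseteq> B" using openE by blast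
    have "N \<omega> y \<le> C * N \<omega>' u" if "norm (y - u) < r" for y u
    proof -
      have "u - y \<in> B" using that r(2) by (auto simp: norm_minus_commute)
      from B(4)[OF this, of y] show ?thesis by simp
    qed
    then show ?thesis using r(1) B(3) by blast
  qed
  obtain \<omega>1 r1 C1 where 1: "0 < r1" "0 < C1" "\<And>y u. norm (y - u) < r1 \<Longrightarrow> N \<omega> y \<le> C1 * N \<omega>1 u"
    using shift[of \<omega>] by blast
  obtain \<omega>2 L where L: "bounded (range L)" "integrable lebesgue L" "\<And>y. 0 \<le> L y"
    "\<And>y. N \<omega>1 y \<le> L y * N \<omega>2 y" "(L \<longlongrightarrow> 0) at_infinity"
    using condI by meson
  obtain \<omega>3 r3 C3 where 3: "0 < r3" "0 < C3" "\<And>y u. norm (y - u) < r3 \<Longrightarrow> N \<omega>2 y \<le> C3 * N \<omega>3 u"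
    using shift[of \<omega>2] by blast
  define L' where "L' y = C1 * C3 * L y" for y
  have "N \<omega> y \<le> L' u * N \<omega>3 z" if "norm (y - u) < min r1 r3" "norm (u - z) < min r1 r3" for y u z
  proof -
    have "N \<omega> y \<le> C1 * N \<omega>1 u" using that 1 by simp
    also have "\<dots> \<le> C1 * (L u * N \<omega>2 u)" using L(4) 1 by (intro mult_left_mono) auto
    also have "\<dots> \<le> C1 * (L u * (C3 * N \<omega>3 z))" using L(3) 1 3 that by (intro mult_left_mono) auto
    finally show ?thesis by (simp add: L'_def mult_ac)
  qed
  moreover have "bounded (range L')"
    using bounded_scaling[OF L(1), of "C1 * C3"] by (simp add: L'_def[abs_def] image_image)
  moreover have "integrable lebesgue L'" using L(2) by (simp add: L'_def[abs_def])
  moreover have "0 \<le> L' y" for y using 1 3 L(3) by (simp add: L'_def)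
  moreover have "(L' \<longlongrightarrow> 0) at_infinity"
    using tendsto_mult_right_zero[OF L(5), of "C1 * C3"] by (simp add: L'_def[abs_def])
  moreover have "0 < min r1 r3" using 1 3 by simp
  ultimately show ?thesis by blast
qed

section \<open>Comparison of lattice sums with integrals\<close>

lemma lattice_cells_disjoint:
  fixes z :: "'b::euclidean_space"
  assumes "0 < h" "z \<in> int_lattice" "z' \<in> int_lattice"
    "u \<in> box (h *\<^sub>R z) (h *\<^sub>R z + h *\<^sub>R One)" "u \<in> box (h *\<^sub>R z') (h *\<^sub>R z' + h *\<^sub>R One)"
  shows "z = z'"
proof (rule euclidean_eqI)
  fix b :: 'b assume b: "b \<in> Basis"
  obtain i j :: int where ij: "z \<bullet> b = of_int i" "z' \<bullet> b = of_int j"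
    using assms(2,3) b Ints_cases unfolding int_lattice_def mem_Collect_eq by metis
  have u: "h * (z \<bullet> b) < u \<bullet> b" "u \<bullet> b < h * (z \<bullet> b + 1)" "h * (z' \<bullet> b) < u \<bullet> b" "u \<bullet> b < h * (z' \<bullet> b + 1)"
    using assms(4,5) b by (auto simp: mem_box inner_add_left inner_sum_left_Basis algebra_simps)
  have "h * (z \<bullet> b) < h * (z' \<bullet> b + 1)" "h * (z' \<bullet> b) < h * (z \<bullet> b + 1)" using u by linarith+
  then have "of_int i < (of_int j + 1 :: real)" "of_int j < (of_int i + 1 :: real)"
    unfolding ij using assms(1) by (simp_all only: mult_less_cancel_left_pos)
  then have "i = j" by linarith
  then show "z \<bullet> b = z' \<bullet> b" by (simp add: ij)
qed

text \<open>Each \<open>a z\<close> is below \<open>L\<close> on an open cell of volume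
  \<open>h ^ DIM('b)\<close>, and distinct cells are disjoint, so the step function with these
  values is below \<open>L\<close>.\<close>

lemma lattice_sum_le_integral:
  fixes L :: "'b::euclidean_space \<Rightarrow> real"
  assumes h: "0 < h" and F: "finite F" "F \<subseteq> int_lattice" and L: "integrable lebesgue L" "\<And>u. 0 \<le> L u"
    and a: "\<And>z u. z \<in> F \<Longrightarrow> u \<in> box (h *\<^sub>R z) (h *\<^sub>R z + h *\<^sub>R One) \<Longrightarrow> a z \<le> L u"
  shows "h ^ DIM('b) * (\<Sum>z\<in>F. a z) \<le> integral\<^sup>L lebesgue L"
proof -
  let ?c = "\<lambda>z::'b. box (h *\<^sub>R z) (h *\<^sub>R z + h *\<^sub>R One)"
  have m: "measure lebesgue (?c z) = h ^ DIM('b)" for z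
    using h by (simp add: measure_completion measure_lborel_box_eq inner_add_left)
  have em: "emeasure lebesgue (?c z) < \<infinity>" for z
    by (simp add: emeasure_lborel_box_eq)
  have int: "integrable lebesgue (\<lambda>u. a z * indicator (?c z) u)" for z
    using em by (intro integrable_mult_right) (simp add: integrable_indicator_iff)
  have "h ^ DIM('b) * (\<Sum>z\<in>F. a z) = (\<Sum>z\<in>F. integral\<^sup>L lebesgue (\<lambda>u. a z * indicator (?c z) u))"
    by (simp add: sum_distrib_right m mult.commute)
  also have "\<dots> = integral\<^sup>L lebesgue (\<lambda>u. \<Sum>z\<in>F. a z * indicator (?c z) u)"
    by (intro Bochner_Integration.integral_sum[symmetric] int)
  also have "\<dots> \<le> integral\<^sup>L lebesgue L"
  proof (rule integral_mono)
    show "integrable lebesgue (\<lambda>u. \<Sum>z\<in>F. a z * indicator (?c z) u)"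
      by (intro Bochner_Integration.integrable_sum int)
    fix u
    show "(\<Sum>z\<in>F. a z * indicator (?c z) u) \<le> L u"
    proof (cases "\<exists>z\<in>F. u \<in> ?c z")
      case True
      then obtain z where z: "z \<in> F" "u \<in> ?c z" by blast
      then have "(\<Sum>z'\<in>F. a z' * indicator (?c z') u) = (\<Sum>z'\<in>F. if z' = z then a z else 0)"
        using lattice_cells_disjoint[OF h, of _ z u] F(2) by (intro sum.cong) (auto simp: indicator_def)
      then show ?thesis using z F(1) a[OF z] by simp
    next
      case False
      then have "(\<Sum>z'\<in>F. a z' * indicator (?c z') u) = 0" by (intro sum.neutral) auto
      then show ?thesis using L(2) by simp
    qed
  qed (rule L(1))
  finally show ?thesis .
qed


definition spline_atom :: "real \<Rightarrow> nat \<Rightarrow> 'b::euclidean_space \<Rightarrow> 'b \<Rightarrow> complex" where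
  "spline_atom h m z y = cardinal_spline m ((1 / h) *\<^sub>R y - z)"

lemma
  shows smooth_fun_spline_atom: "smooth_fun (spline_atom h m z)"
    and pdl_spline_atom: "set bs \<subseteq> Basis \<Longrightarrow> pdl bs (spline_atom h m z)
      = (\<lambda>y. of_real (1 / h) ^ length bs * pdl bs (cardinal_spline m) ((1 / h) *\<^sub>R y - z))"
  using smooth_fun_affine[OF smooth_fun_bspline bounded_linear_ident, of _ "1 / h" "- z"]
    pdl_affine[OF smooth_fun_bspline bounded_linear_ident, of bs _ "1 / h" "- z"]
  by (simp_all add: spline_atom_def[abs_def])

lemma norm_scaled_diff: "0 < h \<Longrightarrow> norm (y - h *\<^sub>R z) = h * norm ((1 / h) *\<^sub>R y - z)"
proof -
  assume h: "0 < h"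
  then have "y - h *\<^sub>R z = h *\<^sub>R ((1 / h) *\<^sub>R y - z)" by (simp add: scaleR_diff_right)
  then show ?thesis using h by simp
qed

lemma pdl_spline_atom_support:
  fixes z :: "'b::euclidean_space"
  assumes "0 < h" "set bs \<subseteq> Basis" "length bs \<le> m" "pdl bs (spline_atom h m z) y \<noteq> 0"
  shows "norm (y - h *\<^sub>R z) \<le> h * spline_radius TYPE('b) m"
  unfolding norm_scaled_diff[OF assms(1)]
  using assms by (intro mult_left_mono pdl_cardinal_spline_support[of bs]) (auto simp: pdl_spline_atom)

lemma norm_pdl_spline_atom_le:
  assumes "0 < h" "h \<le> 1" "set bs \<subseteq> Basis" "length bs \<le> m"
  shows "norm (pdl bs (spline_atom h m z) y) \<le> (2 / h) ^ m"
proof -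
  have "norm (pdl bs (spline_atom h m z) y) = (1 / h) ^ length bs * norm (pdl bs (cardinal_spline m) ((1 / h) *\<^sub>R y - z))"
    using assms(1) by (simp add: pdl_spline_atom[OF assms(3)] norm_mult norm_power norm_divide)
  also have "\<dots> \<le> (1 / h) ^ m * 2 ^ m"
    using assms by (intro mult_mono norm_pdl_cardinal_spline_le power_increasing) auto
  finally show ?thesis by (simp add: power_divide mult.commute)
qed

lemma spline_atom_in_K_space:
  fixes N :: "'w \<Rightarrow> 'b::euclidean_space \<Rightarrow> real"
  assumes "0 < h" "weight_family N" "\<And>\<omega> S. bounded S \<Longrightarrow> bdd_above (N \<omega> ` S)"
  shows "spline_atom h m z \<in> K_space N"
proof (rule compact_support_K_space[OF smooth_fun_spline_atom _ assms(2,3)])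
  fix y assume "spline_atom h m z y \<noteq> 0"
  then show "y \<in> cball (h *\<^sub>R z) (h * spline_radius TYPE('b) m)"
    using pdl_spline_atom_support[OF assms(1), of "[]" m z y] by (simp add: dist_norm norm_minus_commute)
qed

text \<open>\<open>T\<close> samples \<open>g\<close> at nodes in a bounded region. A node
  contributes to the nuclear norm the factor \<open>1 / N \<omega>' (h *\<^sub>R z)\<close> from the
  evaluation and at most \<open>(2 / h) ^ m * (L u * N \<omega>' (h *\<^sub>R z))\<close> from the
  atom, for every \<open>u\<close> in the cell; the weights cancel and
  \<open>lattice_sum_le_integral\<close> applies. The error is the spline error inside the region
  and is small outside it because \<open>L\<close> decays; the summand 1 in the constant accounts
  for the outside.\<close>

lemma quasi_interpolation:
  fixes N :: "'w \<Rightarrow> 'b::euclidean_space \<Rightarrow> real"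
  assumes N: "weight_family N" and bdd: "\<And>\<omega> S. bounded S \<Longrightarrow> bdd_above (N \<omega> ` S)"
    and L: "\<And>y. L y \<le> A" "integrable lebesgue L" "\<And>y. 0 \<le> L y" "(L \<longlongrightarrow> 0) at_infinity"
    and NL: "\<And>y u z. norm (y - u) < r \<Longrightarrow> norm (u - z) < r \<Longrightarrow> N \<omega> y \<le> L u * N \<omega>' z"
    and h: "0 < h" "h \<le> 1" "h * (spline_radius TYPE('b) m + real m + real DIM('b)) < r"
  shows "\<exists>T B. nuclear_op (K_space N) (K_seminorm N (\<omega>', Suc m)) (K_seminorm N (\<omega>, m)) T B \<and>
     h ^ (m + DIM('b)) * B \<le> 2 ^ m * integral\<^sup>L lebesgue L \<and>
     (\<forall>g\<in>K_space N. K_seminorm N (\<omega>, m) (\<lambda>y. g y - T g y)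
        \<le> h * (real DIM('b) * (spline_radius TYPE('b) m + m) * A + 1) * K_seminorm N (\<omega>', Suc m) g)"
proof -
  let ?\<rho> = "spline_radius TYPE('b) m" and ?V = "K_space N"
  let ?P = "K_seminorm N (\<omega>', Suc m)" and ?Q = "K_seminorm N (\<omega>, m)"
  have \<rho>0: "0 \<le> ?\<rho>" by (simp add: spline_radius_def)
  have D1: "1 \<le> real DIM('b)" using DIM_positive[where 'a='b] by linarith
  have hr: "h * ?\<rho> < r" "h * (?\<rho> + m) < r" "h * ?\<rho> + h * DIM('b) < r" "0 < r"
  proof -
    have "0 \<le> h * ?\<rho>" "0 \<le> h * real m" "0 < h * real DIM('b)" using h(1) \<rho>0 D1 by auto
    then show "h * ?\<rho> < r" "h * (?\<rho> + m) < r" "h * ?\<rho> + h * DIM('b) < r" "0 < r"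
      using h(3) by (simp_all add: distrib_left)
  qed
  have A0: "0 \<le> A" using L(1,3) order_trans by blast
  have N0: "0 \<le> N \<omega> y" for \<omega> y using weight_family_nonneg[OF N] .
  obtain c where c: "\<And>u::'b. finite {z \<in> int_lattice. norm (u - z) \<le> ?\<rho>}"
    "\<And>u::'b. card {z \<in> int_lattice. norm (u - z) \<le> ?\<rho>} \<le> c"
    using card_lattice_ball[of ?\<rho>] by blast
  \<comment> \<open>At a point outside the region \<open>g\<close> and at most \<open>c\<close>
    atoms contribute, the atoms with derivatives up to \<open>(2 / h) ^ m\<close>; this choice makes
    their total exactly \<open>h\<close> times the seminorm of \<open>g\<close>.\<close>
  define \<epsilon> where "\<epsilon> = h / (1 + c * (2 / h) ^ m)"
  have \<epsilon>: "\<epsilon> > 0" "\<epsilon> * (1 + c * (2 / h) ^ m) = h"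
  proof -
    have "0 < 1 + c * (2 / h) ^ m" using h(1) by (intro add_pos_nonneg) auto
    then show "\<epsilon> > 0" "\<epsilon> * (1 + c * (2 / h) ^ m) = h" using h(1) by (auto simp: \<epsilon>_def)
  qed
  obtain R where R: "\<And>y. R \<le> norm y \<Longrightarrow> L y < \<epsilon>"
    using tendstoD[OF L(4) \<epsilon>(1)] L(3) unfolding eventually_at_infinity by (auto simp: dist_norm)
  \<comment> \<open>Where \<open>N \<omega>'\<close> vanishes, evaluation is not bounded by the seminorm; such nodes can be dropped
    because there \<open>N \<omega>\<close> vanishes on the support of the corresponding atom.\<close>
  define F where "F = {z \<in> int_lattice. norm (h *\<^sub>R z) \<le> R + r \<and> 0 < N \<omega>' (h *\<^sub>R z)}"
  have FL: "F \<subseteq> int_lattice" by (auto simp: F_def)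
  have finF: "finite F"
  proof (rule finite_subset)
    have "norm z \<le> (R + r) / h" if "norm (h *\<^sub>R z) \<le> R + r" for z :: 'b
      using that h(1) by (simp add: field_simps)
    then show "F \<subseteq> {z \<in> int_lattice. norm (0 - z) \<le> (R + r) / h}" by (auto simp: F_def)
    show "finite {z :: 'b \<in> int_lattice. norm (0 - z) \<le> (R + r) / h}"
      using card_lattice_ball[of "(R + r) / h"] by blast
  qed
  let ?e = "spline_atom h m"
  define T where "T = (\<lambda>g y. \<Sum>z\<in>F. 1 * g (h *\<^sub>R z) * ?e z y)"
  define B where "B = (\<Sum>z\<in>F. 1 / N \<omega>' (h *\<^sub>R z) * ?Q (?e z))"
  have eval: "N \<omega>' v * norm (pdl bs g v) \<le> ?P g" if "g \<in> ?V" "set bs \<subseteq> Basis" "length bs \<le> Suc m" for g bs v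
    by (rule K_seminorm_upper[OF that])
  have "nuclear_op ?V ?P ?Q T B"
    unfolding T_def B_def
  proof (rule nuclear_op_sum[OF finF])
    fix z assume z: "z \<in> F"
    have "norm (1 * g (h *\<^sub>R z)) \<le> 1 / N \<omega>' (h *\<^sub>R z) * ?P g" if "g \<in> ?V" for g
      using eval[OF that, of "[]" "h *\<^sub>R z"] z by (simp add: F_def field_simps)
    then show "point_functional (\<lambda>g. 1 * g (h *\<^sub>R z)) \<and> ?e z \<in> ?V \<and> 0 \<le> 1 / N \<omega>' (h *\<^sub>R z) \<and>
      (\<forall>g\<in>?V. norm (1 * g (h *\<^sub>R z)) \<le> 1 / N \<omega>' (h *\<^sub>R z) * ?P g)"
      using point_functional_eval[of 1 "h *\<^sub>R z"] spline_atom_in_K_space[OF h(1) N bdd] N0 by auto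
  qed
  moreover have "h ^ (m + DIM('b)) * B \<le> 2 ^ m * integral\<^sup>L lebesgue L"
  proof -
    have "h ^ DIM('b) * (\<Sum>z\<in>F. (h / 2) ^ m * (1 / N \<omega>' (h *\<^sub>R z) * ?Q (?e z))) \<le> integral\<^sup>L lebesgue L"
    proof (rule lattice_sum_le_integral[OF h(1) finF FL L(2,3)])
      fix z u assume z: "z \<in> F" and u: "u \<in> box (h *\<^sub>R z) (h *\<^sub>R z + h *\<^sub>R One)"
      have "norm (u - h *\<^sub>R z) \<le> (\<Sum>b\<in>Basis. \<bar>(u - h *\<^sub>R z) \<bullet> b\<bar>)" by (rule norm_le_l1)
      also have "\<dots> \<le> (\<Sum>b\<in>(Basis::'b set). h)"
        using u by (intro sum_mono) (auto simp: mem_box inner_diff_left inner_add_left inner_sum_left_Basis)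
      finally have uz: "norm (u - h *\<^sub>R z) \<le> h * DIM('b)" by (simp add: mult.commute)
      have "?Q (?e z) \<le> (2 / h) ^ m * (L u * N \<omega>' (h *\<^sub>R z))"
      proof (rule K_seminorm_least)
        fix y and bs :: "'b list" assume bs: "set bs \<subseteq> Basis" "length bs \<le> m"
        show "N \<omega> y * norm (pdl bs (?e z) y) \<le> (2 / h) ^ m * (L u * N \<omega>' (h *\<^sub>R z))"
        proof (cases "pdl bs (?e z) y = 0")
          case False
          from pdl_spline_atom_support[OF h(1) bs this] have yz: "norm (y - h *\<^sub>R z) \<le> h * ?\<rho>" .
          have "norm (y - u) \<le> norm (y - h *\<^sub>R z) + norm (u - h *\<^sub>R z)"
            using norm_triangle_ineq4[of "y - h *\<^sub>R z" "u - h *\<^sub>R z"] by simp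
          then have "norm (y - u) < r" "norm (u - h *\<^sub>R z) < r" using uz yz hr h(1) \<rho>0
            by (auto intro: le_less_trans mult_nonneg_nonneg) (smt (verit) mult_nonneg_nonneg)
          from mult_mono[OF NL[OF this] norm_pdl_spline_atom_le[OF h(1,2) bs, of z y]]
          show ?thesis using L(3) N0 by (simp add: mult_ac)
        qed (use L(3) N0 h(1) in simp)
      qed
      then have "1 / N \<omega>' (h *\<^sub>R z) * ?Q (?e z) \<le> 1 / N \<omega>' (h *\<^sub>R z) * ((2 / h) ^ m * (L u * N \<omega>' (h *\<^sub>R z)))"
        using N0 by (intro mult_left_mono) auto
      also have "\<dots> = (2 / h) ^ m * L u" using z by (simp add: F_def)
      finally have "(h / 2) ^ m * (1 / N \<omega>' (h *\<^sub>R z) * ?Q (?e z)) \<le> (h / 2) ^ m * ((2 / h) ^ m * L u)"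
        using h(1) by (intro mult_left_mono) auto
      also have "\<dots> = L u" using h(1) by (simp add: power_divide)
      finally show "(h / 2) ^ m * (1 / N \<omega>' (h *\<^sub>R z) * ?Q (?e z)) \<le> L u" .
    qed
    then have "h ^ DIM('b) * ((h / 2) ^ m * B) \<le> integral\<^sup>L lebesgue L"
      unfolding B_def by (simp only: sum_distrib_left)
    then show ?thesis by (simp add: power_divide power_add field_simps)
  qed
  moreover have "?Q (\<lambda>y. g y - T g y) \<le> h * (real DIM('b) * (?\<rho> + m) * A + 1) * ?P g" if g: "g \<in> ?V" for g
  proof (rule K_seminorm_least)
    fix y and bs :: "'b list" assume bs: "set bs \<subseteq> Basis" "length bs \<le> m"
    define q where "q = ?P g"
    have q0: "0 \<le> q" unfolding q_def by (rule K_seminorm_nonneg[OF N g])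
    have smg: "smooth_fun g" by (rule K_space_smooth[OF g])
    have sm: "smooth_fun (\<lambda>y. 1 * g (h *\<^sub>R z) * ?e z y)" for z
      by (intro smooth_fun_cmult smooth_fun_spline_atom)
    have smT: "smooth_fun (T g)" unfolding T_def by (rule smooth_fun_sum[OF sm])
    have pT: "pdl bs (T g) y = (\<Sum>z\<in>F. g (h *\<^sub>R z) * pdl bs (?e z) y)"
      unfolding T_def pdl_sum[OF sm bs(1)] pdl_cmult[OF smooth_fun_spline_atom bs(1)] by simp
    have "pdl bs (\<lambda>y. g y - T g y) y = pdl bs g y - pdl bs (T g) y"
      using pdl_diff[OF smg smT bs(1)] by simp
    also have "\<dots> = pdl bs g y - (\<Sum>z\<in>F. g (h *\<^sub>R z) * pdl bs (?e z) y)" by (simp only: pT)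
    finally have eq: "pdl bs (\<lambda>y. g y - T g y) y = pdl bs g y - (\<Sum>z\<in>F. g (h *\<^sub>R z) * pdl bs (?e z) y)" .
    let ?err = "N \<omega> y * norm (pdl bs g y - (\<Sum>z\<in>F. g (h *\<^sub>R z) * pdl bs (?e z) y))"
    \<comment> \<open>The case \<open>u = y\<close>: the weight at \<open>y\<close> is exchanged for
      the weight at any point within \<open>r\<close>, with the factor \<open>L y\<close>. So values
      of \<open>g\<close> at nearby nodes are controlled from \<open>y\<close>.\<close>
    have near: "N \<omega> y \<le> L y * N \<omega>' v" if "norm (y - v) < r" for v
      using NL[of y y v] that hr(4) by simp
    have Nq: "N \<omega> y * norm (pdl cs g v) \<le> L y * q"
      if "set cs \<subseteq> Basis" "length cs \<le> Suc m" "norm (y - v) < r" for cs v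
    proof -
      have "N \<omega> y * norm (pdl cs g v) \<le> L y * N \<omega>' v * norm (pdl cs g v)"
        using near[OF that(3)] by (intro mult_right_mono) auto
      also have "\<dots> \<le> L y * q"
        unfolding q_def mult.assoc using L(3) by (intro mult_left_mono eval g that) auto
      finally show ?thesis .
    qed
    consider "N \<omega> y = 0" | "N \<omega> y > 0" "norm y \<le> R" | "R \<le> norm y" using N0[of \<omega> y] by linarith
    then show "N \<omega> y * norm (pdl bs (\<lambda>y. g y - T g y) y) \<le> h * (real DIM('b) * (?\<rho> + m) * A + 1) * ?P g"
      unfolding eq q_def[symmetric]
    proof cases
      case 1
      then show "?err
          \<le> h * (real DIM('b) * (?\<rho> + m) * A + 1) * q"
        using h(1) \<rho>0 A0 q0 by simp
    next
      case 2
      \<comment> \<open>Here \<open>F\<close> contains every node whose atom reaches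
        \<open>y\<close>: such a node is within \<open>r\<close> of \<open>y\<close>, and
        \<open>N \<omega>'\<close> cannot vanish at it because \<open>N \<omega> y\<close> is
        positive.\<close>
      have "norm (pdl bs g y - (\<Sum>z\<in>F. of_real (1 / h) ^ length bs * pdl bs (cardinal_spline m) ((1 / h) *\<^sub>R y - z) * g (h *\<^sub>R z)))
          \<le> h * (real DIM('b) * (?\<rho> + m) * (A * q / N \<omega> y))"
      proof (rule scaled_cardinal_spline_approx[OF smg h(1) bs finF FL])
        fix z assume z: "z \<in> int_lattice" "norm (y - h *\<^sub>R z) \<le> h * ?\<rho>"
        then have "norm (y - h *\<^sub>R z) < r" using hr(1) by linarith
        moreover have "norm (h *\<^sub>R z) \<le> norm y + norm (y - h *\<^sub>R z)"
          using norm_triangle_ineq4[of y "y - h *\<^sub>R z"] by simp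
        moreover have "0 < N \<omega>' (h *\<^sub>R z)"
          using near[OF \<open>norm (y - h *\<^sub>R z) < r\<close>] 2(1) N0[of \<omega>' "h *\<^sub>R z"] by (cases "N \<omega>' (h *\<^sub>R z) = 0") auto
        ultimately show "z \<in> F" using z(1) 2(2) by (simp add: F_def)
      next
        fix cs :: "'b list" and v assume cs: "set cs \<subseteq> Basis" "length cs = Suc (length bs)"
          and v: "norm (v - y) \<le> h * (?\<rho> + real m)"
        have "N \<omega> y * norm (pdl cs g v) \<le> L y * q"
          using cs bs v hr(2) by (intro Nq) (auto simp: norm_minus_commute)
        also have "\<dots> \<le> A * q" using L(1) q0 by (intro mult_right_mono) auto
        finally show "norm (pdl cs g v) \<le> A * q / N \<omega> y" using 2(1) by (simp add: field_simps)
      qed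
      then have "?err
          \<le> N \<omega> y * (h * (real DIM('b) * (?\<rho> + m) * (A * q / N \<omega> y)))"
        using N0 by (intro mult_left_mono) (simp_all only: pdl_spline_atom[OF bs(1)] mult_ac)
      also have "\<dots> = h * (real DIM('b) * (?\<rho> + m) * A) * q" using 2(1) by simp
      also have "\<dots> \<le> h * (real DIM('b) * (?\<rho> + m) * A + 1) * q"
        using h(1) q0 by (intro mult_right_mono mult_left_mono) auto
      finally show "?err
          \<le> h * (real DIM('b) * (?\<rho> + m) * A + 1) * q" .
    next
      case 3
      then have Ly: "L y * q \<le> \<epsilon> * q" using R[of y] q0 by (intro mult_right_mono) auto
      \<comment> \<open>Outside the region no cancellation between \<open>g\<close> and
        \<open>T g\<close> is sought, so it does not matter which nodes belong to \<open>F\<close>.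
        Only the nodes near \<open>y\<close> count, and there are at most \<open>c\<close> of them
        wherever \<open>y\<close> lies.\<close>
      let ?F = "F \<inter> {z \<in> int_lattice. norm ((1 / h) *\<^sub>R y - z) \<le> ?\<rho>}"
      have cF: "card ?F \<le> c" by (rule order_trans[OF card_mono[OF c(1)] c(2)]) auto
      have "(\<Sum>z\<in>F. g (h *\<^sub>R z) * pdl bs (?e z) y) = (\<Sum>z\<in>?F. g (h *\<^sub>R z) * pdl bs (?e z) y)"
      proof (rule sum.mono_neutral_right[OF finF])
        show "\<forall>z\<in>F - ?F. g (h *\<^sub>R z) * pdl bs (?e z) y = 0"
          using pdl_spline_atom_support[OF h(1) bs, of _ y] FL h(1) by (force simp: norm_scaled_diff)
      qed auto
      then have "?err
          \<le> N \<omega> y * (norm (pdl bs g y) + (\<Sum>z\<in>?F. norm (g (h *\<^sub>R z) * pdl bs (?e z) y)))"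
        by (simp only:) (intro mult_left_mono[OF _ N0] order_trans[OF norm_triangle_ineq4 add_left_mono[OF norm_sum]])
      also have "\<dots> = N \<omega> y * norm (pdl bs g y) + (\<Sum>z\<in>?F. N \<omega> y * norm (g (h *\<^sub>R z)) * norm (pdl bs (?e z) y))"
        by (simp add: distrib_left sum_distrib_left norm_mult mult.assoc)
      also have "\<dots> \<le> \<epsilon> * q + (\<Sum>z\<in>?F. \<epsilon> * q * (2 / h) ^ m)"
      proof (intro add_mono sum_mono)
        show "N \<omega> y * norm (pdl bs g y) \<le> \<epsilon> * q"
          using Nq[of bs y] bs hr(4) Ly by simp
        fix z assume z: "z \<in> ?F"
        then have "norm (y - h *\<^sub>R z) \<le> h * ?\<rho>" using h(1) by (simp add: norm_scaled_diff)
        then have "N \<omega> y * norm (g (h *\<^sub>R z)) \<le> \<epsilon> * q"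
          using Nq[of "[]" "h *\<^sub>R z"] hr(1) Ly by simp
        then show "N \<omega> y * norm (g (h *\<^sub>R z)) * norm (pdl bs (?e z) y) \<le> \<epsilon> * q * (2 / h) ^ m"
          by (rule mult_mono[OF _ norm_pdl_spline_atom_le[OF h(1,2) bs]]) (use \<epsilon>(1) q0 in auto)
      qed
      also have "\<dots> \<le> \<epsilon> * q + c * (\<epsilon> * q * (2 / h) ^ m)"
        using cF \<epsilon>(1) q0 h(1) by (auto intro!: mult_right_mono)
      also have "\<dots> = (\<epsilon> * (1 + c * (2 / h) ^ m)) * q" by (simp add: algebra_simps)
      also have "\<dots> = h * 1 * q" by (simp only: \<epsilon>(2) mult_1_right)
      also have "\<dots> \<le> h * (real DIM('b) * (?\<rho> + m) * A + 1) * q"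
        using h(1) q0 \<rho>0 A0 by (intro mult_right_mono mult_left_mono) auto
      finally show "?err
          \<le> h * (real DIM('b) * (?\<rho> + m) * A + 1) * q" .
    qed
  qed
  ultimately show ?thesis by blast
qed

section \<open>Composition of approximations\<close>

lemma
  assumes "point_functional l"
  shows point_functional_add_arg: "l (\<lambda>y. f y + g y) = l f + l g"
    and point_functional_cmult_arg: "l (\<lambda>y. a * f y) = a * l f"
    and point_functional_diff_arg: "l (\<lambda>y. f y - g y) = l f - l g"
    and point_functional_cmult: "point_functional (\<lambda>g. a * l g)"
    and point_functional_zero_arg: "l (\<lambda>y. 0) = 0"
proof -
  show "l (\<lambda>y. f y + g y) = l f + l g" "l (\<lambda>y. a * f y) = a * l f" "l (\<lambda>y. f y - g y) = l f - l g"
    "l (\<lambda>y. 0) = 0"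
    using assms by (induction) (auto simp: algebra_simps)
  show "point_functional (\<lambda>g. a * l g)"
    using assms
  proof induction
    case (add l c z)
    from point_functional.add[OF add.IH, of "a * c" z] show ?case by (simp add: algebra_simps)
  qed (simp add: point_functional.zero)
qed

lemma point_functional_plus:
  assumes "point_functional l" "point_functional l'"
  shows "point_functional (\<lambda>g. l g + l' g)"
  using assms(2,1) by induction (auto simp: point_functional.add simp flip: add.assoc)

lemma point_functional_minus:
  assumes "point_functional l" "point_functional l'"
  shows "point_functional (\<lambda>g. l g - l' g)"
  using point_functional_plus[OF assms(1) point_functional_cmult[OF assms(2), of "-1"]] by simp

lemma
  assumes "nuclear_op V P Q T B"
  shows nuclear_op_point: "point_functional (\<lambda>g. T g z)"
    and nuclear_op_add_arg: "T (\<lambda>y. f y + g y) = (\<lambda>y. T f y + T g y)"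
    and nuclear_op_diff_arg: "T (\<lambda>y. f y - g y) = (\<lambda>y. T f y - T g y)"
    and nuclear_op_cmult_arg: "T (\<lambda>y. a * f y) = (\<lambda>y. a * T f y)"
    and nuclear_op_zero_arg: "T (\<lambda>y. 0) = (\<lambda>y. 0)"
proof -
  have P: "point_functional (\<lambda>g. T g z)" for z
    using assms
  proof induction
    case (add T B l e c)
    from point_functional_plus[OF add.IH point_functional_cmult[OF add.hyps(2), of "e z"]]
    show ?case by (simp add: mult.commute)
  qed (auto intro: point_functional.zero)
  show "point_functional (\<lambda>g. T g z)" by (rule P)
  show "T (\<lambda>y. f y + g y) = (\<lambda>y. T f y + T g y)" "T (\<lambda>y. f y - g y) = (\<lambda>y. T f y - T g y)"
    "T (\<lambda>y. a * f y) = (\<lambda>y. a * T f y)" "T (\<lambda>y. 0) = (\<lambda>y. 0)"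
    using point_functional_add_arg[OF P] point_functional_diff_arg[OF P]
      point_functional_cmult_arg[OF P] point_functional_zero_arg[OF P] by (simp_all add: fun_eq_iff)
qed

lemma point_functional_comp:
  assumes l: "point_functional l" and T: "nuclear_op V P Q T B"
  shows "point_functional (\<lambda>g. l (T g))"
  using l
proof induction
  case (add l c z)
  then show ?case
    by (intro point_functional_plus point_functional_cmult nuclear_op_point[OF T])
qed (rule point_functional.zero)

lemma nuclear_op_plus:
  assumes T: "nuclear_op V P Q T B" and T': "nuclear_op V P Q T' B'"
  shows "nuclear_op V P Q (\<lambda>g y. T g y + T' g y) (B + B')"
  using T'
proof induction
  case zero
  then show ?case using T by simp
next
  case (add T' B' l e c)
  from nuclear_op.add[OF add.IH add.hyps(2-5)] show ?case by (simp add: add.assoc)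
next
  case (weaken T' B' B'')
  then show ?case by (auto intro: nuclear_op.weaken)
qed

lemma nuclear_op_uminus:
  assumes T: "nuclear_op V P Q T B"
  shows "nuclear_op V P Q (\<lambda>g y. - T g y) B"
  using T
proof induction
  case zero
  show ?case using nuclear_op.zero by simp
next
  case (add T B l e c)
  have "nuclear_op V P Q (\<lambda>g y. - T g y + (- 1 * l g) * e y) (B + c * Q e)"
    using add by (intro nuclear_op.add[OF add.IH] point_functional_cmult) auto
  then show ?case by simp
next
  case (weaken T' B' B'')
  then show ?case by (auto intro: nuclear_op.weaken)
qed

lemma nuclear_op_minus:
  assumes T: "nuclear_op V P Q T B" and T': "nuclear_op V P Q T' B'"
  shows "nuclear_op V P Q (\<lambda>g y. T g y - T' g y) (B + B')"
  using nuclear_op_plus[OF T nuclear_op_uminus[OF T']] by simp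

text \<open>One half of the ideal property of the nuclear norm: \<open>S\<close> acts on the
  functionals and multiplies their norms by at most \<open>b\<close>. It is stated for a general
  \<open>S\<close> because the instances are the identity and \<open>1 - T'\<close>, which need not
  have finite rank.\<close>

lemma nuclear_op_comp_right:
  assumes T: "nuclear_op V P Q T B"
    and S: "\<And>l. point_functional l \<Longrightarrow> point_functional (\<lambda>g. l (S g))"
      "\<And>g. g \<in> V \<Longrightarrow> S g \<in> V" "\<And>g. g \<in> V \<Longrightarrow> P (S g) \<le> b * P' g" "0 \<le> b"
  shows "nuclear_op V P' Q (\<lambda>g. T (S g)) (B * b)"
  using T
proof induction
  case zero
  show ?case using nuclear_op.zero by simp
next
  case (add T B l e c)
  have "norm (l (S g)) \<le> (c * b) * P' g" if "g \<in> V" for g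
    using order_trans[OF add.hyps(5)[OF S(2)[OF that]] mult_left_mono[OF S(3)[OF that] add.hyps(4)]]
    by (simp add: mult.assoc)
  from nuclear_op.add[OF add.IH S(1)[OF add.hyps(2)] add.hyps(3) mult_nonneg_nonneg[OF add.hyps(4) S(4)] this]
  show ?case by (simp add: algebra_simps)
next
  case (weaken T' B' B'')
  then show ?case by (auto intro: nuclear_op.weaken mult_right_mono S(4))
qed

text \<open>The other half: \<open>S\<close> acts on the vectors \<open>e\<close>. Linearity of
  \<open>S\<close> is asked for on all functions; \<open>1 - T'\<close> has it because its
  functionals are combinations of point evaluations.\<close>

lemma nuclear_op_comp_left:
  assumes T: "nuclear_op V P Q T B"
    and S: "\<And>f g a. S (\<lambda>y. f y + a * g y) = (\<lambda>y. S f y + a * S g y)" "S (\<lambda>y. 0) = (\<lambda>y. 0)"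
      "\<And>g. g \<in> V \<Longrightarrow> S g \<in> V" "\<And>g. g \<in> V \<Longrightarrow> Q' (S g) \<le> b * Q g" "0 \<le> b"
  shows "nuclear_op V P Q' (\<lambda>g. S (T g)) (b * B)"
  using T
proof induction
  case zero
  show ?case using nuclear_op.zero by (simp add: S(2))
next
  case (add T B l e c)
  have "nuclear_op V P Q' (\<lambda>g y. S (T g) y + l g * S e y) (b * B + c * Q' (S e))"
    by (rule nuclear_op.add[OF add.IH add.hyps(2) S(3)[OF add.hyps(3)] add.hyps(4,5)])
  moreover have "c * Q' (S e) \<le> c * (b * Q e)" by (intro mult_left_mono S add.hyps)
  ultimately show ?case unfolding S(1) by (elim nuclear_op.weaken) (simp add: algebra_simps)
next
  case (weaken T' B' B'')
  then show ?case by (auto intro: nuclear_op.weaken mult_left_mono S(5))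
qed

context
  fixes N :: "'w \<Rightarrow> 'b::euclidean_space \<Rightarrow> real"
  assumes N: "weight_family N"
begin

abbreviation (input) "\<K> \<equiv> K_space N"
abbreviation (input) "\<qq> \<equiv> K_seminorm N"
abbreviation (input) "nuc k' k \<equiv> nuclear_op (\<K>) (\<qq> k') (\<qq> k)"

lemma nuc_mem: "nuc k' k T B \<Longrightarrow> T g \<in> \<K>"
  by (induction rule: nuclear_op.induct)
    (auto intro!: K_space_add[OF N] K_space_cmult[OF N])

lemma nuc_bound:
  assumes "nuc k' k T B" and g: "g \<in> \<K>"
  shows "\<qq> k (T g) \<le> B * \<qq> k' g"
  using assms(1)
proof (induction rule: nuclear_op.induct)
  case zero
  show ?case by (simp add: K_seminorm_zero[OF N])
next
  case (add T B l e c)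
  have "\<qq> k (\<lambda>y. T g y + l g * e y) \<le> \<qq> k (T g) + norm (l g) * \<qq> k e"
    unfolding K_seminorm_cmult[OF N add.hyps(3), symmetric]
    by (intro K_seminorm_add[OF N] nuc_mem[OF add.hyps(1)] K_space_cmult[OF N] add.hyps)
  also have "\<dots> \<le> B * \<qq> k' g + (c * \<qq> k' g) * \<qq> k e"
    by (intro add_mono add.IH mult_right_mono add.hyps g K_seminorm_nonneg[OF N])
  finally show ?case by (simp add: algebra_simps)
next
  case (weaken T B B')
  then show ?case using order_trans[OF _ mult_right_mono[OF weaken.hyps(2) K_seminorm_nonneg[OF N g]]] by blast
qed

text \<open>The nuclear norm is normalised to \<open>C / \<eta>\<close> for every pair of seminorms,
  so composition keeps this budget up to a constant and only the exponent \<open>t\<close> has to be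
  tracked.\<close>

definition approximable :: "'w \<times> nat \<Rightarrow> 'w \<times> nat \<Rightarrow> real \<Rightarrow> bool" where
  "approximable k' k t \<longleftrightarrow> (\<exists>C\<ge>0. \<forall>\<eta>. 0 < \<eta> \<longrightarrow> \<eta> \<le> 1 \<longrightarrow> (\<exists>T. nuc k' k T (C / \<eta>) \<and>
     (\<forall>g\<in>\<K>. \<qq> k (\<lambda>y. g y - T g y) \<le> C * \<eta> powr t * \<qq> k' g)))"

text \<open>The case \<open>\<eta> = 1\<close>: \<open>g\<close> is \<open>T g\<close> plus an
  error, and both are bounded by multiples of \<open>\<qq> k' g\<close>.\<close>

lemma approximable_bounded:
  assumes "approximable k' k t"
  shows "\<exists>b\<ge>0. \<forall>g\<in>\<K>. \<qq> k g \<le> b * \<qq> k' g"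
proof -
  obtain C where C: "0 \<le> C" "\<And>\<eta>. 0 < \<eta> \<Longrightarrow> \<eta> \<le> 1 \<Longrightarrow> \<exists>T. nuc k' k T (C / \<eta>) \<and>
     (\<forall>g\<in>\<K>. \<qq> k (\<lambda>y. g y - T g y) \<le> C * \<eta> powr t * \<qq> k' g)"
    using assms unfolding approximable_def by blast
  from C(2)[of 1] obtain T where T: "nuc k' k T C"
    "\<And>g. g \<in> \<K> \<Longrightarrow> \<qq> k (\<lambda>y. g y - T g y) \<le> C * \<qq> k' g"
    by auto
  have "\<qq> k g \<le> (C + C) * \<qq> k' g" if g: "g \<in> \<K>" for g
  proof -
    have "\<qq> k (\<lambda>y. (g y - T g y) + T g y) \<le> \<qq> k (\<lambda>y. g y - T g y) + \<qq> k (T g)"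
      by (intro K_seminorm_add[OF N] K_space_diff[OF N] g nuc_mem[OF T(1)])
    then show ?thesis using T(2)[OF g] nuc_bound[OF T(1) g] by (simp add: distrib_right)
  qed
  then show ?thesis using C by (intro exI[of _ "C + C"]) auto
qed

lemma nuc_rest_comp:
  assumes T: "nuc k1 k T B" and S: "nuc k0 k3 T' B'"
    and b: "\<forall>g\<in>\<K>. \<qq> k1 (\<lambda>y. g y - T' g y) \<le> b * \<qq> k2 g" "0 \<le> b"
  shows "nuc k2 k (\<lambda>g. T (\<lambda>y. g y - T' g y)) (B * b)"
proof (rule nuclear_op_comp_right[OF T])
  show "point_functional (\<lambda>g. l (\<lambda>y. g y - T' g y))" if "point_functional l" for l
    using point_functional_minus[OF that point_functional_comp[OF that S]]
    by (simp add: point_functional_diff_arg[OF that])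
  show "(\<lambda>y. g y - T' g y) \<in> \<K>" if "g \<in> \<K>" for g
    by (intro K_space_diff[OF N] that nuc_mem[OF S])
qed (use b in auto)

lemma nuc_comp_rest:
  assumes T: "nuc k1 k T B" and S: "nuc k0 k3 T' B'"
    and b: "\<forall>g\<in>\<K>. \<qq> k2 (\<lambda>y. g y - T' g y) \<le> b * \<qq> k g" "0 \<le> b"
  shows "nuc k1 k2 (\<lambda>g y. T g y - T' (T g) y) (b * B)"
proof (rule nuclear_op_comp_left[OF T, where S = "\<lambda>g y. g y - T' g y"])
  show "(\<lambda>y. f y + a * g y - T' (\<lambda>y. f y + a * g y) y) = (\<lambda>y. f y - T' f y + a * (g y - T' g y))" for f g a
    by (simp add: nuclear_op_add_arg[OF S] nuclear_op_cmult_arg[OF S] algebra_simps)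
  show "(\<lambda>y. 0 - T' (\<lambda>y. 0) y) = (\<lambda>y. 0)" by (simp add: nuclear_op_zero_arg[OF S])
  show "(\<lambda>y. g y - T' g y) \<in> \<K>" if "g \<in> \<K>" for g
    by (intro K_space_diff[OF N] that nuc_mem[OF S])
qed (use b in auto)

text \<open>The error operators multiply: \<open>(1 - T1) (1 - T2) = 1 - (T1 + (1 - T1) T2)\<close>.\<close>

lemma rest_comp:
  assumes T1: "nuc k1 k T1 B1" and T2: "nuc k2 k1 T2 B2"
    and e1: "\<forall>g\<in>\<K>. \<qq> k (\<lambda>y. g y - T1 g y) \<le> \<epsilon>1 * \<qq> k1 g" "0 \<le> \<epsilon>1"
    and e2: "\<forall>g\<in>\<K>. \<qq> k1 (\<lambda>y. g y - T2 g y) \<le> \<epsilon>2 * \<qq> k2 g"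
    and b: "\<forall>g\<in>\<K>. \<qq> k1 g \<le> b * \<qq> k2 g" "0 \<le> b"
  shows "nuc k2 k (\<lambda>g y. T1 g y + (T2 g y - T1 (T2 g) y)) (B1 * b + \<epsilon>1 * B2)"
    and "g \<in> \<K> \<Longrightarrow> \<qq> k (\<lambda>y. g y - (T1 g y + (T2 g y - T1 (T2 g) y))) \<le> \<epsilon>1 * \<epsilon>2 * \<qq> k2 g"
proof -
  have "nuc k2 k (\<lambda>g. T1 g) (B1 * b)"
    by (rule nuclear_op_comp_right[OF T1, where S = "\<lambda>g. g"]) (use b in auto)
  then show "nuc k2 k (\<lambda>g y. T1 g y + (T2 g y - T1 (T2 g) y)) (B1 * b + \<epsilon>1 * B2)"
    by (intro nuclear_op_plus nuc_comp_rest[OF T2 T1 e1])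
  assume g: "g \<in> \<K>"
  let ?r = "\<lambda>y. g y - T2 g y"
  have r: "?r \<in> \<K>" by (intro K_space_diff[OF N] g nuc_mem[OF T2])
  have "(\<lambda>y. g y - (T1 g y + (T2 g y - T1 (T2 g) y))) = (\<lambda>y. ?r y - T1 ?r y)"
    by (simp add: nuclear_op_diff_arg[OF T1] algebra_simps)
  then have "\<qq> k (\<lambda>y. g y - (T1 g y + (T2 g y - T1 (T2 g) y))) \<le> \<epsilon>1 * \<qq> k1 ?r"
    using bspec[OF e1(1) r] by simp
  also have "\<dots> \<le> \<epsilon>1 * (\<epsilon>2 * \<qq> k2 g)" by (intro mult_left_mono bspec[OF e2] g e1)
  finally show "\<qq> k (\<lambda>y. g y - (T1 g y + (T2 g y - T1 (T2 g) y))) \<le> \<epsilon>1 * \<epsilon>2 * \<qq> k2 g"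
    by simp
qed

text \<open>Errors multiply, so exponents add. The nuclear norm of the composite is at most
  \<open>C1 / \<eta> * b\<close> plus \<open>C1 * \<eta> powr t * (C2 / \<eta>)\<close>; both are
  \<open>O(1 / \<eta>)\<close> because \<open>\<eta> \<le> 1\<close> and
  \<open>0 \<le> t\<close>.\<close>

lemma approximable_trans:
  assumes a1: "approximable k1 k t" and a2: "approximable k2 k1 u" and "0 \<le> t"
  shows "approximable k2 k (t + u)"
proof -
  obtain b where b: "0 \<le> b" "\<forall>g\<in>\<K>. \<qq> k1 g \<le> b * \<qq> k2 g"
    using approximable_bounded[OF a2] by blast
  obtain C1 where C1: "0 \<le> C1" "\<And>\<eta>. 0 < \<eta> \<Longrightarrow> \<eta> \<le> 1 \<Longrightarrow> \<exists>T. nuc k1 k T (C1 / \<eta>) \<and>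
     (\<forall>g\<in>\<K>. \<qq> k (\<lambda>y. g y - T g y) \<le> C1 * \<eta> powr t * \<qq> k1 g)"
    using a1 unfolding approximable_def by blast
  obtain C2 where C2: "0 \<le> C2" "\<And>\<eta>. 0 < \<eta> \<Longrightarrow> \<eta> \<le> 1 \<Longrightarrow> \<exists>T. nuc k2 k1 T (C2 / \<eta>) \<and>
     (\<forall>g\<in>\<K>. \<qq> k1 (\<lambda>y. g y - T g y) \<le> C2 * \<eta> powr u * \<qq> k2 g)"
    using a2 unfolding approximable_def by blast
  define C where "C = C1 * b + C1 * C2"
  have "\<exists>T. nuc k2 k T (C / \<eta>) \<and>
     (\<forall>g\<in>\<K>. \<qq> k (\<lambda>y. g y - T g y) \<le> C * \<eta> powr (t + u) * \<qq> k2 g)"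
    if \<eta>: "0 < \<eta>" "\<eta> \<le> 1" for \<eta>
  proof -
    obtain T1 where T1: "nuc k1 k T1 (C1 / \<eta>)"
      "\<forall>g\<in>\<K>. \<qq> k (\<lambda>y. g y - T1 g y) \<le> C1 * \<eta> powr t * \<qq> k1 g"
      using C1(2)[OF \<eta>] by blast
    obtain T2 where T2: "nuc k2 k1 T2 (C2 / \<eta>)"
      "\<forall>g\<in>\<K>. \<qq> k1 (\<lambda>y. g y - T2 g y) \<le> C2 * \<eta> powr u * \<qq> k2 g"
      using C2(2)[OF \<eta>] by blast
    have e0: "0 \<le> C1 * \<eta> powr t" using C1(1) by simp
    note R = rest_comp[OF T1(1) T2(1) T1(2) e0 T2(2) b(2,1)]
    have "C1 / \<eta> * b + C1 * \<eta> powr t * (C2 / \<eta>) \<le> C / \<eta>"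
    proof -
      have "\<eta> powr t \<le> 1" using powr_mono2[OF \<open>0 \<le> t\<close> _ \<eta>(2)] \<eta>(1) by simp
      then have "\<eta> powr t * (C1 * C2 / \<eta>) \<le> 1 * (C1 * C2 / \<eta>)" using C1(1) C2(1) \<eta> by (intro mult_right_mono) auto
      then show ?thesis by (simp add: C_def add_divide_distrib mult_ac)
    qed
    from nuclear_op.weaken[OF R(1) this]
    have "nuc k2 k (\<lambda>g y. T1 g y + (T2 g y - T1 (T2 g) y)) (C / \<eta>)" .
    moreover have "\<qq> k (\<lambda>y. g y - (T1 g y + (T2 g y - T1 (T2 g) y))) \<le> C * \<eta> powr (t + u) * \<qq> k2 g"
      if g: "g \<in> \<K>" for g
    proof -
      have "C1 * \<eta> powr t * (C2 * \<eta> powr u) \<le> C * \<eta> powr (t + u)"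
        using C1(1) C2(1) b(1) \<eta> by (simp add: C_def powr_add algebra_simps)
      from order_trans[OF R(2)[OF g] mult_right_mono[OF this K_seminorm_nonneg[OF N g]]] show ?thesis .
    qed
    ultimately show ?thesis by blast
  qed
  moreover have "0 \<le> C" using C1 C2 b by (simp add: C_def)
  ultimately show ?thesis unfolding approximable_def by blast
qed

text \<open>With exponents above 1, the differences of consecutive error operators
  \<open>(1 - T1) (1 - T2)\<close> along \<open>\<eta> = 1 / 2 ^ j\<close> have summable nuclear norms.\<close>

lemma approximable_imp_nuclear:
  assumes a1: "approximable k1 k t" and a2: "approximable k2 k1 u" and t: "1 < t" and u: "1 < u"
  shows "\<exists>C. \<forall>\<epsilon>>0. \<exists>T. nuc k2 k T C \<and> (\<forall>g\<in>\<K>. \<qq> k (\<lambda>y. g y - T g y) \<le> \<epsilon> * \<qq> k2 g)"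
proof -
  obtain b where b: "0 \<le> b" "\<forall>g\<in>\<K>. \<qq> k1 g \<le> b * \<qq> k2 g"
    using approximable_bounded[OF a2] by blast
  define \<eta> :: "nat \<Rightarrow> real" where "\<eta> j = 1 / 2 ^ j" for j
  have \<eta>: "0 < \<eta> j" "\<eta> j \<le> 1" for j by (auto simp: \<eta>_def)
  obtain C1 where C1: "0 \<le> C1" "\<forall>j. \<exists>T. nuc k1 k T (C1 / \<eta> j) \<and>
     (\<forall>g\<in>\<K>. \<qq> k (\<lambda>y. g y - T g y) \<le> C1 * \<eta> j powr t * \<qq> k1 g)"
    using a1 \<eta> unfolding approximable_def by blast
  obtain T1 where T1: "\<And>j. nuc k1 k (T1 j) (C1 / \<eta> j)"
      "\<And>j. \<forall>g\<in>\<K>. \<qq> k (\<lambda>y. g y - T1 j g y) \<le> C1 * \<eta> j powr t * \<qq> k1 g"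
    using choice[OF C1(2)] by blast
  obtain C2 where C2: "0 \<le> C2" "\<forall>j. \<exists>T. nuc k2 k1 T (C2 / \<eta> j) \<and>
     (\<forall>g\<in>\<K>. \<qq> k1 (\<lambda>y. g y - T g y) \<le> C2 * \<eta> j powr u * \<qq> k2 g)"
    using a2 \<eta> unfolding approximable_def by blast
  obtain T2 where T2: "\<And>j. nuc k2 k1 (T2 j) (C2 / \<eta> j)"
      "\<And>j. \<forall>g\<in>\<K>. \<qq> k1 (\<lambda>y. g y - T2 j g y) \<le> C2 * \<eta> j powr u * \<qq> k2 g"
    using choice[OF C2(2)] by blast
  define T where "T j = (\<lambda>g y. T1 j g y + (T2 j g y - T1 j (T2 j g) y))" for j
  have e0: "0 \<le> C1 * \<eta> j powr t" "0 \<le> C2 * \<eta> j powr u" for j using C1(1) C2(1) by auto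
  note R = rest_comp[OF T1(1) T2(1) T1(2) e0(1) T2(2) b(2,1), folded T_def]
  \<comment> \<open>The ratio of a geometric series: the error \<open>\<eta> powr s\<close> times
    the nuclear norm \<open>1 / \<eta>\<close>, taken at \<open>\<eta> = 1 / 2 ^ j\<close>. It is
    below 1 exactly when \<open>s > 1\<close>.\<close>
  define \<theta> where "\<theta> s = (2 :: real) powr (1 - s)" for s
  have \<theta>: "0 < \<theta> s" "\<theta> s < 1" if "1 < s" for s
    using that powr_less_mono[of "1 - s" 0 "2::real"] by (auto simp: \<theta>_def)
  have qj: "\<eta> j powr s * 2 ^ j = \<theta> s ^ j" for j s
  proof -
    have "\<eta> j = 2 powr (- real j)" by (simp add: \<eta>_def powr_minus powr_realpow divide_inverse)
    then have "\<eta> j powr s * 2 ^ j = 2 powr (- real j * s) * 2 powr real j" by (simp add: powr_powr powr_realpow)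
    also have "\<dots> = 2 powr ((1 - s) * real j)" by (simp add: algebra_simps flip: powr_add)
    also have "\<dots> = \<theta> s ^ j" by (simp add: \<theta>_def powr_powr[symmetric] powr_realpow)
    finally show ?thesis .
  qed
  \<comment> \<open>The factor 3 comes from
    \<open>1 / \<eta> (Suc j) + 1 / \<eta> j = 3 * 2 ^ j\<close>, the bound for the difference of
    two consecutive operators.\<close>
  define d where "d j = 3 * C1 * C2 * (\<theta> t ^ j + \<theta> u ^ j)" for j
  have nuc: "nuc k2 k (T J) (C1 * b + C1 * C2 + (\<Sum>j<J. d j))" for J
  proof (induction J)
    case 0
    from R(1)[of 0 0] show ?case by (simp add: T_def \<eta>_def)
  next
    case (Suc j)
    \<comment> \<open>\<open>T (Suc j) - T j\<close> equals
      \<open>?D1 (1 - T2 j) + (1 - T1 (Suc j)) ?D2\<close>: in each product the finite-rank factor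
      costs \<open>O(1 / \<eta> j)\<close> and the other is an error operator.\<close>
    let ?D1 = "\<lambda>g y. T1 (Suc j) g y - T1 j g y" and ?D2 = "\<lambda>g y. T2 (Suc j) g y - T2 j g y"
    have "nuc k2 k (\<lambda>g. ?D1 (\<lambda>y. g y - T2 j g y)) ((C1 / \<eta> (Suc j) + C1 / \<eta> j) * (C2 * \<eta> j powr u))"
      by (rule nuc_rest_comp[OF nuclear_op_minus[OF T1(1) T1(1)] T2(1) T2(2) e0(2)])
    moreover have "nuc k2 k (\<lambda>g y. ?D2 g y - T1 (Suc j) (?D2 g) y) (C1 * \<eta> (Suc j) powr t * (C2 / \<eta> (Suc j) + C2 / \<eta> j))"
      by (rule nuc_comp_rest[OF nuclear_op_minus[OF T2(1) T2(1)] T1(1) T1(2) e0(1)])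
    ultimately have "nuc k2 k (\<lambda>g y. T j g y + (?D1 (\<lambda>y. g y - T2 j g y) y + (?D2 g y - T1 (Suc j) (?D2 g) y)))
        (C1 * b + C1 * C2 + (\<Sum>j<j. d j) + ((C1 / \<eta> (Suc j) + C1 / \<eta> j) * (C2 * \<eta> j powr u)
          + C1 * \<eta> (Suc j) powr t * (C2 / \<eta> (Suc j) + C2 / \<eta> j)))"
      by (intro nuclear_op_plus Suc.IH)
    moreover have "(\<lambda>g y. T j g y + (?D1 (\<lambda>y. g y - T2 j g y) y + (?D2 g y - T1 (Suc j) (?D2 g) y))) = T (Suc j)"
      unfolding T_def by (simp add: fun_eq_iff nuclear_op_diff_arg[OF T1(1)])
    moreover have "(C1 / \<eta> (Suc j) + C1 / \<eta> j) * (C2 * \<eta> j powr u)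
          + C1 * \<eta> (Suc j) powr t * (C2 / \<eta> (Suc j) + C2 / \<eta> j) \<le> d j"
    proof -
      have "\<eta> (Suc j) powr t \<le> \<eta> j powr t"
        using t \<eta>(1)[of "Suc j"] by (intro powr_mono2) (auto simp: \<eta>_def field_simps)
      then have "C1 * \<eta> (Suc j) powr t * (C2 / \<eta> (Suc j) + C2 / \<eta> j) \<le> C1 * \<eta> j powr t * (C2 / \<eta> (Suc j) + C2 / \<eta> j)"
        using C1(1) C2(1) \<eta>(1) by (intro mult_right_mono mult_left_mono add_nonneg_nonneg) (auto simp: less_imp_le)
      also have "\<dots> = 3 * C1 * C2 * (\<eta> j powr t * 2 ^ j)" by (simp add: \<eta>_def algebra_simps)
      finally have "C1 * \<eta> (Suc j) powr t * (C2 / \<eta> (Suc j) + C2 / \<eta> j) \<le> 3 * C1 * C2 * \<theta> t ^ j" unfolding qj .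
      moreover have "(C1 / \<eta> (Suc j) + C1 / \<eta> j) * (C2 * \<eta> j powr u) = 3 * C1 * C2 * (\<eta> j powr u * 2 ^ j)"
        by (simp add: \<eta>_def algebra_simps)
      ultimately show ?thesis unfolding qj d_def distrib_left[of "3 * C1 * C2"] by linarith
    qed
    ultimately show ?case by (auto elim: nuclear_op.weaken)
  qed
  define C where "C = C1 * b + C1 * C2 + 3 * C1 * C2 * (1 / (1 - \<theta> t) + 1 / (1 - \<theta> u))"
  have sumd: "(\<Sum>j<J. d j) \<le> 3 * C1 * C2 * (1 / (1 - \<theta> t) + 1 / (1 - \<theta> u))" for J
  proof -
    have "(\<Sum>j<J. \<theta> s ^ j) \<le> 1 / (1 - \<theta> s)" if "1 < s" for s
      using \<theta>[OF that] sum_le_suminf[of "\<lambda>j. \<theta> s ^ j" "{..<J}"] by (simp add: suminf_geometric)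
    from add_mono[OF this[OF t] this[OF u]] show ?thesis
      unfolding d_def using C1(1) C2(1) by (simp add: sum_distrib_left[symmetric] sum.distrib mult_left_mono)
  qed
  have "\<exists>T. nuc k2 k T C \<and> (\<forall>g\<in>\<K>. \<qq> k (\<lambda>y. g y - T g y) \<le> \<epsilon> * \<qq> k2 g)" if "\<epsilon> > 0" for \<epsilon>
  proof -
    have "(\<lambda>j. C1 * C2 * (1 / 2) ^ j) \<longlonglongrightarrow> C1 * C2 * 0" by (intro tendsto_intros LIMSEQ_power_zero) auto
    then have "eventually (\<lambda>j. C1 * C2 * (1 / 2) ^ j < \<epsilon>) sequentially" using that by (auto dest: order_tendstoD)
    then obtain J where J: "C1 * C2 * \<eta> J < \<epsilon>" unfolding eventually_sequentially \<eta>_def by (auto simp: power_divide)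
    have small: "C1 * \<eta> J powr t * (C2 * \<eta> J powr u) \<le> \<epsilon>"
    proof -
      have "\<eta> J powr t \<le> \<eta> J powr 1" "\<eta> J powr u \<le> 1"
        using t u \<eta>[of J] powr_mono'[of 1 t "\<eta> J"] powr_mono2[of u "\<eta> J" 1] by auto
      then have "\<eta> J powr t * \<eta> J powr u \<le> \<eta> J * 1" using \<eta>[of J] by (intro mult_mono) auto
      then have "C1 * C2 * (\<eta> J powr t * \<eta> J powr u) \<le> C1 * C2 * (\<eta> J * 1)" using C1(1) C2(1) by (intro mult_left_mono) auto
      then show ?thesis using J by (simp add: mult_ac)
    qed
    have "nuc k2 k (T J) C" using sumd[of J] by (intro nuclear_op.weaken[OF nuc[of J]]) (simp add: C_def)
    moreover have "\<qq> k (\<lambda>y. g y - T J g y) \<le> \<epsilon> * \<qq> k2 g" if g: "g \<in> \<K>" for g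
      using order_trans[OF R(2)[OF g, of J J] mult_right_mono[OF small K_seminorm_nonneg[OF N g]]] by (simp add: T_def)
    ultimately show ?thesis by blast
  qed
  then show ?thesis by blast
qed

end

section \<open>Nuclear approximation of the identity\<close>

text \<open>Divergence of the harmonic series. At least one summand is present because the chain in
  \<open>nuclear_approximation\<close> takes at least one step.\<close>

lemma ex_sum_inverse_gt_1: "\<exists>n. 1 < (\<Sum>i<Suc n. 1 / real (a + i))"
proof (rule ccontr)
  assume "\<not> ?thesis"
  then have le: "(\<Sum>i<Suc n. 1 / real (a + i)) \<le> 1" for n by (simp add: not_less)
  have "(\<Sum>i<n. 1 / real (a + i)) \<le> 1" for n
    using le[of n] by (simp del: of_nat_add) (smt (verit) divide_nonneg_nonneg of_nat_0_le_iff)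
  then have "summable (\<lambda>i. 1 / real (a + i))" by (intro summableI_nonneg_bounded[where x = 1]) auto
  then have "summable (\<lambda>i. 1 / real (i + a))" by (simp add: add.commute)
  then have "summable (\<lambda>i. 1 / real i)" using summable_iff_shift[of "\<lambda>i. 1 / real i" a] by simp
  then show False using not_summable_harmonic[where 'a=real] by (simp add: inverse_eq_divide)
qed

context
  fixes N :: "'w \<Rightarrow> 'b::euclidean_space \<Rightarrow> real"
  assumes N: "weight_family N" and bdd: "\<And>\<omega> S. bounded S \<Longrightarrow> bdd_above (N \<omega> ` S)"
    and condI: "\<forall>\<omega>. \<exists>\<omega>' L. bounded (range L) \<and> integrable lebesgue L \<and> (\<forall>y. 0 \<le> L y) \<and>
                 (\<forall>y. N \<omega> y \<le> L y * N \<omega>' y) \<and> (L \<longlongrightarrow> 0) at_infinity"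
    and condII: "\<forall>\<omega>. \<exists>\<omega>' B C. open B \<and> 0 \<in> B \<and> C > 0 \<and>
                 (\<forall>y y'. y' \<in> B \<longrightarrow> N \<omega> y \<le> C * N \<omega>' (y + y'))"
begin

text \<open>The mesh is \<open>h0 * \<eta> powr (1 / s)\<close> with \<open>s = m + DIM('b)\<close>.
  Its power \<open>s\<close> is \<open>h0 ^ s * \<eta>\<close>, so the nuclear norm is a multiple of
  \<open>1 / \<eta>\<close> and the error a multiple of \<open>\<eta> powr (1 / s)\<close>. The
  fixed \<open>h0\<close> makes the mesh admissible for all \<open>\<eta> \<le> 1\<close>.\<close>

lemma approximable_step:
  shows "\<exists>\<omega>'. approximable N (\<omega>', Suc m) (\<omega>, m) (1 / real (m + DIM('b)))"
proof -
  obtain \<omega>' L r where L: "bounded (range L)" "integrable lebesgue L" "\<And>y. 0 \<le> L y" "(L \<longlongrightarrow> 0) at_infinity"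
    and r: "0 < r" and NL: "\<And>y u z. norm (y - u) < r \<Longrightarrow> norm (u - z) < r \<Longrightarrow> N \<omega> y \<le> L u * N \<omega>' z"
    using weight_transfer[OF N condI condII, of \<omega>] by blast
  obtain A where A: "\<And>y. L y \<le> A" using L(1) unfolding bounded_iff by (auto simp: abs_le_iff)
  have A0: "0 \<le> A" using A L(3) order_trans by blast
  define s where "s = m + DIM('b)"
  have s: "0 < s" using DIM_positive[where 'a='b] by (simp add: s_def)
  define \<kappa> where "\<kappa> = spline_radius TYPE('b) m + real m + real DIM('b)"
  have \<kappa>: "0 \<le> \<kappa>" by (simp add: \<kappa>_def spline_radius_def)
  define h0 where "h0 = min 1 (r / (\<kappa> + 1))"
  have h0: "0 < h0" "h0 \<le> 1" "h0 * \<kappa> < r"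
  proof -
    show "0 < h0" "h0 \<le> 1" using r \<kappa> by (auto simp: h0_def)
    have "h0 * \<kappa> \<le> r / (\<kappa> + 1) * \<kappa>" using \<kappa> by (intro mult_right_mono) (auto simp: h0_def)
    also have "\<dots> < r" using r \<kappa> by (simp add: field_simps)
    finally show "h0 * \<kappa> < r" .
  qed
  define E where "E = real DIM('b) * (spline_radius TYPE('b) m + m) * A + 1"
  have E: "0 \<le> E" using A0 by (simp add: E_def spline_radius_def)
  define I where "I = 2 ^ m * integral\<^sup>L lebesgue L / h0 ^ s"
  have I: "0 \<le> I" using L(3) h0 by (simp add: I_def)
  have "\<exists>T. nuclear_op (K_space N) (K_seminorm N (\<omega>', Suc m)) (K_seminorm N (\<omega>, m)) T ((I + E) / \<eta>) \<and>
     (\<forall>g\<in>K_space N. K_seminorm N (\<omega>, m) (\<lambda>y. g y - T g y) \<le> (I + E) * \<eta> powr (1 / real s) * K_seminorm N (\<omega>', Suc m) g)"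
    if \<eta>: "0 < \<eta>" "\<eta> \<le> 1" for \<eta>
  proof -
    define e where "e = \<eta> powr (1 / real s)"
    have e: "0 < e" "e \<le> 1" using \<eta> powr_mono2[of "1 / real s" \<eta> 1] by (auto simp: e_def)
    have es: "e ^ s = \<eta>" using s \<eta> by (simp add: e_def powr_realpow[symmetric] powr_powr)
    have h0e: "h0 * e \<le> h0" using h0 e by (simp add: mult_left_le)
    have "h0 * e * \<kappa> \<le> h0 * \<kappa>" by (rule mult_right_mono[OF h0e \<kappa>])
    then have he: "0 < h0 * e" "h0 * e \<le> 1" "h0 * e * \<kappa> < r"
      using mult_pos_pos[OF h0(1) e(1)] h0 h0e by linarith+
    obtain T B where T: "nuclear_op (K_space N) (K_seminorm N (\<omega>', Suc m)) (K_seminorm N (\<omega>, m)) T B"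
      and B: "(h0 * e) ^ s * B \<le> 2 ^ m * integral\<^sup>L lebesgue L"
      and err: "\<And>g. g \<in> K_space N \<Longrightarrow> K_seminorm N (\<omega>, m) (\<lambda>y. g y - T g y) \<le> h0 * e * E * K_seminorm N (\<omega>', Suc m) g"
      using quasi_interpolation[OF N bdd A L(2-4) NL he[unfolded \<kappa>_def], folded s_def E_def] by blast
    have "B \<le> I / \<eta>" using B h0 \<eta> by (simp add: I_def power_mult_distrib es field_simps)
    also have "\<dots> \<le> (I + E) / \<eta>" using E \<eta> by (simp add: divide_right_mono)
    finally have "nuclear_op (K_space N) (K_seminorm N (\<omega>', Suc m)) (K_seminorm N (\<omega>, m)) T ((I + E) / \<eta>)"
      by (rule nuclear_op.weaken[OF T])
    moreover have "K_seminorm N (\<omega>, m) (\<lambda>y. g y - T g y) \<le> (I + E) * e * K_seminorm N (\<omega>', Suc m) g"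
      if g: "g \<in> K_space N" for g
    proof -
      have "h0 * e * E \<le> 1 * e * E" using h0 e E by (intro mult_right_mono) auto
      also have "\<dots> \<le> (I + E) * e" using I e by (simp add: distrib_right mult.commute)
      finally show ?thesis by (rule order_trans[OF err[OF g] mult_right_mono[OF _ K_seminorm_nonneg[OF N g]]])
    qed
    ultimately show ?thesis unfolding e_def by blast
  qed
  then show ?thesis unfolding approximable_def[OF N] s_def[symmetric] using I E by (intro exI[of _ \<omega>'] exI[of _ "I + E"]) auto
qed

lemma nuclear_approximation:
  shows "\<exists>k' C. \<forall>\<epsilon>>0. \<exists>T. nuclear_op (K_space N) (K_seminorm N k') (K_seminorm N k) T C \<and>
           (\<forall>g\<in>K_space N. K_seminorm N k (\<lambda>y. g y - T g y) \<le> \<epsilon> * K_seminorm N k' g)"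
proof -
  \<comment> \<open>Step \<open>i\<close> starts from order \<open>m + i\<close> and needs one
    derivative more, so it contributes the exponent \<open>1 / (m + DIM('b) + i)\<close>.\<close>
  have chain: "\<exists>\<omega>'. approximable N (\<omega>', m + Suc n) (\<omega>, m) (\<Sum>i<Suc n. 1 / real ((m + DIM('b)) + i))" for \<omega> m n
  proof (induction n)
    case 0
    show ?case using approximable_step[of m \<omega>] by simp
  next
    case (Suc n)
    then obtain \<omega>1 where 1: "approximable N (\<omega>1, m + Suc n) (\<omega>, m) (\<Sum>i<Suc n. 1 / real ((m + DIM('b)) + i))" by blast
    obtain \<omega>2 where 2: "approximable N (\<omega>2, Suc (m + Suc n)) (\<omega>1, m + Suc n) (1 / real (m + Suc n + DIM('b)))"
      using approximable_step by blast
    have "0 \<le> (\<Sum>i<Suc n. 1 / real ((m + DIM('b)) + i))" by (intro sum_nonneg) auto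
    from approximable_trans[OF N 1 2 this] show ?case by (auto simp: add_ac)
  qed
  have gt1: "\<exists>k' t. 1 < t \<and> approximable N k' k t" for k :: "'w \<times> nat"
  proof -
    obtain \<omega> m where k: "k = (\<omega>, m)" by fastforce
    obtain n where "1 < (\<Sum>i<Suc n. 1 / real ((m + DIM('b)) + i))" using ex_sum_inverse_gt_1 by blast
    then show ?thesis using chain[of m n \<omega>] unfolding k by blast
  qed
  \<comment> \<open>Two chains in a row: the telescoping argument needs an exponent above 1 for each
    of its two error operators.\<close>
  obtain k1 t where t: "1 < t" "approximable N k1 k t" using gt1 by blast
  obtain k2 u where u: "1 < u" "approximable N k2 k1 u" using gt1 by blast
  from approximable_imp_nuclear[OF N t(2) u(2) t(1) u(1)] show ?thesis by blast
qed

end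

section \<open>Tensor products\<close>

lemma defining_family_weight: "defining_family M \<Longrightarrow> weight_family M"
  unfolding defining_family_def weight_family_def by blast

lemma weight_family_tensor:
  assumes M: "weight_family M" and N: "weight_family N"
  shows "weight_family (tensor_family M N)"
  unfolding weight_family_def
proof (intro conjI allI)
  fix k z show "0 \<le> tensor_family M N k z"
    using weight_family_nonneg[OF M] weight_family_nonneg[OF N]
    by (cases k; cases z) (auto simp: tensor_family_def)
next
  fix k1 k2 :: "'a \<times> 'c"
  obtain \<gamma>1 \<omega>1 \<gamma>2 \<omega>2 where k: "k1 = (\<gamma>1, \<omega>1)" "k2 = (\<gamma>2, \<omega>2)" by fastforce
  obtain \<gamma> C where C: "C > 0" "\<And>x. M \<gamma> x \<ge> C * (M \<gamma>1 x + M \<gamma>2 x)"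
    using M unfolding weight_family_def by meson
  obtain \<omega> D where D: "D > 0" "\<And>x. N \<omega> x \<ge> D * (N \<omega>1 x + N \<omega>2 x)"
    using N unfolding weight_family_def by meson
  have "C * D * (M \<gamma>1 x * N \<omega>1 y + M \<gamma>2 x * N \<omega>2 y) \<le> M \<gamma> x * N \<omega> y" for x y
  proof -
    note nn = weight_family_nonneg[OF M] weight_family_nonneg[OF N]
    \<comment> \<open>The cross terms on the right are nonnegative.\<close>
    have "M \<gamma>1 x * N \<omega>1 y + M \<gamma>2 x * N \<omega>2 y \<le> (M \<gamma>1 x + M \<gamma>2 x) * (N \<omega>1 y + N \<omega>2 y)"
      using nn by (simp add: algebra_simps)
    then have "C * D * (M \<gamma>1 x * N \<omega>1 y + M \<gamma>2 x * N \<omega>2 y) \<le> (C * (M \<gamma>1 x + M \<gamma>2 x)) * (D * (N \<omega>1 y + N \<omega>2 y))"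
      using C(1) D(1) by (simp add: mult_ac)
    also have "\<dots> \<le> M \<gamma> x * N \<omega> y" using C D nn by (intro mult_mono) auto
    finally show ?thesis .
  qed
  then show "\<exists>k C. C > 0 \<and> (\<forall>z. tensor_family M N k z \<ge> C * (tensor_family M N k1 z + tensor_family M N k2 z))"
    using C(1) D(1) by (intro exI[of _ "(\<gamma>, \<omega>)"] exI[of _ "C * D"]) (auto simp: tensor_family_def k)
next
  fix z :: "'b \<times> 'd"
  obtain x y where z: "z = (x, y)" by fastforce
  obtain \<gamma> U C where U: "open U" "x \<in> U" "C > 0" "\<And>x'. x' \<in> U \<Longrightarrow> M \<gamma> x' \<ge> C"
    using M unfolding weight_family_def by meson
  obtain \<omega> V D where V: "open V" "y \<in> V" "D > 0" "\<And>x'. x' \<in> V \<Longrightarrow> N \<omega> x' \<ge> D"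
    using N unfolding weight_family_def by meson
  have "C * D \<le> tensor_family M N (\<gamma>, \<omega>) p" if UV: "p \<in> U \<times> V" for p
  proof -
    obtain u v where p: "p = (u, v)" "u \<in> U" "v \<in> V" using UV by auto
    have "C * D \<le> M \<gamma> u * N \<omega> v" using U(3,4) V(3,4) p by (intro mult_mono) (auto intro: weight_family_nonneg[OF M])
    then show ?thesis by (simp add: p tensor_family_def)
  qed
  then show "\<exists>k U C. open U \<and> z \<in> U \<and> C > 0 \<and> (\<forall>p\<in>U. C \<le> tensor_family M N k p)"
    using U V z by (intro exI[of _ "(\<gamma>, \<omega>)"] exI[of _ "U \<times> V"] exI[of _ "C * D"]) (auto intro: open_Times)
qed

section \<open>Explicit representations of tensors and their cost\<close>

abbreviation (input) tensor_fun :: "('a \<Rightarrow> complex) \<Rightarrow> ('b \<Rightarrow> complex) \<Rightarrow> 'a \<times> 'b \<Rightarrow> complex" where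
  "tensor_fun f g \<equiv> \<lambda>(x, y). f x * g y"

abbreviation lift_left :: "'a list \<Rightarrow> ('a \<times> 'b::zero) list" where
  "lift_left as \<equiv> map (\<lambda>a. (a, 0)) as"

abbreviation lift_right :: "'b list \<Rightarrow> ('a::zero \<times> 'b) list" where
  "lift_right bs \<equiv> map (Pair 0) bs"

text \<open>Upper bounds for the projective seminorm are carried by explicit representations of cost
  at most \<open>c\<close>. Such bounds add up without any handling of infima, and they also record
  that \<open>t\<close> is a finite sum of tensors.\<close>

definition proj_rep :: "('a \<Rightarrow> complex) set \<Rightarrow> (('a \<Rightarrow> complex) \<Rightarrow> real) \<Rightarrow> ('b \<Rightarrow> complex) set \<Rightarrow> (('b \<Rightarrow> complex) \<Rightarrow> real) \<Rightarrow>
    ('a \<times> 'b \<Rightarrow> complex) \<Rightarrow> real \<Rightarrow> bool" where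
  "proj_rep VE P VF Q t c \<longleftrightarrow> (\<exists>(n::nat) f g. (\<forall>i<n. f i \<in> VE \<and> g i \<in> VF) \<and>
     t = (\<lambda>z. \<Sum>i<n. tensor_fun (f i) (g i) z) \<and> (\<Sum>i<n. P (f i) * Q (g i)) \<le> c)"

lemma proj_rep_zero: "proj_rep VE P VF Q (\<lambda>z. 0) 0"
  unfolding proj_rep_def by (rule exI[of _ 0]) simp

lemma proj_rep_weaken: "proj_rep VE P VF Q t c \<Longrightarrow> c \<le> c' \<Longrightarrow> proj_rep VE P VF Q t c'"
  unfolding proj_rep_def by (elim exE conjE, intro exI conjI) (assumption, assumption, rule order_trans)

lemma proj_rep_add:
  assumes "proj_rep VE P VF Q t c" "f \<in> VE" "g \<in> VF"
  shows "proj_rep VE P VF Q (\<lambda>z. t z + tensor_fun f g z) (c + P f * Q g)"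
proof -
  obtain n :: nat and F G where FG: "\<forall>i<n. F i \<in> VE \<and> G i \<in> VF"
    "t = (\<lambda>z. \<Sum>i<n. tensor_fun (F i) (G i) z)" "(\<Sum>i<n. P (F i) * Q (G i)) \<le> c"
    using assms(1) unfolding proj_rep_def by blast
  show ?thesis
    unfolding proj_rep_def
  proof (intro exI[of _ "Suc n"] exI[of _ "F(n := f)"] exI[of _ "G(n := g)"] conjI)
    show "\<forall>i<Suc n. (F(n := f)) i \<in> VE \<and> (G(n := g)) i \<in> VF" using FG(1) assms(2,3) by auto
    show "(\<lambda>z. t z + tensor_fun f g z) = (\<lambda>z. \<Sum>i<Suc n. tensor_fun ((F(n := f)) i) ((G(n := g)) i) z)"
      by (auto simp: FG(2))
    show "(\<Sum>i<Suc n. P ((F(n := f)) i) * Q ((G(n := g)) i)) \<le> c + P f * Q g" using FG(3) by simp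
  qed
qed

lemma proj_rep_plus:
  fixes n :: nat
  assumes "proj_rep VE P VF Q t c" "\<forall>i<n. f i \<in> VE \<and> g i \<in> VF"
  shows "proj_rep VE P VF Q (\<lambda>z. t z + (\<Sum>i<n. tensor_fun (f i) (g i) z)) (c + (\<Sum>i<n. P (f i) * Q (g i)))"
  using assms(2)
proof (induction n)
  case 0
  show ?case using assms(1) by simp
next
  case (Suc n)
  then have "proj_rep VE P VF Q (\<lambda>z. t z + (\<Sum>i<n. tensor_fun (f i) (g i) z) + tensor_fun (f n) (g n) z)
     (c + (\<Sum>i<n. P (f i) * Q (g i)) + P (f n) * Q (g n))"
    by (intro proj_rep_add) auto
  then show ?case by (simp add: add.assoc)
qed

lemma proj_rep_tensor_sums: "proj_rep VE P VF Q t c \<Longrightarrow> t \<in> tensor_sums VE VF tensor_fun"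
  unfolding proj_rep_def tensor_sums_def by blast

context
  fixes M :: "'g \<Rightarrow> 'a::euclidean_space \<Rightarrow> real"
    and N :: "'w \<Rightarrow> 'b::euclidean_space \<Rightarrow> real"
  assumes M: "weight_family M" and N: "weight_family N"
begin

abbreviation (input) "W \<equiv> tensor_family M N"
abbreviation (input) "KM \<equiv> K_space M"
abbreviation (input) "KN \<equiv> K_space N"
abbreviation (input) "KW \<equiv> K_space W"
abbreviation (input) "qM \<equiv> K_seminorm M"
abbreviation (input) "qN \<equiv> K_seminorm N"
abbreviation (input) "qW \<equiv> K_seminorm W"
abbreviation (input) "TS \<equiv> tensor_sums KM KN tensor_fun"
abbreviation (input) "proj_sn \<equiv> proj_seminorm KM qM KN qN tensor_fun"

lemma W: "weight_family W"
  by (rule weight_family_tensor[OF M N])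

lemma
  assumes f: "f \<in> KM" and g: "g \<in> KN"
  shows tensor_fun_K_space: "tensor_fun f g \<in> KW"
    and K_seminorm_tensor_fun:
      "qW ((\<gamma>, \<omega>), m) (tensor_fun f g) \<le> qM (\<gamma>, m) f * qN (\<omega>, m) g"
proof -
  note sm = K_space_smooth[OF f] K_space_smooth[OF g]
  have *: "W (\<gamma>, \<omega>) z * norm (pdl cs (tensor_fun f g) z) \<le> qM (\<gamma>, m) f * qN (\<omega>, m) g"
    if cs: "set cs \<subseteq> Basis" "length cs \<le> m" for \<gamma> \<omega> z cs m
  proof -
    obtain x y where z: "z = (x, y)" by fastforce
    have len: "length (lefts cs) \<le> m" "length (rights cs) \<le> m" using length_lefts_rights[of cs] cs by auto
    have "(M \<gamma> x * norm (pdl (lefts cs) f x)) * (N \<omega> y * norm (pdl (rights cs) g y))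
        \<le> qM (\<gamma>, m) f * qN (\<omega>, m) g"
      using len set_lefts[OF cs(1)] set_rights[OF cs(1)]
      by (intro mult_mono K_seminorm_upper f g K_seminorm_nonneg[OF M]) (auto simp: weight_family_nonneg[OF N])
    then show ?thesis by (simp add: z pdl_tensor[OF sm cs(1)] tensor_family_def norm_mult mult_ac)
  qed
  show "tensor_fun f g \<in> KW"
  proof (rule K_spaceI[OF smooth_fun_tensor[OF sm]])
    fix k :: "'g \<times> 'w" and m :: nat
    obtain \<gamma> \<omega> where "k = (\<gamma>, \<omega>)" by fastforce
    then show "\<exists>c. \<forall>z cs. set cs \<subseteq> Basis \<longrightarrow> length cs \<le> m \<longrightarrow> W k z * norm (pdl cs (tensor_fun f g) z) \<le> c"
      using *[of _ m \<gamma> \<omega>] by blast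
  qed
  show "qW ((\<gamma>, \<omega>), m) (tensor_fun f g) \<le> qM (\<gamma>, m) f * qN (\<omega>, m) g"
    by (intro K_seminorm_least *)
qed

section \<open>Slices of functions of two variables and operators acting in one variable\<close>

lemma lift_Basis:
  "set as \<subseteq> Basis \<Longrightarrow> set (lift_left as :: ('a \<times> 'b) list) \<subseteq> Basis"
  "set bs \<subseteq> Basis \<Longrightarrow> set (lift_right bs :: ('a \<times> 'b) list) \<subseteq> Basis"
  by (auto simp: Basis_prod_def)

lemma
  assumes h: "smooth_fun (h :: 'a \<times> 'b \<Rightarrow> complex)"
  shows smooth_fun_slice_right: "smooth_fun (\<lambda>y. h (x, y))"
    and pdl_slice_right: "set bs \<subseteq> Basis \<Longrightarrow> pdl bs (\<lambda>y. h (x, y)) = (\<lambda>y. pdl (lift_right bs) h (x, y))"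
    and smooth_fun_slice_left: "smooth_fun (\<lambda>x. h (x, y))"
    and pdl_slice_left: "set as \<subseteq> Basis \<Longrightarrow> pdl as (\<lambda>x. h (x, y)) = (\<lambda>x. pdl (lift_left as) h (x, y))"
proof -
  have R: "bounded_linear (\<lambda>y::'b. (0::'a, y))" "bounded_linear (\<lambda>x::'a. (x, 0::'b))"
    by (auto intro!: bounded_linear_Pair bounded_linear_zero bounded_linear_ident)
  have RB: "Pair 0 ` (Basis :: 'b set) \<subseteq> (Basis :: ('a \<times> 'b) set)"
     "(\<lambda>x. (x, 0)) ` (Basis :: 'a set) \<subseteq> (Basis :: ('a \<times> 'b) set)"
    by (auto simp: Basis_prod_def)
  show "smooth_fun (\<lambda>y. h (x, y))" "smooth_fun (\<lambda>x. h (x, y))"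
    using smooth_fun_affine[OF h R(1) RB(1), of 1 "(x, 0)"] smooth_fun_affine[OF h R(2) RB(2), of 1 "(0, y)"] by simp_all
  show "set bs \<subseteq> Basis \<Longrightarrow> pdl bs (\<lambda>y. h (x, y)) = (\<lambda>y. pdl (lift_right bs) h (x, y))"
    using pdl_affine[OF h R(1) RB(1), of bs 1 "(x, 0)"] by simp
  show "set as \<subseteq> Basis \<Longrightarrow> pdl as (\<lambda>x. h (x, y)) = (\<lambda>x. pdl (lift_left as) h (x, y))"
    using pdl_affine[OF h R(2) RB(2), of as 1 "(0, y)"] by simp
qed

text \<open>The derivatives in \<open>x\<close> are taken before \<open>x\<close> is fixed;
  derivatives in \<open>y\<close> follow in \<open>pdl_slice\<close>. This is the order that
  \<open>mset_lefts_rights\<close> produces.\<close>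

definition slice :: "'a list \<Rightarrow> 'a \<Rightarrow> ('a \<times> 'b \<Rightarrow> complex) \<Rightarrow> 'b \<Rightarrow> complex" where
  "slice as x h = (\<lambda>y. pdl (lift_left as) h (x, y))"

lemma pdl_slice:
  assumes "smooth_fun h" "set as \<subseteq> Basis" "set bs \<subseteq> Basis"
  shows "pdl bs (slice as x h) = (\<lambda>y. pdl (lift_right bs @ lift_left as) h (x, y))"
  unfolding slice_def pdl_append by (intro pdl_slice_right smooth_fun_pdl assms lift_Basis)

text \<open>At fixed \<open>x\<close> the weight \<open>M \<gamma> x\<close> is a scalar, and a
  supremum over \<open>y\<close> alone is at most the supremum over both variables. For membership,
  \<open>\<gamma>\<close> is taken with \<open>M \<gamma> x > 0\<close>, which local positivity
  provides.\<close>

lemma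
  assumes h: "h \<in> KW" and as: "set as \<subseteq> Basis"
  shows slice_in_K_space: "slice as x h \<in> KN"
    and K_seminorm_slice: "M \<gamma> x * qN (\<omega>, m) (slice as x h) \<le> qW ((\<gamma>, \<omega>), length as + m) h"
proof -
  have sm: "smooth_fun h" by (rule K_space_smooth[OF h])
  have *: "M \<gamma> x * (N \<omega> y * norm (pdl bs (slice as x h) y)) \<le> qW ((\<gamma>, \<omega>), length as + m) h"
    if bs: "set bs \<subseteq> Basis" "length bs \<le> m" for \<gamma> \<omega> y bs m
    using K_seminorm_upper[OF h, of "lift_right bs @ lift_left as" "length as + m" "(\<gamma>, \<omega>)" "(x, y)"]
      lift_Basis as bs by (simp add: pdl_slice[OF sm as bs(1)] tensor_family_def mult.assoc)
  show S: "slice as x h \<in> KN"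
  proof (rule K_spaceI)
    show "smooth_fun (slice as x h)"
      unfolding slice_def by (intro smooth_fun_slice_right smooth_fun_pdl sm lift_Basis as)
    fix \<omega> and m :: nat
    obtain \<gamma> r C where r: "r > 0" "C > 0" "\<And>v. v \<in> ball x r \<Longrightarrow> C \<le> M \<gamma> v"
      using weight_family_locally_pos[OF M, of x] by blast
    then have "C \<le> M \<gamma> x" by simp
    with r(2) have pos: "0 < M \<gamma> x" by simp
    have "N \<omega> y * norm (pdl bs (slice as x h) y) \<le> qW ((\<gamma>, \<omega>), length as + m) h / M \<gamma> x"
      if "set bs \<subseteq> Basis" "length bs \<le> m" for y bs
      using *[OF that, of \<gamma> \<omega> y] pos by (simp add: field_simps)
    then show "\<exists>c. \<forall>y bs. set bs \<subseteq> Basis \<longrightarrow> length bs \<le> m \<longrightarrow> N \<omega> y * norm (pdl bs (slice as x h) y) \<le> c" by blast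
  qed
  show "M \<gamma> x * qN (\<omega>, m) (slice as x h) \<le> qW ((\<gamma>, \<omega>), length as + m) h"
  proof (cases "M \<gamma> x = 0")
    case True
    then show ?thesis using K_seminorm_nonneg[OF W h] by simp
  next
    case False
    then have pos: "0 < M \<gamma> x" using weight_family_nonneg[OF M, of \<gamma> x] by simp
    have "qN (\<omega>, m) (slice as x h) \<le> qW ((\<gamma>, \<omega>), length as + m) h / M \<gamma> x"
      using *[of _ m \<gamma> \<omega>] pos by (intro K_seminorm_least) (simp add: field_simps)
    then show ?thesis using pos by (simp add: field_simps)
  qed
qed

text \<open>\<open>l\<close> is a finite combination of evaluations in \<open>y\<close>, so
  differentiation in \<open>x\<close> passes through it term by term.\<close>

lemma
  assumes l: "point_functional l" and h: "smooth_fun (h :: 'a \<times> 'b \<Rightarrow> complex)"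
  shows smooth_fun_partial: "smooth_fun (\<lambda>x. l (\<lambda>y. h (x, y)))"
    and pdl_partial: "set as \<subseteq> Basis \<Longrightarrow> pdl as (\<lambda>x. l (\<lambda>y. h (x, y))) = (\<lambda>x. l (slice as x h))"
proof -
  have *: "smooth_fun (\<lambda>x. l (\<lambda>y. h (x, y))) \<and> (set as \<subseteq> Basis \<longrightarrow> pdl as (\<lambda>x. l (\<lambda>y. h (x, y))) = (\<lambda>x. l (slice as x h)))" for as
    using l
  proof induction
    case zero
    show ?case by (simp add: pdl_const)
  next
    case (add l c z)
    have sc: "smooth_fun (\<lambda>x. c * h (x, z))" by (intro smooth_fun_cmult smooth_fun_slice_left h)
    show ?case
      using add.IH smooth_fun_add[OF _ sc] pdl_add[OF _ sc, of _ as]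
      by (auto simp: pdl_cmult[OF smooth_fun_slice_left[OF h]] pdl_slice_left[OF h] slice_def)
  qed
  show "smooth_fun (\<lambda>x. l (\<lambda>y. h (x, y)))"
    "set as \<subseteq> Basis \<Longrightarrow> pdl as (\<lambda>x. l (\<lambda>y. h (x, y))) = (\<lambda>x. l (slice as x h))"
    using * by blast+
qed

text \<open>The functional \<open>1 \<otimes> l\<close>: derivatives in \<open>x\<close> pass to
  slices, the bound on \<open>l\<close> is used at each \<open>x\<close> separately, and
  \<open>K_seminorm_slice\<close> absorbs the weight. The orders \<open>m\<close> and
  \<open>m'\<close> add up because both sets of derivatives fall on \<open>h\<close>.\<close>

lemma
  assumes l: "point_functional l" and h: "h \<in> KW" and c: "0 \<le> c"
    and bound: "\<And>g. g \<in> KN \<Longrightarrow> norm (l g) \<le> c * qN (\<omega>, m') g"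
  shows partial_in_K_space: "(\<lambda>x. l (\<lambda>y. h (x, y))) \<in> KM"
    and K_seminorm_partial: "qM (\<gamma>, m) (\<lambda>x. l (\<lambda>y. h (x, y))) \<le> c * qW ((\<gamma>, \<omega>), m + m') h"
proof -
  have sm: "smooth_fun h" by (rule K_space_smooth[OF h])
  have *: "M \<gamma> x * norm (pdl as (\<lambda>x. l (\<lambda>y. h (x, y))) x) \<le> c * qW ((\<gamma>, \<omega>), m + m') h"
    if as: "set as \<subseteq> Basis" "length as \<le> m" for \<gamma> x as m
  proof -
    have "M \<gamma> x * norm (l (slice as x h)) \<le> M \<gamma> x * (c * qN (\<omega>, m') (slice as x h))"
      by (intro mult_left_mono bound slice_in_K_space h as weight_family_nonneg[OF M])
    also have "\<dots> = c * (M \<gamma> x * qN (\<omega>, m') (slice as x h))" by simp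
    also have "\<dots> \<le> c * qW ((\<gamma>, \<omega>), length as + m') h"
      by (intro mult_left_mono K_seminorm_slice h as c)
    also have "\<dots> \<le> c * (1 * qW ((\<gamma>, \<omega>), m + m') h)"
      using as by (intro mult_left_mono K_seminorm_mono h W c) auto
    finally show ?thesis by (simp add: pdl_partial[OF l sm as(1)])
  qed
  show "(\<lambda>x. l (\<lambda>y. h (x, y))) \<in> KM"
    by (rule K_spaceI[OF smooth_fun_partial[OF l sm]]) (use * in blast)
  show "qM (\<gamma>, m) (\<lambda>x. l (\<lambda>y. h (x, y))) \<le> c * qW ((\<gamma>, \<omega>), m + m') h"
    by (intro K_seminorm_least *)
qed

text \<open>The operator \<open>1 \<otimes> T\<close>. It is defined directly on functions of two
  variables, so it acts on all of \<open>K_space W\<close> and not only on finite sums of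
  tensors.\<close>

definition apply_right :: "(('b \<Rightarrow> complex) \<Rightarrow> 'b \<Rightarrow> complex) \<Rightarrow> ('a \<times> 'b \<Rightarrow> complex) \<Rightarrow> 'a \<times> 'b \<Rightarrow> complex" where
  "apply_right T h = (\<lambda>(x, y). T (\<lambda>y. h (x, y)) y)"

lemma apply_right_simps:
  "apply_right (\<lambda>g y. 0) h = (\<lambda>z. 0)"
  "apply_right (\<lambda>g y. T g y + l g * e y) h = (\<lambda>z. apply_right T h z + tensor_fun (\<lambda>x. l (\<lambda>y. h (x, y))) e z)"
  by (auto simp: apply_right_def)

lemma
  assumes T: "nuclear_op (KN) P Q T B" and h: "smooth_fun h"
  shows smooth_fun_apply_right: "smooth_fun (apply_right T h)"
    and pdl_apply_right: "set cs \<subseteq> Basis \<Longrightarrow> pdl cs (apply_right T h) (x, y) = pdl (rights cs) (T (slice (lefts cs) x h)) y"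
proof -
  have *: "smooth_fun (apply_right T h) \<and> (\<forall>g. smooth_fun (T g)) \<and>
     (\<forall>cs x y. set cs \<subseteq> Basis \<longrightarrow> pdl cs (apply_right T h) (x, y) = pdl (rights cs) (T (slice (lefts cs) x h)) y)"
    using T
  proof induction
    case zero
    show ?case by (auto simp: apply_right_simps pdl_const set_rights lefts_def rights_def)
  next
    case (add T B l e c)
    note sp = smooth_fun_partial[OF add.hyps(2) h] and se = K_space_smooth[OF add.hyps(3)]
    note st = smooth_fun_tensor[OF sp se]
    have "pdl cs (apply_right (\<lambda>g y. T g y + l g * e y) h) (x, y)
        = pdl (rights cs) (\<lambda>y. T (slice (lefts cs) x h) y + l (slice (lefts cs) x h) * e y) y"
      if cs: "set cs \<subseteq> Basis" for cs x y
      unfolding apply_right_simps using add.IH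
      by (simp add: pdl_add[OF _ st cs] pdl_tensor[OF sp se cs] pdl_partial[OF add.hyps(2) h set_lefts[OF cs]]
          pdl_add[OF _ smooth_fun_cmult[OF se] set_rights[OF cs]] pdl_cmult[OF se set_rights[OF cs]] cs)
    then show ?case unfolding apply_right_simps using add.IH st se by (auto intro!: smooth_fun_add smooth_fun_cmult)
  qed
  show "smooth_fun (apply_right T h)"
    "set cs \<subseteq> Basis \<Longrightarrow> pdl cs (apply_right T h) (x, y) = pdl (rights cs) (T (slice (lefts cs) x h)) y"
    using * by blast+
qed

text \<open>\<open>pdl_perm\<close> reorders the derivatives of \<open>h\<close> so that those in
  \<open>x\<close> form a slice. On a slice the operator \<open>1 \<otimes> (1 - T)\<close> acts as
  \<open>1 - T\<close>, and the error bound for \<open>T\<close> is used at each \<open>x\<close>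
  separately.\<close>

lemma K_seminorm_apply_right:
  assumes T: "nuclear_op (KN) P Q T B" "\<And>g. T g \<in> KN" and h: "h \<in> KW"
    and err: "\<And>g. g \<in> KN \<Longrightarrow> qN (\<omega>, m) (\<lambda>y. g y - T g y) \<le> \<epsilon> * qN (\<omega>', m') g" and \<epsilon>: "0 \<le> \<epsilon>"
  shows "qW ((\<gamma>, \<omega>), m) (\<lambda>z. h z - apply_right T h z) \<le> \<epsilon> * qW ((\<gamma>, \<omega>'), m + m') h"
proof (rule K_seminorm_least)
  fix z :: "'a \<times> 'b" and cs :: "('a \<times> 'b) list" assume cs: "set cs \<subseteq> Basis" "length cs \<le> m"
  obtain x y where z: "z = (x, y)" by fastforce
  have sm: "smooth_fun h" by (rule K_space_smooth[OF h])
  note L = set_lefts[OF cs(1)] set_rights[OF cs(1)]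
  have len: "length (lefts cs) \<le> m" "length (rights cs) \<le> m" using length_lefts_rights[of cs] cs by auto
  let ?g = "slice (lefts cs) x h"
  have g: "?g \<in> KN" by (rule slice_in_K_space[OF h L(1)])
  have "pdl cs h = pdl (lift_right (rights cs) @ lift_left (lefts cs)) h"
    by (rule pdl_perm[OF sm cs(1) mset_lefts_rights[OF cs(1)]])
  then have "pdl cs h (x, y) = pdl (rights cs) ?g y" by (simp add: pdl_slice[OF sm L])
  then have eq: "pdl cs (\<lambda>z. h z - apply_right T h z) z = pdl (rights cs) (\<lambda>y. ?g y - T ?g y) y"
    by (simp add: z pdl_diff[OF sm smooth_fun_apply_right[OF T(1) sm] cs(1)] pdl_apply_right[OF T(1) sm cs(1)]
        pdl_diff[OF K_space_smooth[OF g] K_space_smooth[OF T(2)] L(2)])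
  have "N \<omega> y * norm (pdl (rights cs) (\<lambda>y. ?g y - T ?g y) y) \<le> qN (\<omega>, m) (\<lambda>y. ?g y - T ?g y)"
    by (intro K_seminorm_upper K_space_diff[OF N] g T(2) L len)
  also have "\<dots> \<le> \<epsilon> * qN (\<omega>', m') ?g" by (rule err[OF g])
  finally have "M \<gamma> x * (N \<omega> y * norm (pdl (rights cs) (\<lambda>y. ?g y - T ?g y) y)) \<le> M \<gamma> x * (\<epsilon> * qN (\<omega>', m') ?g)"
    by (intro mult_left_mono weight_family_nonneg[OF M])
  also have "\<dots> = \<epsilon> * (M \<gamma> x * qN (\<omega>', m') ?g)" by simp
  also have "\<dots> \<le> \<epsilon> * qW ((\<gamma>, \<omega>'), length (lefts cs) + m') h"
    by (intro mult_left_mono K_seminorm_slice h L \<epsilon>)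
  also have "\<dots> \<le> \<epsilon> * (1 * qW ((\<gamma>, \<omega>'), m + m') h)"
    using len by (intro mult_left_mono K_seminorm_mono h W \<epsilon>) auto
  finally show "W (\<gamma>, \<omega>) z * norm (pdl cs (\<lambda>z. h z - apply_right T h z) z) \<le> \<epsilon> * qW ((\<gamma>, \<omega>'), m + m') h"
    by (simp add: eq) (simp add: z tensor_family_def mult.assoc)
qed

text \<open>Every rank-one summand of \<open>T\<close>, with functional \<open>l\<close> and vector
  \<open>e\<close>, yields one tensor: the partial application of \<open>l\<close> to
  \<open>h\<close>, times \<open>e\<close>. Summing the costs gives the nuclear norm of
  \<open>T\<close> times a seminorm of \<open>h\<close>.\<close>

lemma apply_right_proj_rep:
  assumes T: "nuclear_op (KN) (qN (\<omega>', m')) (qN (\<omega>, m0)) T B" and h: "h \<in> KW"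
    and P: "\<And>f. f \<in> KM \<Longrightarrow> P f \<le> C * qM (\<gamma>, m) f" "0 \<le> C"
    and Q: "\<And>g. g \<in> KN \<Longrightarrow> Q g \<le> D * qN (\<omega>, m0) g" "\<And>g. g \<in> KN \<Longrightarrow> 0 \<le> Q g" "0 \<le> D"
  shows "proj_rep (KM) P (KN) Q (apply_right T h) (C * D * (B * qW ((\<gamma>, \<omega>'), m + m') h))"
  using T
proof induction
  case zero
  show ?case using proj_rep_zero by (simp add: apply_right_simps)
next
  case (add T B l e c)
  let ?f = "\<lambda>x. l (\<lambda>y. h (x, y))" and ?k = "qW ((\<gamma>, \<omega>'), m + m') h"
  note f = partial_in_K_space[OF add.hyps(2) h add.hyps(4,5)]
  have "P ?f \<le> C * (c * ?k)"
    by (rule order_trans[OF P(1)[OF f] mult_left_mono[OF K_seminorm_partial[OF add.hyps(2) h add.hyps(4,5)] P(2)]])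
  moreover have "0 \<le> C * (c * ?k)" using P(2) add.hyps(4) K_seminorm_nonneg[OF W h] by simp
  ultimately have le: "P ?f * Q e \<le> (C * (c * ?k)) * (D * qN (\<omega>, m0) e)"
    using Q add.hyps(3) by (intro mult_mono) auto
  show ?case
    unfolding apply_right_simps
  proof (rule proj_rep_weaken[OF proj_rep_add[OF add.IH f add.hyps(3)]])
    have "C * D * ((B + c * qN (\<omega>, m0) e) * ?k)
        = C * D * (B * ?k) + (C * (c * ?k)) * (D * qN (\<omega>, m0) e)" by (simp add: algebra_simps)
    then show "C * D * (B * ?k) + P ?f * Q e \<le> C * D * ((B + c * qN (\<omega>, m0) e) * ?k)"
      using le by linarith
  qed
next
  case (weaken T B B')
  show ?case
    by (rule proj_rep_weaken[OF weaken.IH])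
      (rule mult_left_mono[OF mult_right_mono[OF weaken.hyps(2) K_seminorm_nonneg[OF W h]] mult_nonneg_nonneg[OF P(2) Q(3)]])
qed

section \<open>Comparison of the projective and the weighted seminorms\<close>

lemma tensor_sums_K_space: "t \<in> TS \<Longrightarrow> t \<in> KW"
proof -
  assume "t \<in> TS"
  then obtain n :: nat and f g where fg: "\<forall>i<n. f i \<in> KM \<and> g i \<in> KN"
    and t: "t = (\<lambda>z. \<Sum>i<n. tensor_fun (f i) (g i) z)" unfolding tensor_sums_def by blast
  show "t \<in> KW" unfolding t by (rule K_space_sum[OF W], rule tensor_fun_K_space) (use fg in auto)
qed

lemma nuclear_op_sum_arg:
  assumes "nuclear_op V P Q T B"
  shows "T (\<lambda>y. \<Sum>i<(n::nat). a i * g i y) = (\<lambda>y. \<Sum>i<n. a i * T (g i) y)"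
  by (induction n) (simp_all add: nuclear_op_zero_arg[OF assms] nuclear_op_add_arg[OF assms] nuclear_op_cmult_arg[OF assms])

text \<open>The triangle inequality gives the bound for each representation of \<open>t\<close>,
  hence for the infimum over all of them; that set is nonempty because \<open>t\<close> is a tensor
  sum.\<close>

lemma K_seminorm_le_proj_seminorm:
  assumes "t \<in> TS"
  shows "qW ((\<gamma>, \<omega>), m) t \<le> proj_sn {(\<gamma>, m)} {(\<omega>, m)} t"
proof -
  obtain n0 :: nat and f0 g0 where rep0: "\<forall>i<n0. f0 i \<in> KM \<and> g0 i \<in> KN" "t = (\<lambda>z. \<Sum>i<n0. tensor_fun (f0 i) (g0 i) z)"
    using assms unfolding tensor_sums_def by blast
  show ?thesis
    unfolding proj_seminorm_def
  proof (rule cInf_greatest)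
    show "{\<Sum>i<n. (\<Sum>a\<in>{(\<gamma>, m)}. qM a (f i)) * (\<Sum>b\<in>{(\<omega>, m)}. qN b (g i)) | (n::nat) f g.
       (\<forall>i<n. f i \<in> KM \<and> g i \<in> KN) \<and> t = (\<lambda>z. \<Sum>i<n. tensor_fun (f i) (g i) z)} \<noteq> {}"
      by (rule ex_in_conv[THEN iffD1], rule exI, rule CollectI, rule exI[of _ n0], rule exI[of _ f0], rule exI[of _ g0])
        (rule conjI[OF refl conjI[OF rep0]])
    fix v assume "v \<in> {\<Sum>i<n. (\<Sum>a\<in>{(\<gamma>, m)}. qM a (f i)) * (\<Sum>b\<in>{(\<omega>, m)}. qN b (g i)) | (n::nat) f g.
       (\<forall>i<n. f i \<in> KM \<and> g i \<in> KN) \<and> t = (\<lambda>z. \<Sum>i<n. tensor_fun (f i) (g i) z)}"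
    then obtain n :: nat and f g where v: "v = (\<Sum>i<n. qM (\<gamma>, m) (f i) * qN (\<omega>, m) (g i))"
      and fg: "\<forall>i<n. f i \<in> KM \<and> g i \<in> KN" and t: "t = (\<lambda>z. \<Sum>i<n. tensor_fun (f i) (g i) z)"
      by auto
    have "qW ((\<gamma>, \<omega>), m) (\<lambda>z. \<Sum>i<n. tensor_fun (f i) (g i) z)
        \<le> (\<Sum>i<n. qM (\<gamma>, m) (f i) * qN (\<omega>, m) (g i))"
      using fg
    proof (induction n)
      case 0
      show ?case by (simp add: K_seminorm_zero[OF W])
    next
      case (Suc n)
      have "qW ((\<gamma>, \<omega>), m) (\<lambda>z. (\<Sum>i<n. tensor_fun (f i) (g i) z) + tensor_fun (f n) (g n) z)
         \<le> qW ((\<gamma>, \<omega>), m) (\<lambda>z. \<Sum>i<n. tensor_fun (f i) (g i) z) + qW ((\<gamma>, \<omega>), m) (tensor_fun (f n) (g n))"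
        using Suc.prems by (intro K_seminorm_add[OF W] K_space_sum[OF W] tensor_fun_K_space) auto
      also have "\<dots> \<le> (\<Sum>i<n. qM (\<gamma>, m) (f i) * qN (\<omega>, m) (g i))
          + qM (\<gamma>, m) (f n) * qN (\<omega>, m) (g n)"
        using Suc by (intro add_mono K_seminorm_tensor_fun) auto
      finally show ?case by simp
    qed
    then show "qW ((\<gamma>, \<omega>), m) t \<le> v" by (simp only: t v)
  qed
qed

lemma proj_seminorm_le:
  assumes "proj_rep (KM) (\<lambda>f. \<Sum>a\<in>I. qM a f) (KN) (\<lambda>g. \<Sum>b\<in>J. qN b g) t c"
  shows "proj_sn I J t \<le> c"
proof -
  obtain n :: nat and f g where fg: "\<forall>i<n. f i \<in> KM \<and> g i \<in> KN" "t = (\<lambda>z. \<Sum>i<n. tensor_fun (f i) (g i) z)"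
    and c: "(\<Sum>i<n. (\<Sum>a\<in>I. qM a (f i)) * (\<Sum>b\<in>J. qN b (g i))) \<le> c"
    using assms unfolding proj_rep_def by blast
  show ?thesis
    unfolding proj_seminorm_def
  proof (rule cInf_lower2[OF _ c])
    show "(\<Sum>i<n. (\<Sum>a\<in>I. qM a (f i)) * (\<Sum>b\<in>J. qN b (g i))) \<in>
       {\<Sum>i<n. (\<Sum>a\<in>I. qM a (f i)) * (\<Sum>b\<in>J. qN b (g i)) | (n::nat) f g.
       (\<forall>i<n. f i \<in> KM \<and> g i \<in> KN) \<and> t = (\<lambda>z. \<Sum>i<n. tensor_fun (f i) (g i) z)}"
      by (rule CollectI, rule exI[of _ n], rule exI[of _ f], rule exI[of _ g]) (rule conjI[OF refl conjI[OF fg]])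
    show "bdd_below {\<Sum>i<n. (\<Sum>a\<in>I. qM a (f i)) * (\<Sum>b\<in>J. qN b (g i)) | (n::nat) f g.
       (\<forall>i<n. f i \<in> KM \<and> g i \<in> KN) \<and> t = (\<lambda>z. \<Sum>i<n. tensor_fun (f i) (g i) z)}"
      by (rule bdd_belowI[of _ 0])
        (auto intro!: sum_nonneg mult_nonneg_nonneg K_seminorm_nonneg[OF M] K_seminorm_nonneg[OF N])
  qed
qed

context
  assumes nuclear: "\<And>k. \<exists>k' C. \<forall>\<epsilon>>0. \<exists>T. nuclear_op (KN) (qN k') (qN k) T C \<and>
           (\<forall>g\<in>KN. qN k (\<lambda>y. g y - T g y) \<le> \<epsilon> * qN k' g)"
begin

lemma tensor_sums_dense:
  assumes h: "h \<in> KW" and K: "finite K" and "\<epsilon> > 0"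
  shows "\<exists>t\<in>TS. (\<Sum>k\<in>K. qW k (\<lambda>z. h z - t z)) < \<epsilon>"
proof -
  obtain \<gamma>\<omega> m C where C: "0 \<le> C" "\<And>f. f \<in> KW \<Longrightarrow> (\<Sum>k\<in>K. qW k f) \<le> C * qW (\<gamma>\<omega>, m) f"
    using sum_K_seminorm_le[OF K W] by blast
  obtain \<gamma> \<omega> where \<gamma>\<omega>: "\<gamma>\<omega> = (\<gamma>, \<omega>)" by fastforce
  obtain k' B where nuc: "\<And>\<epsilon>. \<epsilon> > 0 \<Longrightarrow> \<exists>T. nuclear_op (KN) (qN k') (qN (\<omega>, m)) T B \<and>
           (\<forall>g\<in>KN. qN (\<omega>, m) (\<lambda>y. g y - T g y) \<le> \<epsilon> * qN k' g)"
    using nuclear[of "(\<omega>, m)"] by blast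
  obtain \<omega>' m' where k': "k' = (\<omega>', m')" by fastforce
  let ?S = "qW ((\<gamma>, \<omega>'), m + m') h"
  have S: "0 \<le> C * ?S" using C(1) K_seminorm_nonneg[OF W h] by simp
  \<comment> \<open>The summand 1 keeps the denominator positive and makes the final estimate
    strict.\<close>
  define \<epsilon>' where "\<epsilon>' = \<epsilon> / (C * ?S + 1)"
  have \<epsilon>': "\<epsilon>' > 0" using S \<open>\<epsilon> > 0\<close> by (simp add: \<epsilon>'_def)
  obtain T where T: "nuclear_op (KN) (qN (\<omega>', m')) (qN (\<omega>, m)) T B"
    "\<And>g. g \<in> KN \<Longrightarrow> qN (\<omega>, m) (\<lambda>y. g y - T g y) \<le> \<epsilon>' * qN (\<omega>', m') g"
    using nuc[OF \<epsilon>'] unfolding k' by blast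
  \<comment> \<open>Only membership in the tensor sums is wanted, so the cost estimate is made
    trivial by taking zero for both seminorms.\<close>
  have t: "apply_right T h \<in> TS"
    by (rule proj_rep_tensor_sums[OF apply_right_proj_rep[OF T(1) h, where P = "\<lambda>_. 0" and Q = "\<lambda>_. 0" and C = 0 and D = 0]]) auto
  have "(\<Sum>k\<in>K. qW k (\<lambda>z. h z - apply_right T h z)) \<le> C * qW ((\<gamma>, \<omega>), m) (\<lambda>z. h z - apply_right T h z)"
    using C(2)[OF K_space_diff[OF W h tensor_sums_K_space[OF t]]] by (simp add: \<gamma>\<omega>)
  also have "\<dots> \<le> C * (\<epsilon>' * ?S)"
    using \<epsilon>' by (intro mult_left_mono K_seminorm_apply_right[OF T(1) nuc_mem[OF N T(1)] h T(2)] C) auto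
  also have "\<dots> = \<epsilon> * (C * ?S) / (C * ?S + 1)" by (simp add: \<epsilon>'_def)
  also have "\<dots> < \<epsilon>" using S \<open>\<epsilon> > 0\<close> by (simp add: pos_divide_less_eq)
  finally show ?thesis using t by blast
qed

text \<open>\<open>t\<close> is \<open>(1 \<otimes> T) t\<close> plus the sum of the tensors of
  \<open>f i\<close> with \<open>g i - T (g i)\<close>. The first part costs
  \<open>C1 * C2 * B\<close> times a seminorm of \<open>t\<close>, the second at most
  \<open>\<epsilon> * S\<close>, where \<open>S\<close> depends on the representation of
  \<open>t\<close>. Since \<open>B\<close> does not depend on \<open>\<epsilon>\<close>, a small
  \<open>\<epsilon>\<close> disposes of \<open>S\<close>.\<close>

lemma proj_seminorm_bound:
  assumes I: "finite I" and J: "finite J"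
  shows "\<exists>K C. finite K \<and> (\<forall>t\<in>TS.
    proj_sn I J t \<le> C * (\<Sum>k\<in>K. qW k t))"
proof -
  let ?P = "\<lambda>f. \<Sum>a\<in>I. qM a f" and ?Q = "\<lambda>g. \<Sum>b\<in>J. qN b g"
  let ?\<pi> = "proj_sn I J"
  obtain \<gamma> m C1 where C1: "0 \<le> C1" "\<And>f. f \<in> KM \<Longrightarrow> ?P f \<le> C1 * qM (\<gamma>, m) f"
    using sum_K_seminorm_le[OF I M] by blast
  obtain \<omega> m0 C2 where C2: "0 \<le> C2" "\<And>g. g \<in> KN \<Longrightarrow> ?Q g \<le> C2 * qN (\<omega>, m0) g"
    using sum_K_seminorm_le[OF J N] by blast
  have P0: "0 \<le> ?P f" if "f \<in> KM" for f by (intro sum_nonneg K_seminorm_nonneg[OF M that])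
  have Q0: "0 \<le> ?Q g" if "g \<in> KN" for g by (intro sum_nonneg K_seminorm_nonneg[OF N that])
  obtain k' B where nuc: "\<And>\<epsilon>. \<epsilon> > 0 \<Longrightarrow> \<exists>T. nuclear_op (KN) (qN k') (qN (\<omega>, m0)) T B \<and>
           (\<forall>g\<in>KN. qN (\<omega>, m0) (\<lambda>y. g y - T g y) \<le> \<epsilon> * qN k' g)"
    using nuclear[of "(\<omega>, m0)"] by blast
  obtain \<omega>' m' where k': "k' = (\<omega>', m')" by fastforce
  let ?k = "((\<gamma>, \<omega>'), m + m')"
  have "?\<pi> t \<le> C1 * C2 * B * (\<Sum>k\<in>{?k}. qW k t)"
    if t: "t \<in> TS" for t
  proof (rule field_le_epsilon)
    fix e :: real assume "e > 0"
    obtain n :: nat and f g where fg: "\<forall>i<n. f i \<in> KM \<and> g i \<in> KN" and t_eq: "t = (\<lambda>z. \<Sum>i<n. tensor_fun (f i) (g i) z)"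
      using t unfolding tensor_sums_def by blast
    define S where "S = (\<Sum>i<n. ?P (f i) * (C2 * qN k' (g i)))"
    have S: "0 \<le> S" unfolding S_def using fg C2(1)
      by (intro sum_nonneg mult_nonneg_nonneg P0 K_seminorm_nonneg[OF N]) auto
    define \<epsilon> where "\<epsilon> = e / (S + 1)"
    have \<epsilon>: "\<epsilon> > 0" "\<epsilon> * S \<le> e" using S \<open>e > 0\<close> by (simp_all add: \<epsilon>_def field_simps)
    obtain T where T: "nuclear_op (KN) (qN k') (qN (\<omega>, m0)) T B"
      "\<And>g. g \<in> KN \<Longrightarrow> qN (\<omega>, m0) (\<lambda>y. g y - T g y) \<le> \<epsilon> * qN k' g"
      using nuc[OF \<epsilon>(1)] by blast
    let ?r = "\<lambda>i y. g i y - T (g i) y"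
    have r: "\<forall>i<n. f i \<in> KM \<and> ?r i \<in> KN"
      using fg by (auto intro!: K_space_diff[OF N] nuc_mem[OF N T(1)])
    have "(\<lambda>z. apply_right T t z + (\<Sum>i<n. tensor_fun (f i) (?r i) z)) = t"
      by (auto simp: fun_eq_iff t_eq apply_right_def nuclear_op_sum_arg[OF T(1)] right_diff_distrib sum_subtractf)
    moreover have "proj_rep (KM) ?P (KN) ?Q (\<lambda>z. apply_right T t z + (\<Sum>i<n. tensor_fun (f i) (?r i) z))
       (C1 * C2 * (B * qW ?k t) + (\<Sum>i<n. ?P (f i) * ?Q (?r i)))"
      by (intro proj_rep_plus apply_right_proj_rep[OF T(1)[unfolded k'] tensor_sums_K_space[OF t]] C1 C2 Q0 r)
    ultimately have "?\<pi> t \<le> C1 * C2 * (B * qW ?k t) + (\<Sum>i<n. ?P (f i) * ?Q (?r i))"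
      by (intro proj_seminorm_le) simp
    also have "(\<Sum>i<n. ?P (f i) * ?Q (?r i)) \<le> (\<Sum>i<n. \<epsilon> * (?P (f i) * (C2 * qN k' (g i))))"
    proof (rule sum_mono)
      fix i assume "i \<in> {..<n}"
      then have i: "f i \<in> KM" "g i \<in> KN" "?r i \<in> KN" using fg r by auto
      have "?Q (?r i) \<le> C2 * (\<epsilon> * qN k' (g i))"
        by (rule order_trans[OF C2(2)[OF i(3)] mult_left_mono[OF T(2)[OF i(2)] C2(1)]])
      from mult_left_mono[OF this P0[OF i(1)]]
      show "?P (f i) * ?Q (?r i) \<le> \<epsilon> * (?P (f i) * (C2 * qN k' (g i)))" by (simp add: mult_ac)
    qed
    also have "\<dots> = \<epsilon> * S" by (simp add: S_def sum_distrib_left)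
    also have "\<dots> \<le> e" by (rule \<epsilon>(2))
    finally show "?\<pi> t \<le> C1 * C2 * B * (\<Sum>k\<in>{?k}. qW k t) + e" by (simp add: mult.assoc)
  qed
  then show ?thesis by (intro exI[of _ "{?k}"] exI[of _ "C1 * C2 * B"]) auto
qed

end

end

theorem theorem3p6:
  fixes M :: "'g \<Rightarrow> 'a::euclidean_space \<Rightarrow> real"
    and N :: "'w \<Rightarrow> 'b::euclidean_space \<Rightarrow> real"
  assumes "defining_family M" and "defining_family N"
    and condI: "\<forall>\<omega>. \<exists>\<omega>' L. bounded (range L) \<and> integrable lebesgue L \<and> (\<forall>y. 0 \<le> L y) \<and>
                 (\<forall>y. N \<omega> y \<le> L y * N \<omega>' y) \<and> (L \<longlongrightarrow> 0) at_infinity"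
    and condII: "\<forall>\<omega>. \<exists>\<omega>' B C. open B \<and> 0 \<in> B \<and> C > 0 \<and>
                 (\<forall>y y'. y' \<in> B \<longrightarrow> N \<omega> y \<le> C * N \<omega>' (y + y'))"
  shows "completed_proj_tensor (K_space M) (K_seminorm M) (K_space N) (K_seminorm N)
           (K_space (tensor_family M N)) (K_seminorm (tensor_family M N))
           (\<lambda>f g. \<lambda>(x, y). f x * g y)"
proof -
  have M: "weight_family M" and N: "weight_family N"
    using assms(1,2) by (auto intro: defining_family_weight)
  have bdd: "bdd_above (N \<omega> ` S)" if "bounded S" for \<omega> S
  proof -
    have "\<forall>\<omega> S. bounded S \<longrightarrow> bdd_above (N \<omega> ` S)"
      using assms(2) unfolding defining_family_def by (elim conjE)
    then show ?thesis using that by simp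
  qed
  note nuclear = nuclear_approximation[OF N bdd condI condII]
  note W = weight_family_tensor[OF M N]
  let ?\<Phi> = "tensor_fun :: ('a \<Rightarrow> complex) \<Rightarrow> ('b \<Rightarrow> complex) \<Rightarrow> 'a \<times> 'b \<Rightarrow> complex"
  let ?W = "tensor_family M N"
  let ?sums = "tensor_sums (K_space M) (K_space N) ?\<Phi>"
  let ?\<pi> = "proj_seminorm (K_space M) (K_seminorm M) (K_space N) (K_seminorm N) ?\<Phi>"
  show ?thesis
    unfolding completed_proj_tensor_def
  proof (intro conjI seminormed_K_space hausdorff_K_space complete_K_space M N W)
    show "\<forall>f\<in>K_space M. \<forall>g\<in>K_space N. (\<lambda>(x, y). f x * g y) \<in> K_space ?W"
      using tensor_fun_K_space[OF M N] by blast
    show "\<forall>(n::nat) f g. (\<forall>i<n. f i \<in> K_space M \<and> g i \<in> K_space N) \<and>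
        (\<forall>c. (\<lambda>x. \<Sum>i<n. c i * f i x) = (\<lambda>x. 0) \<longrightarrow> (\<forall>i<n. c i = 0)) \<and>
        (\<lambda>z. \<Sum>i<n. (\<lambda>(x, y). f i x * g i y) z) = (\<lambda>z. 0) \<longrightarrow> (\<forall>i<n. g i = (\<lambda>y. 0))"
    proof (intro allI impI ext, elim conjE)
      fix n :: nat and f :: "nat \<Rightarrow> 'a \<Rightarrow> complex" and g :: "nat \<Rightarrow> 'b \<Rightarrow> complex" and i y
      assume i: "i < n"
        and indep: "\<forall>c. (\<lambda>x. \<Sum>i<n. c i * f i x) = (\<lambda>x. 0) \<longrightarrow> (\<forall>i<n. c i = 0)"
        and z: "(\<lambda>z. \<Sum>i<n. (\<lambda>(x, y). f i x * g i y) z) = (\<lambda>z. 0)"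
      \<comment> \<open>For fixed \<open>y\<close> the hypothesis is a linear relation among the
        \<open>f i\<close> with coefficients \<open>g i y\<close>.\<close>
      have "(\<lambda>x. \<Sum>i<n. g i y * f i x) = (\<lambda>x. 0)"
        using fun_cong[OF z, of "(x, y)" for x] by (simp add: mult.commute)
      then show "g i y = 0" using indep[rule_format, of "\<lambda>i. g i y"] i by blast
    qed
    show "\<forall>h\<in>K_space ?W. \<forall>K \<epsilon>. finite K \<and> \<epsilon> > 0 \<longrightarrow>
        (\<exists>t\<in>?sums.
          (\<Sum>k\<in>K. K_seminorm ?W k (\<lambda>z. h z - t z)) < \<epsilon>)"
      using tensor_sums_dense[OF M N nuclear] by blast
    show "\<forall>k. \<exists>I J C. finite I \<and> finite J \<and>
        (\<forall>t\<in>?sums. K_seminorm ?W k t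
          \<le> C * ?\<pi> I J t)"
    proof
      fix k :: "('g \<times> 'w) \<times> nat"
      obtain \<gamma> \<omega> m where k: "k = ((\<gamma>, \<omega>), m)" by (metis surj_pair)
      show "\<exists>I J C. finite I \<and> finite J \<and>
        (\<forall>t\<in>?sums. K_seminorm ?W k t
          \<le> C * ?\<pi> I J t)"
        using K_seminorm_le_proj_seminorm[OF M N, of _ \<gamma> \<omega> m] unfolding k
        by (intro exI[of _ "{(\<gamma>, m)}"] exI[of _ "{(\<omega>, m)}"] exI[of _ 1]) auto
    qed
    show "\<forall>I J. finite I \<and> finite J \<longrightarrow> (\<exists>K C. finite K \<and>
        (\<forall>t\<in>?sums.
          ?\<pi> I J t
            \<le> C * (\<Sum>k\<in>K. K_seminorm ?W k t)))"
      using proj_seminorm_bound[OF M N nuclear] by blast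
  qed (auto simp: fun_eq_iff algebra_simps)
qed

end
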